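(* Consider the marked Hawkes process described in the context, either in its nonstationary version $N$ or in its stationary version $N^*$, and let $S(t)$ denote the corresponding total claim amount, $S(t)=\int_{[0,t]\times\mathbb{S}}f(a)\,N(ds,da)$ or $S(t)=\int_{[0,t]\times\mathbb{S}}f(a)\,N^*(ds,da)$ respectively. Assume $\kappa<1$, $\mathbb{E}X^2<\infty$ and $\mathbb{E}[\kappa_A^2]<\infty$. If $$\sqrt t\ \mathbb{E}[\tilde\mu_A(t,\infty)]\to0,\qquad t\to\infty,$$ then, in either the stationary or the nonstationary case, with $\mu_D=\mathbb{E}D$, $$\frac{S(t)-t\,\nu\,\mu_D}{\sqrt{t\,\nu\,\mathbb{E}D^2}}\ \stackrel{d}{\longrightarrow}\ N(0,1),\qquad t\to\infty.$$
   Context: Marked Hawkes process. Let $\mathbb{S}$ be a completely metrizable separable space with Borel $\sigma$-algebra, $Q$ a probability measure on $\mathbb{S}$, $\nu>0$, and $h:[0,\infty)\times\mathbb{S}\to[0,\infty)$ measurable. Let $A\sim Q$ be a generic mark and put $\tilde\mu_A(B)=\int_B h(s,A)\,ds$, $\kappa_A=\tilde\mu_A([0,\infty))=\int_0^\infty h(s,A)\,ds$, $\tilde\mu_A(t,\infty)=\int_t^\infty h(s,A)\,ds$, and $\kappa=\mathbb{E}\kappa_A$. For a mark $a$, the cascade $G^a$ is the random point measure on $[0,\infty)\times\mathbb{S}$ defined recursively (generation by generation) by $G^a=\sum_{l=1}^{L_a}\big(\delta_{\tau_l^1,A_l^1}+\theta_{\tau_l^1}G^{A_l^1}\big)$, where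 $\sum_{l=1}^{L_a}\delta_{\tau^1_l,A^1_l}$ is a Poisson process on $[0,\infty)\times\mathbb{S}$ with mean measure $\tilde\mu_a\times Q$, the cascades $G^{A_l^1}$ are, given this Poisson process, independent with laws those of cascades started from the marks $A_l^1$, and $\theta_t$ shifts times by $t$: $\theta_t\sum_j\delta_{t_j,a_j}=\sum_j\delta_{t_j+t,a_j}$. Under $\kappa<1$ the clusters below are a.s. finite with finite mean size. Let $N^0=\sum_{i\ge1}\delta_{\Gamma_i,A_i}$ be a Poisson process on $[0,\infty)\times\mathbb{S}$ with intensity $(\nu\,\mathrm{Leb})\times Q$; given $N^0$, let $G^{A_i}=\sum_{j=1}^{K_i}\delta_{T_{ij},A_{ij}}$ be independent cascades started from the marks $A_i$, and put $T_{i0}=0$, $A_{i0}=A_i$. The nonstationary marked Hawkes process is $N=\sum_{i}\sum_{j=0}^{K_i}\delta_{\Gamma_i+T_{ij},A_{ij}}$. The stationary version $N^*$ is obtained by the same construction starting from a Poisson process with intensity $(\nu\,\mathrm{Leb})\times Q$ on $\mathbb{R}\times\mathbb{S}$. Let $f:\mathbb{S}\to[0,\infty)$ be measurable; $X=f(A)$ is the generic claim size (with the same mark $A$ as in $\kappa_A$), and $D$ has the law of the cluster total $D_i=\sum_{j=0}^{K_i}f(A_{ij})$. *)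

theory Defs
  imports "HOL-Probability.Probability"
begin

section \<open>Poisson processes\<close>

text \<open>
  A point measure $\sum_{i \in I} \delta_{x_i}$ is rendered throughout as the image
  \<open>distr (count_space I) borel x\<close> of the counting measure on the (countable) index set \<open>I\<close>.
\<close>

lemma emeasure_point_measure:
  assumes "B \<in> sets N" and "x \<in> I \<rightarrow> space N"
  shows "emeasure (distr (count_space I) N x) B = emeasure (count_space UNIV) {i \<in> I. x i \<in> B}"
proof -
  have "emeasure (distr (count_space I) N x) B = emeasure (count_space I) {i \<in> I. x i \<in> B}"
    using assms by (subst emeasure_distr) (auto intro!: arg_cong[where f="emeasure _"])
  also have "\<dots> = emeasure (count_space UNIV) {i \<in> I. x i \<in> B}"
    by (cases "finite {i \<in> I. x i \<in> B}")
       (simp_all add: emeasure_count_space_finite emeasure_count_space_infinite)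
  finally show ?thesis .
qed

text \<open>
  The weight of \<open>k\<close> under the Poisson law with mean \<open>r\<close>, with the usual conventions that mean \<open>0\<close>
  gives the point mass at \<open>0\<close> and mean \<open>\<infinity>\<close> the point mass at \<open>\<infinity>\<close>.
  (The library's \<open>poisson_pmf\<close> is only specified for means in \<open>(0, \<infinity>)\<close>.)
\<close>

definition poisson_weight :: "ennreal \<Rightarrow> nat \<Rightarrow> real" where
  "poisson_weight r k = (if r = \<infinity> then 0 else enn2real r ^ k / fact k * exp (- enn2real r))"

definition poisson_process :: "'w measure \<Rightarrow> 'b measure \<Rightarrow> ('w \<Rightarrow> 'b measure) \<Rightarrow> bool" where
  "poisson_process M \<Lambda> \<eta> \<longleftrightarrow>
     (\<forall>B\<in>sets \<Lambda>. (\<lambda>\<omega>. emeasure (\<eta> \<omega>) B) \<in> borel_measurable M) \<and>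
     (\<forall>B\<in>sets \<Lambda>. \<forall>k::nat.
        measure M {\<omega>\<in>space M. emeasure (\<eta> \<omega>) B = of_nat k} = poisson_weight (emeasure \<Lambda> B) k) \<and>
     (\<forall>(m::nat) B. (\<forall>j<m. B j \<in> sets \<Lambda>) \<and> disjoint_family_on B {..<m} \<longrightarrow>
        prob_space.indep_vars M (\<lambda>_. borel) (\<lambda>j \<omega>. emeasure (\<eta> \<omega>) (B j)) {..<m})"


section \<open>Cascades\<close>

text \<open>
  Individuals of a cascade are labelled by lists of naturals: \<open>[]\<close> is the ancestor and
  \<open>u @ [l]\<close> is the \<open>l\<close>-th child of \<open>u\<close>, which exists iff \<open>u\<close> exists and \<open>l < children x u\<close>.
  \<open>delay x u\<close> is the time between the births of the parent of \<open>u\<close> and of \<open>u\<close>.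
  The values at non-existing labels, and \<open>delay x []\<close>, are dummies (say constants).
\<close>

record 'a cascade_tree =
  children :: "nat list \<Rightarrow> enat"
  delay :: "nat list \<Rightarrow> real"
  mark :: "nat list \<Rightarrow> 'a"

definition subtree :: "'a cascade_tree \<Rightarrow> nat \<Rightarrow> 'a cascade_tree" where
  "subtree x l = \<lparr>children = (\<lambda>u. children x (l # u)), delay = (\<lambda>u. delay x (l # u)),
     mark = (\<lambda>u. mark x (l # u))\<rparr>"

primrec exists_in :: "nat list \<Rightarrow> 'a cascade_tree \<Rightarrow> bool" where
  "exists_in [] x \<longleftrightarrow> True"
| "exists_in (l # u) x \<longleftrightarrow> enat l < children x [] \<and> exists_in u (subtree x l)"

definition individuals :: "'a cascade_tree \<Rightarrow> nat list set" where
  "individuals x = {u. exists_in u x}"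

primrec birth :: "nat list \<Rightarrow> 'a cascade_tree \<Rightarrow> real" where
  "birth [] x = 0"
| "birth (l # u) x = delay x [l] + birth u (subtree x l)"

definition offspring :: "'a::topological_space cascade_tree \<Rightarrow> nat list \<Rightarrow> (real \<times> 'a) measure" where
  "offspring x u = distr (count_space {l. enat l < children x u}) borel
     (\<lambda>l. (delay x (u @ [l]), mark x (u @ [l])))"

definition cascade :: "'a::topological_space cascade_tree \<Rightarrow> (real \<times> 'a) measure" where
  "cascade x = distr (count_space (individuals x - {[]})) borel (\<lambda>u. (birth u x, mark x u))"

definition time_shift :: "real \<Rightarrow> (real \<times> 'a::topological_space) measure \<Rightarrow> (real \<times> 'a) measure" where
  "time_shift t G = distr G borel (\<lambda>(s, a). (s + t, a))"

text \<open>
  The recursion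
  $G^a = \sum_{l=1}^{L_a} (\delta_{\tau_l^1,A_l^1} + \theta_{\tau_l^1} G^{A_l^1})$
  holds pathwise:
\<close>

lemma cascade_recursion:
  fixes x :: "'a::topological_space cascade_tree"
  assumes B: "B \<in> sets borel"
  shows "emeasure (cascade x) B =
    (\<Sum>l. if enat l < children x []
         then indicator B (delay x [l], mark x [l])
              + emeasure (time_shift (delay x [l]) (cascade (subtree x l))) B
         else 0)"
proof -
  let ?p = "\<lambda>u. (birth u x, mark x u)"
  define C where "C l = {u \<in> individuals x. ?p u \<in> B \<and> (\<exists>v. u = l # v)}" for l
  have sh: "(\<lambda>(s, a). (s + t, a)) \<in> borel_measurable borel" for t :: real
    unfolding split_beta by (intro borel_measurable_continuous_onI continuous_intros)
  have "emeasure (cascade x) B = emeasure (count_space UNIV) {u \<in> individuals x - {[]}. ?p u \<in> B}"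
    unfolding cascade_def using B by (intro emeasure_point_measure) auto
  also have "{u \<in> individuals x - {[]}. ?p u \<in> B} = (\<Union>l. C l)"
    by (auto simp: C_def neq_Nil_conv)
  also have "emeasure (count_space UNIV) (\<Union>l. C l) = (\<Sum>l. emeasure (count_space UNIV) (C l))"
    by (rule suminf_emeasure[symmetric]) (auto simp: disjoint_family_on_def C_def)
  also have "\<dots> = (\<Sum>l. if enat l < children x []
         then indicator B (delay x [l], mark x [l])
              + emeasure (time_shift (delay x [l]) (cascade (subtree x l))) B
         else 0)"
  proof (rule suminf_cong)
    fix l
    show "emeasure (count_space UNIV) (C l) = (if enat l < children x []
         then indicator B (delay x [l], mark x [l])
              + emeasure (time_shift (delay x [l]) (cascade (subtree x l))) B
         else 0)"
    proof (cases "enat l < children x []")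
      case False
      then have "C l = {}" by (auto simp: C_def individuals_def)
      with False show ?thesis by simp
    next
      case True
      let ?q = "\<lambda>u. (birth u (subtree x l) + delay x [l], mark (subtree x l) u)"
      define C0 :: "nat list set" where "C0 = {u. u = [] \<and> (delay x [l], mark x [l]) \<in> B}"
      define C1 where "C1 = {u \<in> individuals (subtree x l) - {[]}. ?q u \<in> B}"
      have Cl: "C l = (#) l ` (C0 \<union> C1)"
        using True by (auto simp: C_def C0_def C1_def individuals_def subtree_def add.commute)
      have "emeasure (count_space UNIV) (C l) = emeasure (count_space UNIV) (C0 \<union> C1)"
        unfolding Cl by (auto simp: emeasure_count_space card_image finite_image_iff)
      also have "\<dots> = emeasure (count_space UNIV) C0 + emeasure (count_space UNIV) C1"
        by (rule plus_emeasure[symmetric]) (auto simp: C0_def C1_def)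
      also have "emeasure (count_space UNIV) C0 = indicator B (delay x [l], mark x [l])"
        by (auto simp: C0_def indicator_def)
      also have "emeasure (count_space UNIV) C1
          = emeasure (time_shift (delay x [l]) (cascade (subtree x l))) B"
      proof -
        have "time_shift (delay x [l]) (cascade (subtree x l))
            = distr (count_space (individuals (subtree x l) - {[]})) borel ?q"
          unfolding time_shift_def cascade_def
          by (subst distr_distr) (auto simp: sh comp_def)
        then show ?thesis using B by (simp add: emeasure_point_measure C1_def)
      qed
      finally show ?thesis using True by simp
    qed
  qed
  finally show ?thesis .
qed


section \<open>The law of cascades\<close>

definition fertility :: "(real \<Rightarrow> 'a \<Rightarrow> real) \<Rightarrow> 'a \<Rightarrow> real measure" where
  "fertility h a = density lborel (\<lambda>s. ennreal (h s a) * indicator {0..} s)"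

definition kappa :: "(real \<Rightarrow> 'a \<Rightarrow> real) \<Rightarrow> 'a \<Rightarrow> ennreal" where
  "kappa h a = emeasure (fertility h a) {0..}"

text \<open>
  The information in \<open>\<G>\<close> and in the first \<open>n\<close> generations of all trees \<open>W i\<close>, \<open>i \<in> I\<close>.
\<close>

definition history :: "'w measure \<Rightarrow> 'w measure \<Rightarrow> 'i set \<Rightarrow>
    ('i \<Rightarrow> 'w \<Rightarrow> 'a::topological_space cascade_tree) \<Rightarrow> nat \<Rightarrow> 'w measure" where
  "history M \<G> I W n = sigma (space M) (sets \<G>
     \<union> {(\<lambda>\<omega>. children (W i \<omega>) u) -` S \<inter> space M | i u S. i \<in> I \<and> length u < n}
     \<union> {(\<lambda>\<omega>. delay (W i \<omega>) u) -` S \<inter> space M | i u S.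
          i \<in> I \<and> 1 \<le> length u \<and> length u \<le> n \<and> S \<in> sets borel}
     \<union> {(\<lambda>\<omega>. mark (W i \<omega>) u) -` S \<inter> space M | i u S. i \<in> I \<and> length u \<le> n \<and> S \<in> sets borel})"

text \<open>
  Given \<open>\<G>\<close> and the ancestors' marks \<open>mark (W i) []\<close>, the trees \<open>W i\<close>, \<open>i \<in> I\<close>, are independent and
  \<open>W i\<close> is a cascade started from its ancestor's mark. Generation by generation: conditionally on
  the first \<open>n\<close> generations, the offspring processes of the individuals \<open>(i, u)\<close> of generation \<open>n\<close>
  are independent Poisson processes, that of an individual with mark \<open>a\<close> having mean measure
  \<open>fertility h a \<Otimes>\<^sub>M Q\<close>. The joint conditional law is expressed through the numbers of children
  \<open>k j\<close> that the individual \<open>p j\<close> has in the set \<open>B j\<close>; sets belonging to the same individual are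
  disjoint.
\<close>

definition independent_cascades :: "'w measure \<Rightarrow> 'a::polish_space measure \<Rightarrow>
    (real \<Rightarrow> 'a \<Rightarrow> real) \<Rightarrow> 'w measure \<Rightarrow> 'i set \<Rightarrow> ('i \<Rightarrow> 'w \<Rightarrow> 'a cascade_tree) \<Rightarrow> bool" where
  "independent_cascades M Q h \<G> I W \<longleftrightarrow>
     (\<forall>i\<in>I. \<forall>u. (\<lambda>\<omega>. children (W i \<omega>) u) \<in> measurable M (count_space UNIV)
              \<and> (\<lambda>\<omega>. delay (W i \<omega>) u) \<in> borel_measurable M
              \<and> (\<lambda>\<omega>. mark (W i \<omega>) u) \<in> borel_measurable M) \<and>
     (\<forall>n (m::nat) p B (k :: nat \<Rightarrow> nat).
        (\<forall>j<m. fst (p j) \<in> I \<and> length (snd (p j)) = n \<and> B j \<in> sets borel) \<and>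
        (\<forall>j<m. \<forall>j'<m. j \<noteq> j' \<and> p j = p j' \<longrightarrow> B j \<inter> B j' = {}) \<longrightarrow>
        (AE \<omega> in M.
           (\<forall>j<m. snd (p j) \<in> individuals (W (fst (p j)) \<omega>)) \<longrightarrow>
           real_cond_exp M (history M \<G> I W n)
             (indicator {\<omega> \<in> space M. \<forall>j<m.
                emeasure (offspring (W (fst (p j)) \<omega>) (snd (p j))) (B j) = of_nat (k j)}) \<omega>
           = (\<Prod>j<m. poisson_weight
                (emeasure (fertility h (mark (W (fst (p j)) \<omega>) (snd (p j))) \<Otimes>\<^sub>M Q) (B j)) (k j))))"


section \<open>Marked Hawkes processes\<close>

text \<open>
  \<open>J = {0..}\<close> gives the nonstationary process \<open>N\<close>, \<open>J = UNIV\<close> the stationary process \<open>N\<^sup>*\<close>.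
  The immigrants are the points \<open>(\<Gamma> i, mark (W i) [])\<close>; the label \<open>u = []\<close> contributes the immigrant
  itself to its cluster.
\<close>

definition hawkes_from :: "real set \<Rightarrow> 'w measure \<Rightarrow> real \<Rightarrow> 'a::polish_space measure \<Rightarrow>
    (real \<Rightarrow> 'a \<Rightarrow> real) \<Rightarrow> ('w \<Rightarrow> (real \<times> 'a) measure) \<Rightarrow> bool" where
  "hawkes_from J M \<nu> Q h N \<longleftrightarrow>
     (\<exists>(\<Gamma> :: nat \<Rightarrow> 'w \<Rightarrow> real) (W :: nat \<Rightarrow> 'w \<Rightarrow> 'a cascade_tree).
        (\<forall>i. \<Gamma> i \<in> borel_measurable M) \<and>
        poisson_process M (density lborel (\<lambda>s. ennreal \<nu> * indicator J s) \<Otimes>\<^sub>M Q)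
          (\<lambda>\<omega>. distr (count_space UNIV) borel (\<lambda>i. (\<Gamma> i \<omega>, mark (W i \<omega>) []))) \<and>
        independent_cascades M Q h
          (vimage_algebra (space M) (\<lambda>\<omega> i. \<Gamma> i \<omega>) (PiM UNIV (\<lambda>_. borel))) UNIV W \<and>
        (\<forall>\<omega>\<in>space M. N \<omega> =
           distr (count_space (SIGMA i:UNIV. individuals (W i \<omega>))) borel
             (\<lambda>(i, u). (\<Gamma> i \<omega> + birth u (W i \<omega>), mark (W i \<omega>) u))))"

definition marked_hawkes_process :: "'w measure \<Rightarrow> real \<Rightarrow> 'a::polish_space measure \<Rightarrow>
    (real \<Rightarrow> 'a \<Rightarrow> real) \<Rightarrow> ('w \<Rightarrow> (real \<times> 'a) measure) \<Rightarrow> bool" where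
  "marked_hawkes_process = hawkes_from {0..}"

definition stationary_marked_hawkes_process :: "'w measure \<Rightarrow> real \<Rightarrow> 'a::polish_space measure \<Rightarrow>
    (real \<Rightarrow> 'a \<Rightarrow> real) \<Rightarrow> ('w \<Rightarrow> (real \<times> 'a) measure) \<Rightarrow> bool" where
  "stationary_marked_hawkes_process = hawkes_from UNIV"

definition total_claims :: "('a::topological_space \<Rightarrow> real) \<Rightarrow> ('w \<Rightarrow> (real \<times> 'a) measure) \<Rightarrow>
    real \<Rightarrow> 'w \<Rightarrow> real" where
  "total_claims f N t \<omega> = set_lebesgue_integral (N \<omega>) ({0..t} \<times> UNIV) (\<lambda>(s, a). f a)"

text \<open>
  \<open>D\<close> has the law of the cluster totals $D_i$: it is realised on a single cluster whose ancestor's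
  mark has law \<open>Q\<close>. (A direct reading of $D_i$ from a Hawkes process would depend on how the
  immigrants are enumerated.)
\<close>

definition cluster_total :: "'v measure \<Rightarrow> 'a::polish_space measure \<Rightarrow> (real \<Rightarrow> 'a \<Rightarrow> real) \<Rightarrow>
    ('a \<Rightarrow> real) \<Rightarrow> ('v \<Rightarrow> real) \<Rightarrow> bool" where
  "cluster_total M Q h f D \<longleftrightarrow>
     (\<exists>W :: 'v \<Rightarrow> 'a cascade_tree.
        distr M borel (\<lambda>\<omega>. mark (W \<omega>) []) = Q \<and>
        independent_cascades M Q h (sigma (space M) {}) {()} (\<lambda>_. W) \<and>
        (\<forall>\<omega>\<in>space M. D \<omega> = (\<Sum>\<^sub>\<infinity>u\<in>individuals (W \<omega>). f (mark (W \<omega>) u))))"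


section \<open>Convergence in distribution along a filter\<close>

text \<open>The library's \<open>weak_conv_m\<close> only treats sequences; here the index is real time.\<close>

definition weak_conv_along :: "'t filter \<Rightarrow> ('t \<Rightarrow> real measure) \<Rightarrow> real measure \<Rightarrow> bool" where
  "weak_conv_along F Ms M \<longleftrightarrow>
     (\<forall>x. isCont (cdf M) x \<longrightarrow> ((\<lambda>t. cdf (Ms t) x) \<longlongrightarrow> cdf M x) F)"

lemma weak_conv_along_sequentially: "weak_conv_along sequentially = weak_conv_m"
  by (auto simp: fun_eq_iff weak_conv_along_def weak_conv_m_def weak_conv_def)

end

theory Submission
  imports Defs
begin

text \<open>
  The claims are grouped by cluster. Let \<open>C(t)\<close> (\<open>cluster_claims\<close>) be the sum of all claims, early or
  late, of the clusters whose immigrant arrives in \<open>[0, t]\<close>. It is a compound Poisson variable with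
  the law of \<open>D\<close> as jump law, so
  \<open>E exp (i \<theta> C(t)) = exp (\<nu> t (E exp (i \<theta> D) - 1))\<close> (\<open>char_cluster_claims\<close>), and the expansion of
  \<open>E exp (i \<theta> D)\<close> to second order at \<open>0\<close> yields the normal limit for \<open>C(t)\<close>
  (\<open>compound_poisson_exponent_LIMSEQ\<close>). The difference \<open>S(t) - C(t)\<close> only involves claims that are
  separated from their immigrant by one of the ends of \<open>[0, t]\<close>. Its absolute mean is at most a
  constant times \<open>\<integral>\<^sub>0\<^sup>t E \<mu>\<^sub>A(u, \<infinity>) du\<close>, which is of smaller order than \<open>sqrt t\<close> by hypothesis, so that
  \<open>S(t)\<close> has the same limit. The stationary and the nonstationary process are treated at once: all
  that matters is that immigrants arrive at rate at most \<open>\<nu>\<close> everywhere and at rate \<open>\<nu>\<close> on \<open>[0, t]\<close>.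

  The law of a family of cascades is only given generation by generation, through the joint
  conditional law of finitely many offspring counts. Two consequences are drawn from it. For a
  function \<open>\<psi>\<close> of the marks with values in the unit disc, the conditional expectation of the product
  of \<open>\<psi>\<close> over the next generation is the product over the present one of
  \<open>exp (\<kappa> (\<integral>\<psi> dQ - 1))\<close> (\<open>integral_prod_active_Suc\<close>); iterated from the last generation back to the
  roots, this gives the generating functional of the first \<open>n\<close> generations
  (\<open>generating_functional\<close>). Applied to the single cascade that defines \<open>D\<close> and to the clusters that
  make up \<open>C(t)\<close>, it expresses both characteristic functions by the same numbers, and no
  independence of entire trees has to be established. Secondly, sums over the next generation have
  the expected conditional means (\<open>campbell\<close>), which controls all first moments.

  That \<open>E D\<^sup>2\<close> is finite is also read off from the generating functional. The characteristic function
  of \<open>D\<close> satisfies \<open>\<phi>(\<theta>) = \<integral> exp (i \<theta> f + \<kappa> (\<phi>(\<theta>) - 1)) dQ\<close>; taking real parts and using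
  \<open>\<integral>\<kappa> dQ < 1\<close> shows that \<open>1 - Re \<phi>(\<theta>)\<close> is of order \<open>\<theta>\<^sup>2\<close>, and Fatou's lemma concludes
  (\<open>single_cluster_second_moment\<close>).
\<close>

section \<open>Random subsets of a countable set\<close>

lemma finite_iff_to_nat_bounded:
  "finite B \<longleftrightarrow> (\<exists>n. \<forall>i. i \<in> B \<longrightarrow> to_nat i < n)" for B :: "'i::countable set"
proof
  assume "finite B"
  then have "\<forall>i. i \<in> B \<longrightarrow> to_nat i < Suc (Max (to_nat ` B))" by (auto simp: less_Suc_eq_le)
  then show "\<exists>n. \<forall>i. i \<in> B \<longrightarrow> to_nat i < n" ..
next
  assume "\<exists>n. \<forall>i. i \<in> B \<longrightarrow> to_nat i < n"
  then obtain n where "\<forall>i. i \<in> B \<longrightarrow> to_nat i < n" ..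
  then have "to_nat ` B \<subseteq> {..<n}" by auto
  then have "finite (to_nat ` B)" by (rule finite_subset) auto
  then show "finite B" by (rule finite_imageD) (auto simp: inj_on_def)
qed

text \<open>
  Products over infinite sets are \<open>1\<close> by convention. Where the random set is finite, its product is
  the limit of the products over its elements with code below \<open>n\<close>.
\<close>
lemma borel_measurable_prod_random_set:
  fixes f :: "'i::countable \<Rightarrow> 'w \<Rightarrow> complex"
  assumes f [measurable]: "\<And>i. f i \<in> borel_measurable M"
    and A [measurable]: "\<And>i. Measurable.pred M (\<lambda>w. i \<in> A w)"
  shows "(\<lambda>w. \<Prod>i\<in>A w. f i w) \<in> borel_measurable M"
proof (rule borel_measurable_LIMSEQ_metric)
  have fin [simp]: "finite {i::'i. to_nat i < n}" for n
    by (subst finite_iff_to_nat_bounded) auto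
  let ?g = "\<lambda>n w. if finite (A w) then \<Prod>i\<in>{i. to_nat i < n}. if i \<in> A w then f i w else 1 else 1"
  show "?g n \<in> borel_measurable M" for n
    unfolding finite_iff_to_nat_bounded by measurable
  show "(\<lambda>n. ?g n w) \<longlonglongrightarrow> (\<Prod>i\<in>A w. f i w)" for w
  proof (cases "finite (A w)")
    case True
    then obtain m where m: "\<And>i. i \<in> A w \<Longrightarrow> to_nat i < m" unfolding finite_iff_to_nat_bounded by auto
    have "?g n w = (\<Prod>i\<in>A w. f i w)" if "m \<le> n" for n
    proof -
      have "?g n w = (\<Prod>i\<in>{i. to_nat i < n} \<inter> A w. f i w)"
        using True by (simp add: prod.inter_restrict)
      also have "{i. to_nat i < n} \<inter> A w = A w"
        using that by (auto intro: order_less_le_trans[OF m])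
      finally show ?thesis .
    qed
    then show ?thesis
      by (intro tendsto_eventually eventually_sequentiallyI[of m])
  qed simp
qed

abbreviation tally :: "'b set \<Rightarrow> ennreal" where
  "tally A \<equiv> emeasure (count_space UNIV) A"

lemma tally_eq_suminf:
  "tally B = (\<Sum>l. indicator B l)" for B :: "nat set"
  by (subst nn_integral_count_space_nat[symmetric]) simp

lemma measurable_tally_random_set [measurable (raw)]:
  fixes A :: "'w \<Rightarrow> nat set"
  assumes [measurable]: "\<And>l. Measurable.pred M (\<lambda>w. l \<in> A w)"
  shows "(\<lambda>w. tally (A w)) \<in> borel_measurable M"
  unfolding tally_eq_suminf by measurable

lemma tally_eq_of_nat:
  "finite A \<Longrightarrow> tally A = of_nat k \<longleftrightarrow> card A = k"
  by (simp add: emeasure_count_space_finite)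

lemma tally_cases:
  "tally A = \<infinity> \<or> tally A \<in> range of_nat"
  by (cases "finite A") (auto simp: emeasure_count_space_finite emeasure_count_space_infinite)

lemma (in sigma_finite_measure) nn_integral_count_space_pair:
  assumes [measurable]: "G \<in> borel_measurable (count_space (UNIV :: nat set) \<Otimes>\<^sub>M M)"
  shows "(\<integral>\<^sup>+x. G x \<partial>(count_space UNIV \<Otimes>\<^sub>M M)) = (\<integral>\<^sup>+w. (\<Sum>l. G (l, w)) \<partial>M)"
proof -
  have "(\<integral>\<^sup>+x. G x \<partial>(count_space UNIV \<Otimes>\<^sub>M M)) = (\<integral>\<^sup>+l. \<integral>\<^sup>+w. G (l, w) \<partial>M \<partial>count_space UNIV)"
    by (rule nn_integral_fst[symmetric]) measurable
  also have "\<dots> = (\<integral>\<^sup>+w. (\<Sum>l. G (l, w)) \<partial>M)"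
    by (subst nn_integral_count_space_nat, rule nn_integral_suminf[symmetric]) measurable
  finally show ?thesis .
qed

lemma (in prob_space) norm_expectation_le_1:
  fixes g :: "'a \<Rightarrow> complex"
  assumes [measurable]: "g \<in> borel_measurable M" and g: "\<And>a. norm (g a) \<le> 1"
  shows "norm (\<integral>a. g a \<partial>M) \<le> 1"
proof -
  have "norm (\<integral>a. g a \<partial>M) \<le> (\<integral>a. norm (g a) \<partial>M)" by (rule integral_norm_bound)
  also have "\<dots> \<le> 1"
    using g by (intro integral_le_const integrable_const_bound[where B=1]) auto
  finally show ?thesis .
qed

section \<open>Poisson weights\<close>

lemma poisson_weight_ennreal:
  "0 \<le> r \<Longrightarrow> poisson_weight (ennreal r) k = r ^ k / fact k * exp (- r)"
  by (simp add: poisson_weight_def)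

lemma poisson_weight_nonneg [simp]: "0 \<le> poisson_weight r k"
  by (simp add: poisson_weight_def)

lemma measurable_poisson_weight [measurable]:
  "(\<lambda>r. poisson_weight r k) \<in> borel_measurable borel"
  unfolding poisson_weight_def by measurable

lemma poisson_weight_gf_sums:
  fixes c :: complex
  assumes "0 \<le> r"
  shows "(\<lambda>k. of_real (poisson_weight (ennreal r) k) * c ^ k) sums exp (of_real r * (c - 1))"
proof -
  have "(\<lambda>k. exp (-r) *\<^sub>R ((of_real r * c) ^ k /\<^sub>R fact k)) sums (exp (-r) *\<^sub>R exp (of_real r * c))"
    by (intro sums_scaleR_right exp_converges)
  moreover have "exp (-r) *\<^sub>R exp (of_real r * c) = exp (of_real r * (c - 1))"
    by (simp add: scaleR_conv_of_real exp_of_real[symmetric] exp_add[symmetric] algebra_simps)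
  moreover have "(\<lambda>k. exp (-r) *\<^sub>R ((of_real r * c) ^ k /\<^sub>R fact k))
      = (\<lambda>k. of_real (poisson_weight (ennreal r) k) * c ^ k)"
    using assms by (auto simp: fun_eq_iff poisson_weight_ennreal scaleR_conv_of_real
        power_mult_distrib field_simps)
  ultimately show ?thesis by simp
qed

lemma poisson_weight_sums:
  assumes "0 \<le> r"
  shows "poisson_weight (ennreal r) sums 1"
proof -
  have "(\<lambda>k. complex_of_real (poisson_weight (ennreal r) k)) sums of_real 1"
    using poisson_weight_gf_sums[OF assms, of 1] by simp
  then show ?thesis by (simp only: sums_of_real_iff)
qed

lemma poisson_weight_le_1: "poisson_weight r k \<le> 1"
proof (cases r)
  case (real s)
  have "(\<Sum>i\<in>{k}. poisson_weight r i) \<le> suminf (poisson_weight r)"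
    unfolding real(2) using poisson_weight_sums[OF real(1)]
    by (intro sum_le_suminf) (auto simp: sums_iff)
  also have "\<dots> = 1"
    unfolding real(2) using poisson_weight_sums[OF real(1)] by (simp add: sums_iff)
  finally have "(\<Sum>i\<in>{k}. poisson_weight r i) \<le> 1" .
  then show ?thesis by simp
qed (simp add: poisson_weight_def)

lemma poisson_weight_mean:
  assumes "0 \<le> r"
  shows "(\<Sum>k. ennreal (poisson_weight (ennreal r) k) * of_nat k) = ennreal r"
proof -
  have "(\<lambda>k. r * poisson_weight (ennreal r) k) sums (r * 1)"
    by (intro sums_mult poisson_weight_sums assms)
  moreover have "r * poisson_weight (ennreal r) k
      = poisson_weight (ennreal r) (Suc k) * real (Suc k)" for k
    using assms by (simp add: poisson_weight_ennreal del: of_nat_Suc)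
  ultimately have "(\<lambda>k. poisson_weight (ennreal r) (Suc k) * real (Suc k)) sums r"
    by simp
  then have "(\<lambda>k. poisson_weight (ennreal r) k * real k) sums r"
    by (subst (asm) sums_Suc_iff) simp
  then have "(\<Sum>k. ennreal (poisson_weight (ennreal r) k * real k)) = ennreal r"
    by (intro suminf_ennreal_eq) auto
  then show ?thesis by (simp add: ennreal_mult ennreal_of_nat_eq_real_of_nat)
qed

section \<open>Conditionally Poisson counts\<close>

text \<open>
  Summing the law over \<open>k\<close> shows that the weights exhaust \<open>E\<close>, so an infinite count has probability
  zero there. The mean is then that of the weights. The event \<open>E\<close> stands for the information
  conditioned on.
\<close>
lemma nn_integral_poisson_count:
  fixes N R :: "'w \<Rightarrow> ennreal"
  assumes fin: "finite_measure M" and E: "E \<in> sets M"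
    and N [measurable]: "N \<in> borel_measurable M" and R [measurable]: "R \<in> borel_measurable M"
    and count: "\<And>w. w \<in> space M \<Longrightarrow> N w = \<infinity> \<or> N w \<in> range of_nat"
    and R_fin: "\<And>w. w \<in> E \<Longrightarrow> R w < \<infinity>"
    and law: "\<And>k::nat. emeasure M {w\<in>E. N w = of_nat k}
        = (\<integral>\<^sup>+w\<in>E. ennreal (poisson_weight (R w) k) \<partial>M)"
  shows "(\<integral>\<^sup>+w\<in>E. N w \<partial>M) = (\<integral>\<^sup>+w\<in>E. R w \<partial>M)"
proof -
  interpret finite_measure M by fact
  note E [measurable]
  define P where "P k = {w\<in>E. N w = of_nat k}" for k :: nat
  have P_eq: "P k = E \<inter> {w\<in>space M. N w = of_nat k}" for k
    using sets.sets_into_space[OF E] by (auto simp: P_def)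
  have P [measurable]: "P k \<in> sets M" for k
    unfolding P_eq by measurable
  have disj: "disjoint_family P"
    by (auto simp: disjoint_family_on_def P_def)
  have R_eq: "ennreal (enn2real (R w)) = R w" if "w \<in> E" for w
    using R_fin[OF that] by simp
  have sum1: "(\<Sum>k. ennreal (poisson_weight (R w) k)) = 1" if "w \<in> E" for w
  proof -
    have "(\<Sum>k. ennreal (poisson_weight (ennreal (enn2real (R w))) k)) = ennreal 1"
      by (intro suminf_ennreal_eq poisson_weight_nonneg poisson_weight_sums enn2real_nonneg)
    then show ?thesis unfolding R_eq[OF that] by simp
  qed
  have "emeasure M (\<Union>k. P k) = (\<Sum>k. emeasure M (P k))"
    by (rule suminf_emeasure[symmetric]) (use disj in auto)
  also have "\<dots> = (\<Sum>k. \<integral>\<^sup>+w\<in>E. ennreal (poisson_weight (R w) k) \<partial>M)"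
    by (simp add: P_def law)
  also have "\<dots> = (\<integral>\<^sup>+w. (\<Sum>k. ennreal (poisson_weight (R w) k) * indicator E w) \<partial>M)"
    by (rule nn_integral_suminf[symmetric]) measurable
  also have "\<dots> = (\<integral>\<^sup>+w. indicator E w \<partial>M)"
  proof (rule nn_integral_cong)
    fix w
    show "(\<Sum>k. ennreal (poisson_weight (R w) k) * indicator E w) = indicator E w"
    proof (cases "w \<in> E")
      case True
      then show ?thesis by (simp only: indicator_simps mult_1_right sum1[OF True])
    qed simp
  qed
  finally have full: "emeasure M (\<Union>k. P k) = emeasure M E" by (simp add: E)
  have "emeasure M (E - (\<Union>k. P k)) = emeasure M E - emeasure M (\<Union>k. P k)"
    by (rule emeasure_Diff) (auto simp: P_def)
  then have null: "E - (\<Union>k. P k) \<in> null_sets M"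
    unfolding full by (intro null_setsI) (auto simp: emeasure_finite ennreal_minus_eq_0)
  have "(\<integral>\<^sup>+w\<in>E. N w \<partial>M) = (\<integral>\<^sup>+w. (\<Sum>k. of_nat k * indicator (P k) w) \<partial>M)"
  proof (rule nn_integral_cong_AE)
    show "AE w in M. N w * indicator E w = (\<Sum>k. of_nat k * indicator (P k) w)"
      using AE_not_in[OF null]
    proof eventually_elim
      case (elim w)
      show ?case
      proof (cases "w \<in> E")
        case True
        then obtain k where k: "w \<in> P k" using elim by auto
        then have "(\<Sum>j. of_nat j * indicator (P j) w) = (\<Sum>j\<in>{k}. of_nat j * indicator (P j) w :: ennreal)"
          by (intro suminf_finite) (auto simp: P_def)
        with k True show ?thesis by (simp add: P_def)
      qed (auto simp: P_def)
    qed
  qed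
  also have "\<dots> = (\<Sum>k. of_nat k * emeasure M (P k))"
    by (subst nn_integral_suminf) (auto simp: nn_integral_cmult)
  also have "\<dots> = (\<Sum>k. \<integral>\<^sup>+w. of_nat k * (ennreal (poisson_weight (R w) k) * indicator E w) \<partial>M)"
    by (simp add: P_def law nn_integral_cmult)
  also have "\<dots> = (\<integral>\<^sup>+w. (\<Sum>k. of_nat k * (ennreal (poisson_weight (R w) k) * indicator E w)) \<partial>M)"
    by (rule nn_integral_suminf[symmetric]) measurable
  also have "\<dots> = (\<integral>\<^sup>+w\<in>E. R w \<partial>M)"
  proof (rule nn_integral_cong)
    fix w
    show "(\<Sum>k. of_nat k * (ennreal (poisson_weight (R w) k) * indicator E w)) = R w * indicator E w"
    proof (cases "w \<in> E")
      case True
      have "(\<Sum>k. ennreal (poisson_weight (ennreal (enn2real (R w))) k) * of_nat k) = ennreal (enn2real (R w))"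
        by (intro poisson_weight_mean enn2real_nonneg)
      with True show ?thesis unfolding R_eq[OF True] by (simp add: mult.commute)
    qed simp
  qed
  finally show ?thesis .
qed

lemma prod_of_bool_norm_le: "norm (\<Prod>j\<in>J. of_bool (P j) :: complex) \<le> 1"
  by (subst prod_norm[symmetric]) (intro prod_le_1, auto)

lemma prod_of_bool:
  "finite J \<Longrightarrow> (\<Prod>j\<in>J. of_bool (P j)) = (of_bool (\<forall>j\<in>J. P j) :: complex)"
  by (induction J rule: finite_induct) auto

lemma norm_prod_le_1:
  fixes f :: "'j \<Rightarrow> complex"
  assumes "\<And>j. j \<in> J \<Longrightarrow> norm (f j) \<le> 1"
  shows "norm (prod f J) \<le> 1"
  using assms by (subst prod_norm[symmetric]) (intro prod_le_1, auto)

lemma poisson_gf_norm_le_1: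
  fixes c :: complex
  assumes "0 \<le> r" and "norm c \<le> 1"
  shows "norm (exp (of_real r * (c - 1))) \<le> 1"
proof -
  have "Re c \<le> 1" using assms(2) complex_Re_le_cmod[of c] by linarith
  then have "r * (Re c - 1) \<le> 0" using assms(1) by (simp add: mult_nonneg_nonpos)
  then show ?thesis by simp
qed

text \<open>
  The counts are replaced one at a time: weighting the hypothesis with \<open>c j ^ k j\<close> and summing over the
  one coordinate \<open>k j\<close> turns the count \<open>N j\<close> into its generating function. Partial sums stay bounded
  because \<open>c j\<close> lies in the unit disc. The factor \<open>Z\<close> carries the information conditioned on, so that
  the hypothesis says that the counts are conditionally independent and Poisson with means \<open>R j\<close>.
\<close>
lemma integral_prod_poisson_gf:
  fixes N :: "'j \<Rightarrow> 'w \<Rightarrow> nat" and R :: "'j \<Rightarrow> 'w \<Rightarrow> real" and Z :: "'w \<Rightarrow> complex"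
  assumes "finite J" and Z: "integrable M Z"
    and N [measurable]: "\<And>j. j \<in> J \<Longrightarrow> N j \<in> measurable M (count_space UNIV)"
    and R [measurable]: "\<And>j. j \<in> J \<Longrightarrow> R j \<in> borel_measurable M"
    and R_nonneg: "\<And>j w. j \<in> J \<Longrightarrow> 0 \<le> R j w"
    and c: "\<And>j. j \<in> J \<Longrightarrow> norm (c j) \<le> 1"
    and law: "\<And>k. (\<integral>w. Z w * (\<Prod>j\<in>J. of_bool (N j w = k j)) \<partial>M)
        = (\<integral>w. Z w * (\<Prod>j\<in>J. of_real (poisson_weight (ennreal (R j w)) (k j))) \<partial>M)"
  shows "(\<integral>w. Z w * (\<Prod>j\<in>J. c j ^ N j w) \<partial>M)
    = (\<integral>w. Z w * (\<Prod>j\<in>J. exp (of_real (R j w) * (c j - 1))) \<partial>M)"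
proof -
  note [measurable] = borel_measurable_integrable[OF Z]
  have "(\<integral>w. Z w * ((\<Prod>j\<in>J1. c j ^ N j w) * (\<Prod>j\<in>J-J1. of_bool (N j w = k j))) \<partial>M)
    = (\<integral>w. Z w * ((\<Prod>j\<in>J1. exp (of_real (R j w) * (c j - 1)))
        * (\<Prod>j\<in>J-J1. of_real (poisson_weight (ennreal (R j w)) (k j)))) \<partial>M)"
    if "finite J1" "J1 \<subseteq> J" for k J1
    using that
  proof (induction J1 arbitrary: k rule: finite_induct)
    case empty
    then show ?case using law[of k] by simp
  next
    case (insert x J1)
    then have xJ: "x \<in> J" and J1: "J1 \<subseteq> J" by auto
    have split: "J - J1 = insert x (J - insert x J1)" and fin: "finite (J - insert x J1)"
      using xJ insert.hyps \<open>finite J\<close> by auto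
    define A where "A w = (\<Prod>j\<in>J1. c j ^ N j w) * (\<Prod>j\<in>J - insert x J1. of_bool (N j w = k j))" for w
    define B where "B w = (\<Prod>j\<in>J1. exp (of_real (R j w) * (c j - 1)))
        * (\<Prod>j\<in>J - insert x J1. of_real (poisson_weight (ennreal (R j w)) (k j)))" for w
    have [measurable]: "A \<in> borel_measurable M" unfolding A_def
      by (intro borel_measurable_times borel_measurable_prod measurable_compose[OF N]) (use J1 in auto)
    have [measurable]: "B \<in> borel_measurable M" unfolding B_def
      using J1 by (intro borel_measurable_times borel_measurable_prod) (auto intro!: borel_measurable_exp)
    have A_le: "norm (A w) \<le> 1" for w
      unfolding A_def norm_mult using J1 c
      by (intro mult_le_one prod_of_bool_norm_le norm_prod_le_1)
         (auto simp: norm_power intro!: power_le_one)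
    have B_le: "norm (B w) \<le> 1" for w
      unfolding B_def norm_mult using J1 c R_nonneg poisson_weight_le_1
      by (intro mult_le_one norm_prod_le_1 poisson_gf_norm_le_1) auto
    have [measurable]: "N x \<in> measurable M (count_space UNIV)" "R x \<in> borel_measurable M"
      using xJ by auto
    have step: "(\<integral>w. Z w * (A w * of_bool (N x w = m)) \<partial>M)
        = (\<integral>w. Z w * (B w * of_real (poisson_weight (ennreal (R x w)) m)) \<partial>M)" for m
    proof -
      have e: "(\<Prod>j\<in>J - J1. of_bool (N j w = (k(x := m)) j)) =
          of_bool (N x w = m) * (\<Prod>j\<in>J - insert x J1. of_bool (N j w = k j) :: complex)" for w
        unfolding split using fin by (subst prod.insert) (auto intro!: prod.cong arg_cong2[where f="(*)"])
      have e': "(\<Prod>j\<in>J - J1. of_real (poisson_weight (ennreal (R j w)) ((k(x := m)) j))) =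
          of_real (poisson_weight (ennreal (R x w)) m) * (\<Prod>j\<in>J - insert x J1. of_real (poisson_weight (ennreal (R j w)) (k j)) :: complex)" for w
        unfolding split using fin by (subst prod.insert) (auto intro!: prod.cong arg_cong2[where f="(*)"])
      show ?thesis
        using insert.IH[OF J1, of "k(x := m)"] unfolding e e' A_def B_def
        by (simp add: ac_simps)
    qed
    define a where "a K w = Z w * (A w * (\<Sum>m<K. c x ^ m * of_bool (N x w = m)))" for K :: nat and w
    define b where "b K w = Z w * (B w * (\<Sum>m<K. c x ^ m * of_real (poisson_weight (ennreal (R x w)) m)))" for K :: nat and w
    have intA: "integrable M (\<lambda>w. Z w * (A w * of_bool (N x w = m)))" for m
      using A_le by (intro Bochner_Integration.integrable_bound[OF Z])
        (auto simp: norm_mult intro!: mult_left_le mult_le_one)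
    have intB: "integrable M (\<lambda>w. Z w * (B w * of_real (poisson_weight (ennreal (R x w)) m)))" for m
      using B_le poisson_weight_le_1 by (intro Bochner_Integration.integrable_bound[OF Z])
        (auto simp: norm_mult intro!: mult_left_le mult_le_one)
    have "(\<integral>w. a K w \<partial>M) = (\<Sum>m<K. c x ^ m * (\<integral>w. Z w * (A w * of_bool (N x w = m)) \<partial>M))" for K
    proof -
      have "a K = (\<lambda>w. \<Sum>m<K. c x ^ m * (Z w * (A w * of_bool (N x w = m))))"
        unfolding a_def sum_distrib_left by (intro ext sum.cong) (simp_all only: mult_ac)
      then show ?thesis
        using intA by (simp add: Bochner_Integration.integral_sum)
    qed
    moreover have "(\<integral>w. b K w \<partial>M) = (\<Sum>m<K. c x ^ m * (\<integral>w. Z w * (B w * of_real (poisson_weight (ennreal (R x w)) m)) \<partial>M))" for K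
    proof -
      have "b K = (\<lambda>w. \<Sum>m<K. c x ^ m * (Z w * (B w * of_real (poisson_weight (ennreal (R x w)) m))))"
        unfolding b_def sum_distrib_left by (intro ext sum.cong) (simp_all only: mult_ac)
      then show ?thesis
        using intB by (simp add: Bochner_Integration.integral_sum)
    qed
    ultimately have ab: "(\<integral>w. a K w \<partial>M) = (\<integral>w. b K w \<partial>M)" for K
      by (simp add: step)
    have cx: "norm (c x) \<le> 1" using c xJ by auto
    have "(\<lambda>K. \<integral>w. a K w \<partial>M) \<longlonglongrightarrow> (\<integral>w. Z w * (A w * c x ^ N x w) \<partial>M)"
    proof (rule integral_dominated_convergence[where w="\<lambda>w. norm (Z w)"])
      show "AE w in M. (\<lambda>K. a K w) \<longlonglongrightarrow> Z w * (A w * c x ^ N x w)"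
      proof (rule AE_I2)
        fix w
        have "(\<lambda>m. c x ^ m * of_bool (N x w = m)) sums (\<Sum>m\<in>{N x w}. c x ^ m * of_bool (N x w = m))"
          by (rule sums_finite) auto
        then show "(\<lambda>K. a K w) \<longlonglongrightarrow> Z w * (A w * c x ^ N x w)"
          unfolding a_def sums_def by (auto intro!: tendsto_mult)
      qed
      show "AE w in M. norm (a K w) \<le> norm (Z w)" for K
      proof (rule AE_I2)
        fix w
        have "(\<Sum>m<K. c x ^ m * of_bool (N x w = m)) = (if N x w < K then c x ^ N x w else 0)"
          by (simp add: sum.delta' of_bool_def if_distrib cong: if_cong)
        moreover have "norm (c x ^ N x w) \<le> 1" using cx by (simp add: norm_power power_le_one)
        ultimately show "norm (a K w) \<le> norm (Z w)"
          unfolding a_def norm_mult using A_le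
          by (auto intro!: mult_left_le mult_le_one)
      qed
    qed (use Z in \<open>auto simp: a_def\<close>)
    moreover have "(\<lambda>K. \<integral>w. b K w \<partial>M) \<longlonglongrightarrow> (\<integral>w. Z w * (B w * exp (of_real (R x w) * (c x - 1))) \<partial>M)"
    proof (rule integral_dominated_convergence[where w="\<lambda>w. norm (Z w)"])
      show "AE w in M. (\<lambda>K. b K w) \<longlonglongrightarrow> Z w * (B w * exp (of_real (R x w) * (c x - 1)))"
      proof (rule AE_I2)
        fix w
        have "(\<lambda>m. c x ^ m * of_real (poisson_weight (ennreal (R x w)) m)) sums exp (of_real (R x w) * (c x - 1))"
          using poisson_weight_gf_sums[of "R x w" "c x", OF R_nonneg[OF xJ]] by (simp add: mult.commute)
        then show "(\<lambda>K. b K w) \<longlonglongrightarrow> Z w * (B w * exp (of_real (R x w) * (c x - 1)))"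
          unfolding b_def sums_def by (auto intro!: tendsto_mult)
      qed
      show "AE w in M. norm (b K w) \<le> norm (Z w)" for K
      proof (rule AE_I2)
        fix w
        have "norm (\<Sum>m<K. c x ^ m * of_real (poisson_weight (ennreal (R x w)) m))
            \<le> (\<Sum>m<K. poisson_weight (ennreal (R x w)) m)"
          using cx by (intro order_trans[OF norm_sum] sum_mono)
            (auto simp: norm_mult norm_power intro!: mult_left_le_one_le power_le_one)
        also have "\<dots> \<le> 1"
          using poisson_weight_sums[OF R_nonneg[OF xJ, of w]] sum_le_suminf[of "poisson_weight (ennreal (R x w))" "{..<K}"]
          by (auto simp: sums_iff)
        finally show "norm (b K w) \<le> norm (Z w)"
          unfolding b_def norm_mult using B_le
          by (auto intro!: mult_left_le mult_le_one)
      qed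
    qed (use Z in \<open>auto simp: b_def\<close>)
    ultimately have "(\<integral>w. Z w * (A w * c x ^ N x w) \<partial>M)
        = (\<integral>w. Z w * (B w * exp (of_real (R x w) * (c x - 1))) \<partial>M)"
      unfolding ab by (rule LIMSEQ_unique)
    then show ?case
      using insert.hyps unfolding A_def B_def by (simp add: ac_simps)
  qed
  from this[OF \<open>finite J\<close> order_refl] show ?thesis by simp
qed

lemma simple_function_integral_eq_sum:
  fixes g :: "'a \<Rightarrow> complex"
  assumes "finite_measure Q" and g: "simple_function Q g"
  shows "(\<integral>a. g a \<partial>Q) = (\<Sum>c\<in>g ` space Q. c * of_real (measure Q (g -` {c} \<inter> space Q)))"
proof -
  interpret finite_measure Q by fact
  have fin: "finite (g ` space Q)" and [measurable]: "g -` {c} \<inter> space Q \<in> sets Q" for c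
    using g by (auto intro: simple_functionD)
  have "(\<integral>a. g a \<partial>Q) = (\<integral>a. (\<Sum>c\<in>g ` space Q. indicat_real (g -` {c} \<inter> space Q) a *\<^sub>R c) \<partial>Q)"
  proof (rule Bochner_Integration.integral_cong[OF refl])
    fix a assume a: "a \<in> space Q"
    have "(\<Sum>c\<in>g ` space Q. indicat_real (g -` {c} \<inter> space Q) a *\<^sub>R c)
        = (\<Sum>c\<in>g ` space Q. if c = g a then c else 0)"
      using a by (intro sum.cong) auto
    also have "\<dots> = g a"
      using a fin by (subst sum.delta) auto
    finally show "g a = (\<Sum>c\<in>g ` space Q. indicat_real (g -` {c} \<inter> space Q) a *\<^sub>R c)" ..
  qed
  also have "\<dots> = (\<Sum>c\<in>g ` space Q. (\<integral>a. indicat_real (g -` {c} \<inter> space Q) a *\<^sub>R c \<partial>Q))"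
    by (rule Bochner_Integration.integral_sum) (auto simp: emeasure_eq_measure)
  also have "\<dots> = (\<Sum>c\<in>g ` space Q. c * of_real (measure Q (g -` {c} \<inter> space Q)))"
    by (intro sum.cong refl) (simp add: scaleR_conv_of_real mult.commute)
  finally show ?thesis .
qed

text \<open>
  Dividing an approximation by the larger of its modulus and \<open>1\<close> keeps it in the unit disc. There a
  product of values over any number of points has modulus at most \<open>1\<close>, which is what dominated
  convergence needs below.
\<close>
lemma simple_functions_unit_disc:
  fixes \<psi> :: "'a \<Rightarrow> complex"
  assumes "\<psi> \<in> borel_measurable Q" and le: "\<And>a. norm (\<psi> a) \<le> 1"
  obtains g where "\<And>i::nat. simple_function Q (g i)" "\<And>i a. norm (g i a) \<le> 1"
    "\<And>a. a \<in> space Q \<Longrightarrow> (\<lambda>i. g i a) \<longlonglongrightarrow> \<psi> a"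
proof -
  obtain F where F: "\<And>i::nat. simple_function Q (F i)"
    and lim: "\<And>a. a \<in> space Q \<Longrightarrow> (\<lambda>i. F i a) \<longlonglongrightarrow> \<psi> a"
    using borel_measurable_implies_sequence_metric[OF assms(1), of 0] by blast
  define g where "g i a = F i a / of_real (max 1 (norm (F i a)))" for i a
  show ?thesis
  proof
    show "simple_function Q (g i)" for i
      unfolding g_def by (intro simple_function_compose1[OF F, where g="\<lambda>z. z / of_real (max 1 (norm z))"])
    show "norm (g i a) \<le> 1" for i a
      by (simp add: g_def norm_divide)
    show "(\<lambda>i. g i a) \<longlonglongrightarrow> \<psi> a" if "a \<in> space Q" for a
    proof -
      have "(\<lambda>i. g i a) \<longlonglongrightarrow> \<psi> a / of_real (max 1 (norm (\<psi> a)))"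
        unfolding g_def by (intro tendsto_intros lim that) auto
      then show ?thesis using le[of a] by (simp add: max_def split: if_splits)
    qed
  qed
qed

text \<open>
  If \<open>\<psi>\<close> is simple, its product over the points of \<open>L p\<close> is the product of \<open>c\<close> to the number of points
  marked in the level set of \<open>c\<close>. The exponents \<open>R p * Q (\<psi> = c) * (c - 1)\<close> of the generating functions
  then add up to \<open>R p * (\<integral>\<psi> dQ - 1)\<close>. Dominated convergence gives the general case.

  The parents \<open>p\<close> have the points \<open>x p l\<close>, \<open>l \<in> L p\<close>; the same statement serves for the offspring of
  individuals and, with a single fictitious parent, for the immigrants.
\<close>
lemma integral_prod_poisson_marks:
  fixes Z :: "'w \<Rightarrow> complex" and x :: "'p \<Rightarrow> nat \<Rightarrow> 'w \<Rightarrow> 'a" and L :: "'p \<Rightarrow> 'w \<Rightarrow> nat set"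
  assumes "prob_space Q" and "finite F" and Z: "integrable M Z"
    and x [measurable]: "\<And>p l. p \<in> F \<Longrightarrow> x p l \<in> measurable M Q"
    and L [measurable]: "\<And>p l. p \<in> F \<Longrightarrow> Measurable.pred M (\<lambda>w. l \<in> L p w)"
    and fin: "AE w in M. Z w \<noteq> 0 \<longrightarrow> (\<forall>p\<in>F. finite (L p w))"
    and R [measurable]: "\<And>p. p \<in> F \<Longrightarrow> R p \<in> borel_measurable M"
    and R_nonneg: "\<And>p w. p \<in> F \<Longrightarrow> 0 \<le> R p w"
    and law: "\<And>C S k. finite (C :: complex set) \<Longrightarrow> (\<And>c. c \<in> C \<Longrightarrow> S c \<in> sets Q) \<Longrightarrow>
       disjoint_family_on S C \<Longrightarrow>
       (\<integral>w. Z w * of_bool (\<forall>j\<in>F \<times> C. tally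
           {l \<in> L (fst j) w. x (fst j) l w \<in> S (snd j)} = of_nat (k j)) \<partial>M)
     = (\<integral>w. Z w * of_real (\<Prod>j\<in>F \<times> C. poisson_weight
           (ennreal (R (fst j) w * measure Q (S (snd j)))) (k j)) \<partial>M)"
    and \<psi> [measurable]: "\<psi> \<in> borel_measurable Q" and \<psi>_le: "\<And>a. norm (\<psi> a) \<le> 1"
  shows "(\<integral>w. Z w * (\<Prod>p\<in>F. \<Prod>l\<in>L p w. \<psi> (x p l w)) \<partial>M)
    = (\<integral>w. Z w * (\<Prod>p\<in>F. exp (of_real (R p w) * ((\<integral>a. \<psi> a \<partial>Q) - 1))) \<partial>M)"
proof -
  interpret Q: prob_space Q by fact
  note [measurable] = borel_measurable_integrable[OF Z]
  have simple: "(\<integral>w. Z w * (\<Prod>p\<in>F. \<Prod>l\<in>L p w. g (x p l w)) \<partial>M)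
    = (\<integral>w. Z w * (\<Prod>p\<in>F. exp (of_real (R p w) * ((\<integral>a. g a \<partial>Q) - 1))) \<partial>M)"
    if g: "simple_function Q g" and g_le: "\<And>a. norm (g a) \<le> 1" for g
  proof -
    define C where "C = g ` space Q"
    define S where "S c = g -` {c} \<inter> space Q" for c
    have C: "finite C" and S [measurable]: "S c \<in> sets Q" for c
      using g by (auto intro: simple_functionD simp: C_def S_def)
    have disj: "disjoint_family_on S C" by (auto simp: disjoint_family_on_def S_def)
    define n where "n j w = card {l \<in> L (fst j) w. x (fst j) l w \<in> S (snd j)}" for j w
    have n: "n j \<in> measurable M (count_space UNIV)" if "j \<in> F \<times> C" for j
    proof -
      have [measurable]: "x (fst j) l \<in> measurable M Q" "Measurable.pred M (\<lambda>w. l \<in> L (fst j) w)" for l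
        using that by auto
      show ?thesis unfolding n_def by measurable
    qed
    have "(\<integral>w. Z w * (\<Prod>p\<in>F. \<Prod>l\<in>L p w. g (x p l w)) \<partial>M)
      = (\<integral>w. Z w * (\<Prod>j\<in>F \<times> C. snd j ^ n j w) \<partial>M)"
    proof (rule integral_cong_AE)
      have m: "(\<lambda>w. \<Prod>l\<in>L p w. g (x p l w)) \<in> borel_measurable M" if "p \<in> F" for p
        using that g by (intro borel_measurable_prod_random_set) (auto intro: measurable_compose[OF x[OF that] borel_measurable_simple_function[OF g]])
      show "(\<lambda>w. Z w * (\<Prod>p\<in>F. \<Prod>l\<in>L p w. g (x p l w))) \<in> borel_measurable M"
        by (intro borel_measurable_times borel_measurable_prod m) auto
      show "(\<lambda>w. Z w * (\<Prod>j\<in>F \<times> C. snd j ^ n j w)) \<in> borel_measurable M"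
        by (intro borel_measurable_times borel_measurable_prod measurable_compose[OF n]) auto
      show "AE w in M. Z w * (\<Prod>p\<in>F. \<Prod>l\<in>L p w. g (x p l w)) = Z w * (\<Prod>j\<in>F \<times> C. snd j ^ n j w)"
        using fin AE_space
      proof eventually_elim
        case (elim w)
        have "(\<Prod>l\<in>L p w. g (x p l w)) = (\<Prod>c\<in>C. c ^ n (p, c) w)" if p: "p \<in> F" and fin: "finite (L p w)" for p
        proof -
          have xs: "x p l w \<in> space Q" for l
            using measurable_space[OF x[OF p] elim(2)] .
          have "(\<Prod>l\<in>L p w. g (x p l w))
              = (\<Prod>c\<in>C. \<Prod>l\<in>{l\<in>L p w. g (x p l w) = c}. g (x p l w))"
            using xs by (intro prod.group[symmetric] fin C) (auto simp: C_def)
          also have "\<dots> = (\<Prod>c\<in>C. c ^ n (p, c) w)"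
            using xs by (intro prod.cong refl) (simp add: n_def S_def)
          finally show ?thesis .
        qed
        then show ?case
          using elim by (cases "Z w = 0") (auto simp: prod.cartesian_product intro!: prod.cong)
      qed
    qed
    also have "\<dots> = (\<integral>w. Z w * (\<Prod>j\<in>F \<times> C. exp (of_real (R (fst j) w * measure Q (S (snd j))) * (snd j - 1))) \<partial>M)"
    proof (rule integral_prod_poisson_gf)
      show "norm (snd j) \<le> 1" if "j \<in> F \<times> C" for j using that g_le by (auto simp: C_def)
      fix k
      let ?ev = "\<lambda>w. \<forall>j\<in>F \<times> C. tally
           {l \<in> L (fst j) w. x (fst j) l w \<in> S (snd j)} = of_nat (k j)"
      have "(\<integral>w. Z w * (\<Prod>j\<in>F \<times> C. of_bool (n j w = k j)) \<partial>M) = (\<integral>w. Z w * of_bool (?ev w) \<partial>M)"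
      proof (rule integral_cong_AE)
        show "(\<lambda>w. Z w * (\<Prod>j\<in>F \<times> C. of_bool (n j w = k j))) \<in> borel_measurable M"
          by (intro borel_measurable_times borel_measurable_prod measurable_compose[OF n]) auto
        have "Measurable.pred M ?ev"
        proof (rule pred_intros_finite(3))
          fix j assume "j \<in> F \<times> C"
          then have [measurable]: "x (fst j) l \<in> measurable M Q" "Measurable.pred M (\<lambda>w. l \<in> L (fst j) w)" for l
            by auto
          show "Measurable.pred M (\<lambda>w. tally
              {l \<in> L (fst j) w. x (fst j) l w \<in> S (snd j)} = of_nat (k j))"
            by measurable
        qed (use C \<open>finite F\<close> in simp)
        from measurable_compose[OF this, of of_bool borel]
        show "(\<lambda>w. Z w * of_bool (?ev w)) \<in> borel_measurable M"
          by (intro borel_measurable_times) auto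
        show "AE w in M. Z w * (\<Prod>j\<in>F \<times> C. of_bool (n j w = k j)) = Z w * of_bool (?ev w)"
          using fin
        proof eventually_elim
          case (elim w)
          show ?case
          proof (cases "Z w = 0")
            case False
            have "n j w = k j \<longleftrightarrow> tally
                {l \<in> L (fst j) w. x (fst j) l w \<in> S (snd j)} = of_nat (k j)" if "j \<in> F \<times> C" for j
              using elim False that unfolding n_def
              by (intro tally_eq_of_nat[symmetric]) auto
            then have "(\<forall>j\<in>F \<times> C. n j w = k j) \<longleftrightarrow> ?ev w"
              by (intro ball_cong refl)
            then show ?thesis
              using C \<open>finite F\<close> by (subst prod_of_bool) (simp_all only: finite_cartesian_product)
          qed simp
        qed
      qed
      also have "\<dots> = (\<integral>w. Z w * (\<Prod>j\<in>F \<times> C. of_real (poisson_weight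
           (ennreal (R (fst j) w * measure Q (S (snd j)))) (k j))) \<partial>M)"
        by (subst law[OF C S disj]) simp
      finally show "(\<integral>w. Z w * (\<Prod>j\<in>F \<times> C. of_bool (n j w = k j)) \<partial>M)
        = (\<integral>w. Z w * (\<Prod>j\<in>F \<times> C. of_real (poisson_weight
           (ennreal (R (fst j) w * measure Q (S (snd j)))) (k j))) \<partial>M)" .
    qed (use n Z C \<open>finite F\<close> R_nonneg in auto)
    also have "\<dots> = (\<integral>w. Z w * (\<Prod>p\<in>F. exp (of_real (R p w) * ((\<integral>a. g a \<partial>Q) - 1))) \<partial>M)"
    proof -
      have one: "(\<Sum>c\<in>C. complex_of_real (measure Q (S c))) = 1"
      proof -
        have "(\<Sum>c\<in>C. measure Q (S c)) = measure Q (\<Union>c\<in>C. S c)"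
          using disj C S by (intro Q.finite_measure_finite_Union[symmetric]) auto
        also have "(\<Union>c\<in>C. S c) = space Q" by (auto simp: S_def C_def)
        finally show ?thesis by (simp add: Q.prob_space flip: of_real_sum)
      qed
      have "(\<Prod>c\<in>C. exp (of_real (r * measure Q (S c)) * (c - 1))) = exp (of_real r * ((\<integral>a. g a \<partial>Q) - 1))" for r
      proof -
        have "(\<Sum>c\<in>C. of_real (r * measure Q (S c)) * (c - 1))
          = of_real r * ((\<Sum>c\<in>C. c * of_real (measure Q (S c))) - (\<Sum>c\<in>C. of_real (measure Q (S c))))"
          by (simp add: sum_distrib_left sum_subtractf[symmetric] algebra_simps)
        then show ?thesis
          using C simple_function_integral_eq_sum[OF Q.finite_measure_axioms g]
          by (simp add: exp_sum[symmetric] one flip: C_def S_def)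
      qed
      then show ?thesis by (simp add: prod.cartesian_product')
    qed
    finally show ?thesis .
  qed
  obtain g where g: "\<And>i::nat. simple_function Q (g i)" and g_le: "\<And>i a. norm (g i a) \<le> 1"
    and g_lim: "\<And>a. a \<in> space Q \<Longrightarrow> (\<lambda>i. g i a) \<longlonglongrightarrow> \<psi> a"
    using simple_functions_unit_disc[OF \<psi> \<psi>_le] by blast
  have [measurable]: "g i \<in> borel_measurable Q" for i
    using g by (rule borel_measurable_simple_function)
  have m: "(\<lambda>w. \<Prod>l\<in>L p w. f (x p l w)) \<in> borel_measurable M" if "p \<in> F" "f \<in> borel_measurable Q" for p and f :: "'a \<Rightarrow> complex"
    using that by (intro borel_measurable_prod_random_set) (auto intro: measurable_compose)
  have "(\<lambda>i. \<integral>w. Z w * (\<Prod>p\<in>F. \<Prod>l\<in>L p w. g i (x p l w)) \<partial>M)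
      \<longlonglongrightarrow> (\<integral>w. Z w * (\<Prod>p\<in>F. \<Prod>l\<in>L p w. \<psi> (x p l w)) \<partial>M)"
  proof (rule integral_dominated_convergence[where w="\<lambda>w. norm (Z w)"])
    show "AE w in M. (\<lambda>i. Z w * (\<Prod>p\<in>F. \<Prod>l\<in>L p w. g i (x p l w)))
        \<longlonglongrightarrow> Z w * (\<Prod>p\<in>F. \<Prod>l\<in>L p w. \<psi> (x p l w))"
      using AE_space by eventually_elim
        (intro tendsto_intros g_lim, metis x measurable_space)
    show "AE w in M. norm (Z w * (\<Prod>p\<in>F. \<Prod>l\<in>L p w. g i (x p l w))) \<le> norm (Z w)" for i
      unfolding norm_mult by (intro AE_I2 mult_left_le norm_prod_le_1 g_le norm_ge_zero)
  qed (use Z in \<open>auto intro!: borel_measurable_times borel_measurable_prod m\<close>)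
  moreover have "(\<lambda>i. \<integral>w. Z w * (\<Prod>p\<in>F. exp (of_real (R p w) * ((\<integral>a. g i a \<partial>Q) - 1))) \<partial>M)
      \<longlonglongrightarrow> (\<integral>w. Z w * (\<Prod>p\<in>F. exp (of_real (R p w) * ((\<integral>a. \<psi> a \<partial>Q) - 1))) \<partial>M)"
  proof (rule integral_dominated_convergence[where w="\<lambda>w. norm (Z w)"])
    have "(\<lambda>i. \<integral>a. g i a \<partial>Q) \<longlonglongrightarrow> (\<integral>a. \<psi> a \<partial>Q)"
      by (rule integral_dominated_convergence[where w="\<lambda>_. 1"]) (use g_le g_lim in auto)
    then show "AE w in M. (\<lambda>i. Z w * (\<Prod>p\<in>F. exp (of_real (R p w) * ((\<integral>a. g i a \<partial>Q) - 1))))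
        \<longlonglongrightarrow> Z w * (\<Prod>p\<in>F. exp (of_real (R p w) * ((\<integral>a. \<psi> a \<partial>Q) - 1)))"
      by (intro AE_I2 tendsto_intros)
    have "norm (\<integral>a. g i a \<partial>Q) \<le> 1" for i
      by (rule Q.norm_expectation_le_1) (use g_le in auto)
    then show "AE w in M. norm (Z w * (\<Prod>p\<in>F. exp (of_real (R p w) * ((\<integral>a. g i a \<partial>Q) - 1)))) \<le> norm (Z w)" for i
      unfolding norm_mult using R_nonneg
      by (intro AE_I2 mult_left_le norm_prod_le_1 poisson_gf_norm_le_1 norm_ge_zero) auto
  qed (use Z in \<open>auto intro!: borel_measurable_times borel_measurable_prod borel_measurable_exp\<close>)
  ultimately show ?thesis
    unfolding simple[OF g g_le] by (rule LIMSEQ_unique)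
qed

section \<open>Labels of trees\<close>

lemma exists_in_snoc: "exists_in (u @ [l]) x \<longleftrightarrow> exists_in u x \<and> enat l < children x u"
  by (induction u arbitrary: x) (auto simp: subtree_def)

lemma birth_snoc: "birth (u @ [l]) x = birth u x + delay x (u @ [l])"
  by (induction u arbitrary: x) (auto simp: subtree_def)

section \<open>Fertility and mean offspring\<close>

definition birth_rate :: "(real \<Rightarrow> 'a \<Rightarrow> real) \<Rightarrow> real \<Rightarrow> 'a \<Rightarrow> ennreal" where
  "birth_rate h s a = ennreal (h s a) * indicator {0..} s"

lemma fertility_eq_density: "fertility h a = density lborel (\<lambda>s. birth_rate h s a)"
  by (simp add: fertility_def birth_rate_def)

locale hawkes_kernel = Q: prob_space Q for Q :: "'a::polish_space measure" +
  fixes h :: "real \<Rightarrow> 'a \<Rightarrow> real"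
  assumes sets_Q [simp, measurable_cong]: "sets Q = sets borel"
    and h: "(\<lambda>(s, a). h s a) \<in> borel_measurable (restrict_space borel ({0..} \<times> UNIV))"
    and mean_kappa: "(\<integral>\<^sup>+a. kappa h a \<partial>Q) < 1"
begin

lemma space_Q [simp]: "space Q = UNIV"
  using sets_eq_imp_space_eq[OF sets_Q] by simp

lemma measurable_Q_cong [simp]: "measurable Q N = measurable borel N"
  by (rule measurable_cong_sets) simp_all

lemma measurable_to_Q [simp]: "measurable N Q = measurable N borel"
  by (rule measurable_cong_sets) simp_all

lemma sets_borel_pair_Q [simp]: "sets (borel \<Otimes>\<^sub>M Q) = sets (borel :: (real \<times> 'a) measure)"
proof -
  have "sets (borel \<Otimes>\<^sub>M Q) = sets ((borel :: real measure) \<Otimes>\<^sub>M (borel :: 'a measure))"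
    by (intro sets_pair_measure_cong) simp_all
  then show ?thesis unfolding borel_prod .
qed

lemma measurable_birth_rate:
  "(\<lambda>x. birth_rate h (fst x) (snd x)) \<in> borel_measurable (borel \<Otimes>\<^sub>M borel)"
proof -
  have "(\<lambda>x. ennreal (case x of (s, a) \<Rightarrow> h s a)) \<in> borel_measurable (restrict_space borel ({0..} \<times> UNIV))"
    using h by (intro measurable_compose[OF _ measurable_ennreal])
  then have "(\<lambda>x. ennreal (case x of (s, a) \<Rightarrow> h s a) * indicator ({0..} \<times> UNIV) x) \<in> borel_measurable borel"
    by (subst (asm) borel_measurable_restrict_space_iff_ennreal) (auto intro!: borel_closed closed_Times)
  also have "(\<lambda>x. ennreal (case x of (s, a) \<Rightarrow> h s a) * indicator ({0..} \<times> UNIV) x)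
      = (\<lambda>x. birth_rate h (fst x) (snd x))"
    by (auto simp: fun_eq_iff birth_rate_def split: split_indicator)
  finally show ?thesis by (simp add: borel_prod)
qed

lemma measurable_birth_rate' [measurable (raw)]:
  assumes "f \<in> borel_measurable N" and "g \<in> borel_measurable N"
  shows "(\<lambda>x. birth_rate h (f x) (g x)) \<in> borel_measurable N"
  using measurable_compose[OF measurable_Pair[OF assms] measurable_birth_rate] by simp

lemma kappa_eq: "kappa h a = (\<integral>\<^sup>+s. birth_rate h s a \<partial>lborel)"
proof -
  have "kappa h a = (\<integral>\<^sup>+s. birth_rate h s a * indicator {0..} s \<partial>lborel)"
    unfolding kappa_def fertility_eq_density by (rule emeasure_density) measurable
  also have "\<dots> = (\<integral>\<^sup>+s. birth_rate h s a \<partial>lborel)"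
    by (intro nn_integral_cong) (simp add: birth_rate_def split: split_indicator)
  finally show ?thesis .
qed

lemma measurable_kappa [measurable]: "kappa h \<in> borel_measurable borel"
  unfolding kappa_eq[abs_def] by measurable

lemma nn_integral_fertility:
  assumes [measurable]: "g \<in> borel_measurable borel"
  shows "(\<integral>\<^sup>+s. g s \<partial>fertility h a) = (\<integral>\<^sup>+s. birth_rate h s a * g s \<partial>lborel)"
  unfolding fertility_eq_density by (subst nn_integral_density) auto

lemma sets_fertility_pair_Q: "sets (fertility h a \<Otimes>\<^sub>M Q) = sets borel"
proof -
  have "sets (fertility h a \<Otimes>\<^sub>M Q) = sets (borel \<Otimes>\<^sub>M Q)"
    by (intro sets_pair_measure_cong) (simp_all add: fertility_def)
  then show ?thesis by (simp only: sets_borel_pair_Q)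
qed

lemma emeasure_fertility_pair_Q:
  assumes B: "B \<in> sets borel"
  shows "emeasure (fertility h a \<Otimes>\<^sub>M Q) B
    = (\<integral>\<^sup>+s. \<integral>\<^sup>+b. birth_rate h s a * indicator B (s, b) \<partial>Q \<partial>lborel)"
proof -
  have [measurable]: "B \<in> sets (borel \<Otimes>\<^sub>M Q)" using B by (simp only: sets_borel_pair_Q)
  have "emeasure (fertility h a \<Otimes>\<^sub>M Q) B = (\<integral>\<^sup>+s. \<integral>\<^sup>+b. indicator B (s, b) \<partial>Q \<partial>fertility h a)"
    using B by (intro Q.emeasure_pair_measure) (simp only: sets_fertility_pair_Q)
  also have "\<dots> = (\<integral>\<^sup>+s. birth_rate h s a * (\<integral>\<^sup>+b. indicator B (s, b) \<partial>Q) \<partial>lborel)"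
    by (rule nn_integral_fertility) measurable
  also have "\<dots> = (\<integral>\<^sup>+s. \<integral>\<^sup>+b. birth_rate h s a * indicator B (s, b) \<partial>Q \<partial>lborel)"
    by (intro nn_integral_cong nn_integral_cmult[symmetric]) measurable
  finally show ?thesis .
qed

lemma emeasure_fertility_UNIV: "emeasure (fertility h a) UNIV = kappa h a"
  unfolding kappa_eq fertility_eq_density by (subst emeasure_density) auto

lemma emeasure_fertility_pair_Q_Times:
  assumes "S \<in> sets borel"
  shows "emeasure (fertility h a \<Otimes>\<^sub>M Q) (UNIV \<times> S) = kappa h a * emeasure Q S"
  using assms by (subst Q.emeasure_pair_measure_Times)
    (auto simp: emeasure_fertility_UNIV, simp add: fertility_def)

lemma AE_kappa_finite: "AE a in Q. kappa h a < \<infinity>"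
proof -
  have "AE a in Q. kappa h a \<noteq> \<infinity>"
    using mean_kappa by (intro nn_integral_noteq_infinite) auto
  then show ?thesis by (simp add: less_top)
qed

end

section \<open>Families of cascades\<close>

lemma emeasure_offspring:
  assumes "B \<in> sets borel"
  shows "emeasure (offspring x u) B = tally
    {l. enat l < children x u \<and> (delay x (u @ [l]), mark x (u @ [l])) \<in> B}"
  unfolding offspring_def using assms
  by (subst emeasure_point_measure) auto

text \<open>
  The marks of the ancestors are arbitrary apart from having finite total fertility, which keeps the
  Poisson means finite; for later generations this property is a consequence.
\<close>
locale cascades = hawkes_kernel Q h + prob_space M
  for Q :: "'a::polish_space measure" and h :: "real \<Rightarrow> 'a \<Rightarrow> real" and M :: "'w measure" +
  fixes \<G> :: "'w measure" and W :: "'i::countable \<Rightarrow> 'w \<Rightarrow> 'a cascade_tree"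
  assumes subalgebra_G: "subalgebra M \<G>"
    and W: "independent_cascades M Q h \<G> UNIV W"
    and root_kappa_finite: "\<And>i. AE w in M. kappa h (mark (W i w) []) < \<infinity>"
begin

abbreviation "H n \<equiv> history M \<G> UNIV W n"

definition generation :: "nat \<Rightarrow> 'w \<Rightarrow> ('i \<times> nat list) set" where
  "generation n w = {p. length (snd p) = n \<and> snd p \<in> individuals (W (fst p) w)}"

definition litter :: "'i \<times> nat list \<Rightarrow> 'w \<Rightarrow> nat set" where
  "litter p w = {l. enat l < children (W (fst p) w) (snd p)}"

definition child :: "'i \<times> nat list \<Rightarrow> nat \<Rightarrow> 'i \<times> nat list" where
  "child p l = (fst p, snd p @ [l])"

definition mk :: "'i \<times> nat list \<Rightarrow> 'w \<Rightarrow> 'a" where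
  "mk p = (\<lambda>w. mark (W (fst p) w) (snd p))"

definition dl :: "'i \<times> nat list \<Rightarrow> 'w \<Rightarrow> real" where
  "dl p = (\<lambda>w. delay (W (fst p) w) (snd p))"

lemma measurable_children [measurable]: "(\<lambda>w. children (W i w) u) \<in> measurable M (count_space UNIV)"
  and measurable_delay [measurable]: "(\<lambda>w. delay (W i w) u) \<in> borel_measurable M"
  and measurable_mark [measurable]: "(\<lambda>w. mark (W i w) u) \<in> borel_measurable M"
  using W unfolding independent_cascades_def by auto

lemma measurable_mk [measurable]: "mk p \<in> borel_measurable M"
  and measurable_dl [measurable]: "dl p \<in> borel_measurable M"
  unfolding mk_def dl_def by measurable

lemma measurable_litter [measurable]: "Measurable.pred M (\<lambda>w. l \<in> litter p w)"
  unfolding litter_def mem_Collect_eq by measurable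

definition history_gens :: "nat \<Rightarrow> 'w set set" where
  "history_gens n = sets \<G>
     \<union> {(\<lambda>w. children (W i w) u) -` S \<inter> space M | i u S. i \<in> UNIV \<and> length u < n}
     \<union> {(\<lambda>w. delay (W i w) u) -` S \<inter> space M | i u S.
          i \<in> UNIV \<and> 1 \<le> length u \<and> length u \<le> n \<and> S \<in> sets borel}
     \<union> {(\<lambda>w. mark (W i w) u) -` S \<inter> space M | i u S. i \<in> UNIV \<and> length u \<le> n \<and> S \<in> sets borel}"

lemma history_gens_subset: "history_gens n \<subseteq> sets M"
proof -
  have "(\<lambda>w. children (W i w) u) -` S \<inter> space M \<in> sets M" for i u S
    by (rule measurable_sets[OF measurable_children]) simp
  moreover have "(\<lambda>w. delay (W i w) u) -` S \<inter> space M \<in> sets M" if "S \<in> sets borel" for i u S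
    using that by (rule measurable_sets[OF measurable_delay])
  moreover have "(\<lambda>w. mark (W i w) u) -` S \<inter> space M \<in> sets M" if "S \<in> sets borel" for i u S
    using that by (rule measurable_sets[OF measurable_mark])
  ultimately show ?thesis
    using subalgebra_G unfolding history_gens_def subalgebra_def
    by (intro Un_least) auto
qed

lemma H_eq: "H n = sigma (space M) (history_gens n)"
  unfolding history_def history_gens_def ..

lemma space_H [simp]: "space (H n) = space M"
  unfolding H_eq by (rule space_measure_of_conv)

lemma sets_H: "sets (H n) = sigma_sets (space M) (history_gens n)"
  unfolding H_eq using history_gens_subset sets.space_closed by (intro sets_measure_of) blast

lemma history_gens_in_H: "A \<in> history_gens n \<Longrightarrow> A \<in> sets (H n)"
  unfolding sets_H by (rule sigma_sets.Basic)

lemma subalgebra_H: "subalgebra M (H n)"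
  unfolding subalgebra_def using sets.sigma_sets_subset[OF history_gens_subset]
  by (simp add: sets_H)

lemma sets_H_subset: "A \<in> sets (H n) \<Longrightarrow> A \<in> sets M"
  using subalgebra_H unfolding subalgebra_def by blast

lemma measurable_H_M: "f \<in> measurable (H n) N \<Longrightarrow> f \<in> measurable M N"
  using measurable_from_subalg[OF subalgebra_H] .

lemma sets_G_H: "A \<in> sets \<G> \<Longrightarrow> A \<in> sets (H n)"
  by (rule history_gens_in_H) (simp add: history_gens_def)

lemma measurable_G_H: "f \<in> measurable \<G> N \<Longrightarrow> f \<in> measurable (H n) N"
  using subalgebra_G unfolding subalgebra_def
  by (auto simp: measurable_def intro: sets_G_H)

lemma H_children:
  assumes "length u < n"
  shows "(\<lambda>w. children (W i w) u) \<in> measurable (H n) (count_space UNIV)"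
proof (rule measurableI)
  fix A :: "enat set"
  have "\<exists>i' u' S. (\<lambda>w. children (W i w) u) -` A \<inter> space M
      = (\<lambda>w. children (W i' w) u') -` S \<inter> space M \<and> i' \<in> UNIV \<and> length u' < n"
    using assms by (intro exI[of _ i] exI[of _ u] exI[of _ A]) simp
  then have "(\<lambda>w. children (W i w) u) -` A \<inter> space M \<in> history_gens n"
    unfolding history_gens_def Un_iff mem_Collect_eq by (rule disjI1[OF disjI1[OF disjI2]])
  then show "(\<lambda>w. children (W i w) u) -` A \<inter> space (H n) \<in> sets (H n)"
    unfolding space_H by (rule history_gens_in_H)
qed simp

lemma H_mk:
  assumes "length (snd p) \<le> n"
  shows "mk p \<in> borel_measurable (H n)"
proof (rule measurableI)
  fix A :: "'a set" assume "A \<in> sets borel"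
  then have "mk p -` A \<inter> space M \<in> history_gens n"
    using assms unfolding history_gens_def mk_def by blast
  then show "mk p -` A \<inter> space (H n) \<in> sets (H n)"
    unfolding space_H by (rule history_gens_in_H)
qed simp

lemma H_dl:
  assumes "1 \<le> length (snd p)" and "length (snd p) \<le> n"
  shows "dl p \<in> borel_measurable (H n)"
proof (rule measurableI)
  fix A :: "real set" assume "A \<in> sets borel"
  then have "dl p -` A \<inter> space M \<in> history_gens n"
    using assms unfolding history_gens_def dl_def by blast
  then show "dl p -` A \<inter> space (H n) \<in> sets (H n)"
    unfolding space_H by (rule history_gens_in_H)
qed simp

lemma H_exists_in: "length u \<le> n \<Longrightarrow> Measurable.pred (H n) (\<lambda>w. exists_in u (W i w))"
proof (induction u rule: rev_induct)
  case Nil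
  show ?case unfolding exists_in.simps by (rule measurable_const) simp
next
  case (snoc l u)
  have [measurable]: "(\<lambda>w. children (W i w) u) \<in> measurable (H n) (count_space UNIV)"
    using snoc.prems by (intro H_children) simp
  have [measurable]: "Measurable.pred (H n) (\<lambda>w. exists_in u (W i w))"
    using snoc by simp
  show ?case unfolding exists_in_snoc by measurable
qed

lemma H_birth: "length u \<le> n \<Longrightarrow> (\<lambda>w. birth u (W i w)) \<in> borel_measurable (H n)"
proof (induction u rule: rev_induct)
  case Nil
  show ?case unfolding birth.simps by (rule borel_measurable_const)
next
  case (snoc l u)
  have [measurable]: "(\<lambda>w. delay (W i w) (u @ [l])) \<in> borel_measurable (H n)"
    using H_dl[of "(i, u @ [l])" n] snoc.prems unfolding dl_def by simp
  have [measurable]: "(\<lambda>w. birth u (W i w)) \<in> borel_measurable (H n)"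
    using snoc by simp
  show ?case unfolding birth_snoc by (intro borel_measurable_add) fact+
qed

lemma H_generation: "m \<le> n \<Longrightarrow> Measurable.pred (H n) (\<lambda>w. p \<in> generation m w)"
  using H_exists_in[of "snd p" n "fst p"]
  by (cases "length (snd p) = m") (auto simp: generation_def individuals_def)

lemma measurable_generation [measurable]: "Measurable.pred M (\<lambda>w. p \<in> generation m w)"
  using H_generation[OF order_refl] by (rule measurable_H_M)

lemma child_in_generation: "child p l \<in> generation (Suc n) w \<longleftrightarrow> p \<in> generation n w \<and> l \<in> litter p w"
  by (auto simp: child_def generation_def individuals_def litter_def exists_in_snoc)

lemma child_inject [simp]: "child p l = child q m \<longleftrightarrow> p = q \<and> l = m"
  by (cases p; cases q) (auto simp: child_def)

lemma generation_Suc: "generation (Suc n) w = (\<lambda>(p, l). child p l) ` (SIGMA p:generation n w. litter p w)"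
proof (intro set_eqI iffI)
  fix q assume q: "q \<in> generation (Suc n) w"
  then have "snd q \<noteq> []" by (auto simp: generation_def)
  then have "q = child (fst q, butlast (snd q)) (last (snd q))" by (cases q) (simp add: child_def)
  with q show "q \<in> (\<lambda>(p, l). child p l) ` (SIGMA p:generation n w. litter p w)"
    using child_in_generation by force
qed (auto simp: child_in_generation)

definition brood :: "'i \<times> nat list \<Rightarrow> (real \<times> 'a) set \<Rightarrow> 'w \<Rightarrow> nat set" where
  "brood p B w = {l \<in> litter p w. (dl (child p l) w, mk (child p l) w) \<in> B}"

lemma measurable_brood [measurable]:
  "B \<in> sets borel \<Longrightarrow> Measurable.pred M (\<lambda>w. l \<in> brood p B w)"
proof -
  assume [measurable]: "B \<in> sets borel"
  have [measurable]: "(\<lambda>w. (dl (child p l) w, mk (child p l) w)) \<in> borel_measurable M"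
    by (intro borel_measurable_Pair) measurable
  show ?thesis unfolding brood_def mem_Collect_eq by measurable
qed

lemma emeasure_offspring_brood:
  assumes "B \<in> sets borel"
  shows "emeasure (offspring (W (fst p) w) (snd p)) B = tally (brood p B w)"
  unfolding emeasure_offspring[OF assms] brood_def litter_def dl_def mk_def child_def by simp

lemma measurable_tally_brood [measurable]:
  assumes [measurable]: "B \<in> sets borel"
  shows "(\<lambda>w. tally (brood p B w)) \<in> borel_measurable M"
  by measurable

text \<open>
  The defining property of the family, with the pairs of an individual and a set indexed by any finite
  set instead of an initial segment of the naturals.
\<close>
lemma conditional_offspring:
  assumes J: "finite J"
    and len: "\<And>j. j \<in> J \<Longrightarrow> length (snd (p j)) = n"
    and B: "\<And>j. j \<in> J \<Longrightarrow> B j \<in> sets borel"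
    and disj: "\<And>j j'. j \<in> J \<Longrightarrow> j' \<in> J \<Longrightarrow> j \<noteq> j' \<Longrightarrow> p j = p j' \<Longrightarrow> B j \<inter> B j' = {}"
  shows "AE w in M. (\<forall>j\<in>J. p j \<in> generation n w) \<longrightarrow>
     real_cond_exp M (H n) (indicator {w \<in> space M. \<forall>j\<in>J.
         tally (brood (p j) (B j) w) = of_nat (k j)}) w
     = (\<Prod>j\<in>J. poisson_weight (emeasure (fertility h (mk (p j) w) \<Otimes>\<^sub>M Q) (B j)) (k j))"
proof -
  obtain e where e: "bij_betw e {..<card J} J"
    using ex_bij_betw_nat_finite[OF J] by (auto simp: atLeast0LessThan)
  have eJ: "e j \<in> J" if "j < card J" for j
    using bij_betw_imp_surj_on[OF e] that by auto
  have all: "(\<forall>j<card J. P (e j)) \<longleftrightarrow> (\<forall>j\<in>J. P j)" for P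
  proof -
    have "(\<forall>j<card J. P (e j)) \<longleftrightarrow> (\<forall>j\<in>e ` {..<card J}. P j)" by auto
    then show ?thesis unfolding bij_betw_imp_surj_on[OF e] .
  qed
  have inj: "e j = e j' \<longleftrightarrow> j = j'" if "j < card J" "j' < card J" for j j'
    using bij_betw_imp_inj_on[OF e] that by (auto simp: inj_on_def)
  have "AE w in M.
           (\<forall>j<card J. snd (p (e j)) \<in> individuals (W (fst (p (e j))) w)) \<longrightarrow>
           real_cond_exp M (H n)
             (indicator {w \<in> space M. \<forall>j<card J.
                emeasure (offspring (W (fst (p (e j))) w) (snd (p (e j)))) (B (e j)) = of_nat (k (e j))}) w
           = (\<Prod>j<card J. poisson_weight
                (emeasure (fertility h (mark (W (fst (p (e j))) w) (snd (p (e j)))) \<Otimes>\<^sub>M Q) (B (e j))) (k (e j)))"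
    using W[unfolded independent_cascades_def, THEN conjunct2, rule_format,
        of "card J" "\<lambda>j. p (e j)" n "\<lambda>j. B (e j)" "\<lambda>j. k (e j)"] len B disj eJ inj by simp
  moreover have "{w \<in> space M. \<forall>j<card J.
                emeasure (offspring (W (fst (p (e j))) w) (snd (p (e j)))) (B (e j)) = of_nat (k (e j))}
     = {w \<in> space M. \<forall>j\<in>J. tally (brood (p j) (B j) w) = of_nat (k j)}"
  proof -
    have "(\<forall>j<card J. emeasure (offspring (W (fst (p (e j))) w) (snd (p (e j)))) (B (e j)) = of_nat (k (e j)))
      \<longleftrightarrow> (\<forall>j\<in>J. tally (brood (p j) (B j) w) = of_nat (k j))" for w
      unfolding all[of "\<lambda>j. emeasure (offspring (W (fst (p j)) w) (snd (p j))) (B j) = of_nat (k j)"]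
      using B by (simp add: emeasure_offspring_brood)
    then show ?thesis by simp
  qed
  moreover have "(\<Prod>j<card J. poisson_weight
                (emeasure (fertility h (mark (W (fst (p (e j))) w) (snd (p (e j)))) \<Otimes>\<^sub>M Q) (B (e j))) (k (e j)))
     = (\<Prod>j\<in>J. poisson_weight (emeasure (fertility h (mk (p j) w) \<Otimes>\<^sub>M Q) (B j)) (k j))" for w
    unfolding mk_def by (rule prod.reindex_bij_betw[OF e])
  moreover have "(\<forall>j<card J. snd (p (e j)) \<in> individuals (W (fst (p (e j))) w)) \<longleftrightarrow> (\<forall>j\<in>J. p j \<in> generation n w)" for w
    unfolding all[of "\<lambda>j. snd (p j) \<in> individuals (W (fst (p j)) w)"] using len
    by (auto simp: generation_def)
  ultimately show ?thesis by simp
qed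

end

context cascades begin

lemma measurable_emeasure_fertility_pair_Q [measurable]:
  assumes B: "B \<in> sets borel"
  shows "(\<lambda>a. emeasure (fertility h a \<Otimes>\<^sub>M Q) B) \<in> borel_measurable borel"
proof -
  have [measurable]: "B \<in> sets (borel \<Otimes>\<^sub>M borel)" using B by (simp only: borel_prod)
  show ?thesis unfolding emeasure_fertility_pair_Q[OF B] by measurable
qed

text \<open>
  The conditional law holds only where the individuals exist. Testing it against functions \<open>Z\<close> of the
  history that vanish elsewhere absorbs this restriction.
\<close>
lemma integral_offspring_event_real:
  fixes Z :: "'w \<Rightarrow> real"
  assumes J: "finite J"
    and len: "\<And>j. j \<in> J \<Longrightarrow> length (snd (p j)) = n"
    and B: "\<And>j. j \<in> J \<Longrightarrow> B j \<in> sets borel"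
    and disj: "\<And>j j'. j \<in> J \<Longrightarrow> j' \<in> J \<Longrightarrow> j \<noteq> j' \<Longrightarrow> p j = p j' \<Longrightarrow> B j \<inter> B j' = {}"
    and Z: "Z \<in> borel_measurable (H n)" and Z_le: "\<And>w. \<bar>Z w\<bar> \<le> 1"
    and ex: "\<And>w. w \<in> space M \<Longrightarrow> Z w \<noteq> 0 \<Longrightarrow> \<forall>j\<in>J. p j \<in> generation n w"
  shows "(\<integral>w. Z w * of_bool (\<forall>j\<in>J. tally (brood (p j) (B j) w) = of_nat (k j)) \<partial>M)
    = (\<integral>w. Z w * (\<Prod>j\<in>J. poisson_weight (emeasure (fertility h (mk (p j) w) \<Otimes>\<^sub>M Q) (B j)) (k j)) \<partial>M)"
proof -
  interpret finite_measure_subalgebra M "H n"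
    by unfold_locales (rule subalgebra_H)
  have [measurable]: "Z \<in> borel_measurable M" using Z by (rule measurable_H_M)
  have cond: "AE w in M. (\<forall>j\<in>J. p j \<in> generation n w) \<longrightarrow>
     real_cond_exp M (H n) (indicator {w \<in> space M. \<forall>j\<in>J.
         tally (brood (p j) (B j) w) = of_nat (k j)}) w
     = (\<Prod>j\<in>J. poisson_weight (emeasure (fertility h (mk (p j) w) \<Otimes>\<^sub>M Q) (B j)) (k j))"
    by (rule conditional_offspring) (use J len B disj in auto)
  define U where "U = {w \<in> space M. \<forall>j\<in>J. tally (brood (p j) (B j) w) = of_nat (k j)}"
  have "U = space M \<inter> (\<Inter>j\<in>J. {w \<in> space M. tally (brood (p j) (B j) w) = of_nat (k j)})"
    by (auto simp: U_def)
  moreover have "{w \<in> space M. tally (brood (p j) (B j) w) = of_nat (k j)} \<in> sets M"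
    if "j \<in> J" for j
    using measurable_tally_brood[OF B[OF that], of "p j"] by measurable
  ultimately have U [measurable]: "U \<in> sets M"
    using J by (cases "J = {}") auto
  have "(\<integral>w. Z w * of_bool (\<forall>j\<in>J. tally (brood (p j) (B j) w) = of_nat (k j)) \<partial>M)
    = (\<integral>w. Z w * indicat_real U w \<partial>M)"
    by (intro Bochner_Integration.integral_cong) (auto simp: U_def)
  also have "\<dots> = (\<integral>w. Z w * real_cond_exp M (H n) (indicator U) w \<partial>M)"
    using Z_le by (intro real_cond_exp_intg(2)[symmetric] Z integrable_const_bound[where B=1])
      (auto simp: abs_mult split: split_indicator)
  also have "\<dots> = (\<integral>w. Z w * (\<Prod>j\<in>J. poisson_weight (emeasure (fertility h (mk (p j) w) \<Otimes>\<^sub>M Q) (B j)) (k j)) \<partial>M)"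
  proof (rule integral_cong_AE)
    note [measurable] = B
    show "(\<lambda>w. Z w * (\<Prod>j\<in>J. poisson_weight (emeasure (fertility h (mk (p j) w) \<Otimes>\<^sub>M Q) (B j)) (k j))) \<in> borel_measurable M"
      by measurable
    show "AE w in M. Z w * real_cond_exp M (H n) (indicator U) w
      = Z w * (\<Prod>j\<in>J. poisson_weight (emeasure (fertility h (mk (p j) w) \<Otimes>\<^sub>M Q) (B j)) (k j))"
      using cond AE_space
    proof eventually_elim
      case (elim w)
      then show ?case using ex[OF elim(2)] by (cases "Z w = 0") (auto simp: U_def)
    qed
  qed measurable
  finally show ?thesis .
qed

lemma campbell_count:
  assumes len: "length (snd p) = n" and B [measurable]: "B \<in> sets borel"
    and E: "E \<in> sets (H n)"
    and ex: "\<And>w. w \<in> E \<Longrightarrow> p \<in> generation n w"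
    and fin: "\<And>w. w \<in> E \<Longrightarrow> emeasure (fertility h (mk p w) \<Otimes>\<^sub>M Q) B < \<infinity>"
  shows "(\<integral>\<^sup>+w\<in>E. tally (brood p B w) \<partial>M)
    = (\<integral>\<^sup>+w\<in>E. emeasure (fertility h (mk p w) \<Otimes>\<^sub>M Q) B \<partial>M)"
proof (rule nn_integral_poisson_count)
  have EM [measurable]: "E \<in> sets M" using E by (rule sets_H_subset)
  then show "E \<in> sets M" .
  show "finite_measure M" by unfold_locales
  show "(\<lambda>w. tally (brood p B w)) \<in> borel_measurable M" by measurable
  show "(\<lambda>w. emeasure (fertility h (mk p w) \<Otimes>\<^sub>M Q) B) \<in> borel_measurable M" by measurable
  show "tally (brood p B w) = \<infinity> \<or> tally (brood p B w) \<in> range of_nat" for w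
    by (rule tally_cases)
  show "emeasure M {w \<in> E. tally (brood p B w) = of_nat k}
      = (\<integral>\<^sup>+w\<in>E. ennreal (poisson_weight (emeasure (fertility h (mk p w) \<Otimes>\<^sub>M Q) B) k) \<partial>M)" for k
  proof -
    let ?U = "{w \<in> E. tally (brood p B w) = of_nat k}"
    have U_eq: "?U = E \<inter> {w \<in> space M. tally (brood p B w) = of_nat k}"
      using sets.sets_into_space[OF EM] by auto
    have U: "?U \<in> sets M" unfolding U_eq by measurable
    have "measure M ?U = (\<integral>w. indicat_real E w * of_bool (\<forall>j\<in>{()}. tally (brood p B w) = of_nat k) \<partial>M)"
    proof -
      have "measure M ?U = (\<integral>w. indicat_real ?U w \<partial>M)"
        using U by simp
      also have "\<dots> = (\<integral>w. indicat_real E w * of_bool (\<forall>j\<in>{()}. tally (brood p B w) = of_nat k) \<partial>M)"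
        by (intro Bochner_Integration.integral_cong) (auto split: split_indicator)
      finally show ?thesis .
    qed
    also have "\<dots> = (\<integral>w. indicat_real E w * (\<Prod>j\<in>{()}. poisson_weight (emeasure (fertility h (mk p w) \<Otimes>\<^sub>M Q) B) k) \<partial>M)"
      using len B ex E
      by (intro integral_offspring_event_real[where p="\<lambda>_. p" and B="\<lambda>_. B" and k="\<lambda>_. k"])
        (auto simp: indicator_def split: if_splits)
    finally have eq: "measure M ?U = (\<integral>w. indicat_real E w * poisson_weight (emeasure (fertility h (mk p w) \<Otimes>\<^sub>M Q) B) k \<partial>M)"
      by simp
    have "(\<integral>\<^sup>+w\<in>E. ennreal (poisson_weight (emeasure (fertility h (mk p w) \<Otimes>\<^sub>M Q) B) k) \<partial>M)
      = (\<integral>\<^sup>+w. ennreal (indicat_real E w * poisson_weight (emeasure (fertility h (mk p w) \<Otimes>\<^sub>M Q) B) k) \<partial>M)"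
      by (intro nn_integral_cong) (auto split: split_indicator)
    also have "\<dots> = ennreal (\<integral>w. indicat_real E w * poisson_weight (emeasure (fertility h (mk p w) \<Otimes>\<^sub>M Q) B) k \<partial>M)"
      by (intro nn_integral_eq_integral integrable_const_bound[where B=1])
        (auto simp: poisson_weight_le_1 split: split_indicator)
    finally show ?thesis
      unfolding eq[symmetric] by (simp add: emeasure_eq_measure)
  qed
qed (use fin in auto)

text \<open>
  The mean number of children with infinite total fertility is a multiple of \<open>Q {kappa = \<infinity>} = 0\<close>, even
  when the parent's own total fertility is infinite.
\<close>
lemma AE_kappa_finite_generation:
  "AE w in M. \<forall>p\<in>generation n w. kappa h (mk p w) < \<infinity>"
proof (induction n)
  case 0
  have "AE w in M. \<forall>i. kappa h (mark (W i w) []) < \<infinity>"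
    unfolding AE_all_countable using root_kappa_finite by simp
  then show ?case
    by eventually_elim (auto simp: generation_def mk_def)
next
  case (Suc n)
  define B where "B = (UNIV :: real set) \<times> {b. kappa h b = \<infinity>}"
  have S [measurable]: "{b. kappa h b = \<infinity>} \<in> sets borel"
    using measurable_kappa by measurable
  have B [measurable]: "B \<in> sets borel"
    unfolding B_def borel_prod[symmetric] by measurable
  have B0: "emeasure (fertility h a \<Otimes>\<^sub>M Q) B = 0" for a
  proof -
    have "emeasure Q {b. kappa h b = \<infinity>} = 0"
      using AE_kappa_finite by (subst (asm) AE_iff_measurable[OF _ refl]) (auto simp: less_top[symmetric])
    then show ?thesis unfolding B_def emeasure_fertility_pair_Q_Times[OF S] by simp
  qed
  have "AE w in M. p \<in> generation n w \<longrightarrow> brood p B w = {}" for p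
  proof (cases "length (snd p) = n")
    case True
    define E where "E = {w \<in> space M. p \<in> generation n w}"
    have E: "E \<in> sets (H n)"
      using H_generation[OF order_refl, of p n] unfolding E_def space_H[of n, symmetric] by measurable
    then have EM [measurable]: "E \<in> sets M" by (rule sets_H_subset)
    have "(\<integral>\<^sup>+w\<in>E. tally (brood p B w) \<partial>M) = 0"
      using campbell_count[OF True B E] by (simp add: B0 E_def)
    then have "AE w in M. tally (brood p B w) * indicator E w = 0"
      by (subst (asm) nn_integral_0_iff_AE) auto
    then show ?thesis using AE_space
      by eventually_elim (auto simp: E_def emeasure_count_space_eq_0)
  qed (simp add: generation_def)
  then have "AE w in M. \<forall>p. p \<in> generation n w \<longrightarrow> brood p B w = {}"
    unfolding AE_all_countable by simp
  then show ?case
  proof eventually_elim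
    case (elim w)
    show ?case
    proof
      fix q assume "q \<in> generation (Suc n) w"
      then obtain p l where q: "q = child p l" "p \<in> generation n w" "l \<in> litter p w"
        unfolding generation_Suc by auto
      with elim have "brood p B w = {}" by blast
      then have "l \<notin> brood p B w" by simp
      with q show "kappa h (mk q w) < \<infinity>" by (auto simp: brood_def B_def less_top)
    qed
  qed
qed

end

context cascades begin

lemma measurable_id_H [measurable]: "(\<lambda>w. w) \<in> measurable M (H n)"
  by (rule measurableI) (use sets.sets_into_space sets_H_subset in \<open>auto simp: Int_absorb2\<close>)

text \<open>
  Both sides are integrals of \<open>G\<close> for measures on the product of the history with the space of delays and
  marks. They agree on rectangles by the mean offspring counts. \<open>G\<close> takes the whole history
  as an argument so that functions of the positions of the parent and of the immigrant are covered.
\<close>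
lemma campbell_litter:
  assumes len: "length (snd p) = n"
    and G: "G \<in> borel_measurable (H n \<Otimes>\<^sub>M borel)"
  shows "(\<integral>\<^sup>+w. (\<Sum>l. G (w, dl (child p l) w, mk (child p l) w) * indicator (litter p w) l)
        * indicator (generation n w) p \<partial>M)
    = (\<integral>\<^sup>+w. (\<integral>\<^sup>+s. \<integral>\<^sup>+b. birth_rate h s (mk p w) * G (w, s, b) \<partial>Q \<partial>lborel)
        * indicator (generation n w) p \<partial>M)"
proof -
  define E0 where "E0 = {w \<in> space M. p \<in> generation n w \<and> kappa h (mk p w) < \<infinity>}"
  have E0: "E0 \<in> sets (H n)"
  proof -
    have [measurable]: "Measurable.pred (H n) (\<lambda>w. p \<in> generation n w)" "mk p \<in> borel_measurable (H n)"
      using len by (auto intro: H_generation H_mk)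
    have "{w \<in> space (H n). p \<in> generation n w \<and> kappa h (mk p w) < \<infinity>} \<in> sets (H n)"
      by measurable
    then show ?thesis by (simp add: E0_def)
  qed
  have [measurable]: "E0 \<in> sets M" using E0 by (rule sets_H_subset)
  let ?B = "borel :: (real \<times> 'a) measure"
  let ?K = "count_space (UNIV :: nat set)"
  define t where "t x = (snd x, dl (child p (fst x)) (snd x), mk (child p (fst x)) (snd x))" for x :: "nat \<times> 'w"
  define c :: "nat \<times> 'w \<Rightarrow> ennreal" where "c x = of_bool (fst x \<in> litter p (snd x)) * indicator E0 (snd x)" for x
  have [measurable]: "(\<lambda>x. of_bool (fst x \<in> litter p (snd x)) :: ennreal) \<in> borel_measurable (?K \<Otimes>\<^sub>M M)"
    by (intro measurable_pair_measure_countable1) auto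
  have c [measurable]: "c \<in> borel_measurable (?K \<Otimes>\<^sub>M M)"
    unfolding c_def by measurable
  have t [measurable]: "t \<in> measurable (?K \<Otimes>\<^sub>M M) (H n \<Otimes>\<^sub>M ?B)"
    unfolding t_def by (intro measurable_pair_measure_countable1) (auto intro!: measurable_Pair borel_measurable_Pair)
  define m1 where "m1 = distr (density (?K \<Otimes>\<^sub>M M) c) (H n \<Otimes>\<^sub>M ?B) t"
  interpret LQ: pair_sigma_finite lborel Q ..
  define d where "d x = birth_rate h (fst (snd x)) (mk p (fst x)) * indicator E0 (fst x)" for x :: "'w \<times> real \<times> 'a"
  have [measurable]: "(\<lambda>x. x) \<in> measurable (M \<Otimes>\<^sub>M (lborel \<Otimes>\<^sub>M Q)) (H n \<Otimes>\<^sub>M ?B)"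
  proof -
    have "(\<lambda>x. (fst x, fst (snd x), snd (snd x))) \<in> measurable (M \<Otimes>\<^sub>M (lborel \<Otimes>\<^sub>M Q)) (H n \<Otimes>\<^sub>M ?B)"
      by (intro measurable_Pair borel_measurable_Pair) measurable
    then show ?thesis by simp
  qed
  have d [measurable]: "d \<in> borel_measurable (M \<Otimes>\<^sub>M (lborel \<Otimes>\<^sub>M Q))"
    unfolding d_def by measurable
  define m2 where "m2 = distr (density (M \<Otimes>\<^sub>M (lborel \<Otimes>\<^sub>M Q)) d) (H n \<Otimes>\<^sub>M ?B) (\<lambda>x. x)"
  have nn_m1: "(\<integral>\<^sup>+x. F x \<partial>m1) = (\<integral>\<^sup>+w. (\<Sum>l. F (w, dl (child p l) w, mk (child p l) w)
      * indicator (litter p w) l) * indicator E0 w \<partial>M)"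
    if F [measurable]: "F \<in> borel_measurable (H n \<Otimes>\<^sub>M ?B)" for F
  proof -
    have "(\<integral>\<^sup>+x. F x \<partial>m1) = (\<integral>\<^sup>+x. c x * F (t x) \<partial>(?K \<Otimes>\<^sub>M M))"
      unfolding m1_def by (subst nn_integral_distr) (auto simp: nn_integral_density)
    also have "\<dots> = (\<integral>\<^sup>+w. (\<Sum>l. c (l, w) * F (t (l, w))) \<partial>M)"
      by (rule nn_integral_count_space_pair) measurable
    also have "\<dots> = (\<integral>\<^sup>+w. (\<Sum>l. F (w, dl (child p l) w, mk (child p l) w)
        * indicator (litter p w) l) * indicator E0 w \<partial>M)"
      by (intro nn_integral_cong) (auto simp: c_def t_def indicator_def of_bool_def intro!: suminf_cong)
    finally show ?thesis .
  qed
  have nn_m2: "(\<integral>\<^sup>+x. F x \<partial>m2) = (\<integral>\<^sup>+w. (\<integral>\<^sup>+s. \<integral>\<^sup>+b. birth_rate h s (mk p w)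
      * F (w, s, b) \<partial>Q \<partial>lborel) * indicator E0 w \<partial>M)"
    if F [measurable]: "F \<in> borel_measurable (H n \<Otimes>\<^sub>M ?B)" for F
  proof -
    have [measurable]: "F \<in> borel_measurable (M \<Otimes>\<^sub>M (lborel \<Otimes>\<^sub>M Q))"
      using measurable_compose[of "\<lambda>x. x", OF _ F] by measurable
    have "(\<integral>\<^sup>+x. F x \<partial>m2) = (\<integral>\<^sup>+x. d x * F x \<partial>(M \<Otimes>\<^sub>M (lborel \<Otimes>\<^sub>M Q)))"
      unfolding m2_def by (subst nn_integral_distr) (auto simp: nn_integral_density)
    also have "\<dots> = (\<integral>\<^sup>+w. \<integral>\<^sup>+y. d (w, y) * F (w, y) \<partial>(lborel \<Otimes>\<^sub>M Q) \<partial>M)"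
      by (subst LQ.P.nn_integral_fst[symmetric]) auto
    also have "\<dots> = (\<integral>\<^sup>+w. (\<integral>\<^sup>+s. \<integral>\<^sup>+b. d (w, s, b) * F (w, s, b) \<partial>Q \<partial>lborel) \<partial>M)"
      by (intro nn_integral_cong) (subst Q.nn_integral_fst[symmetric], auto)
    also have "\<dots> = (\<integral>\<^sup>+w. (\<integral>\<^sup>+s. \<integral>\<^sup>+b. birth_rate h s (mk p w)
      * F (w, s, b) \<partial>Q \<partial>lborel) * indicator E0 w \<partial>M)"
      by (intro nn_integral_cong) (auto simp: d_def split: split_indicator)
    finally show ?thesis .
  qed
  have rect: "emeasure m1 (A \<times> B) = (\<integral>\<^sup>+w\<in>A \<inter> E0. emeasure (fertility h (mk p w) \<Otimes>\<^sub>M Q) B \<partial>M)"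
    "emeasure m2 (A \<times> B) = (\<integral>\<^sup>+w\<in>A \<inter> E0. emeasure (fertility h (mk p w) \<Otimes>\<^sub>M Q) B \<partial>M)"
    if A [measurable]: "A \<in> sets (H n)" and B [measurable]: "B \<in> sets ?B" for A B
  proof -
    have AB: "A \<times> B \<in> sets (H n \<Otimes>\<^sub>M ?B)" by measurable
    have "emeasure m1 (A \<times> B) = (\<integral>\<^sup>+x. indicator (A \<times> B) x \<partial>m1)"
      using AB by (simp add: m1_def)
    also have "\<dots> = (\<integral>\<^sup>+w\<in>A \<inter> E0. tally (brood p B w) \<partial>M)"
      unfolding nn_m1[OF borel_measurable_indicator[OF AB]] tally_eq_suminf
      by (intro nn_integral_cong) (auto simp: brood_def indicator_def intro!: suminf_cong)
    also have "\<dots> = (\<integral>\<^sup>+w\<in>A \<inter> E0. emeasure (fertility h (mk p w) \<Otimes>\<^sub>M Q) B \<partial>M)"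
    proof (rule campbell_count[OF len B])
      show "A \<inter> E0 \<in> sets (H n)" using A E0 by simp
      fix w assume w: "w \<in> A \<inter> E0"
      then show "p \<in> generation n w" by (simp add: E0_def)
      have "emeasure (fertility h (mk p w) \<Otimes>\<^sub>M Q) B \<le> emeasure (fertility h (mk p w) \<Otimes>\<^sub>M Q) (UNIV \<times> UNIV)"
        by (rule emeasure_mono, simp, subst sets_fertility_pair_Q, simp)
      also have "\<dots> = kappa h (mk p w)"
        using emeasure_fertility_pair_Q_Times[of UNIV] Q.emeasure_space_1 by simp
      finally show "emeasure (fertility h (mk p w) \<Otimes>\<^sub>M Q) B < \<infinity>"
        using w by (auto simp: E0_def)
    qed
    finally show "emeasure m1 (A \<times> B) = (\<integral>\<^sup>+w\<in>A \<inter> E0. emeasure (fertility h (mk p w) \<Otimes>\<^sub>M Q) B \<partial>M)" .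
    have "emeasure m2 (A \<times> B) = (\<integral>\<^sup>+x. indicator (A \<times> B) x \<partial>m2)"
      using AB by (simp add: m2_def)
    also have "\<dots> = (\<integral>\<^sup>+w\<in>A \<inter> E0. emeasure (fertility h (mk p w) \<Otimes>\<^sub>M Q) B \<partial>M)"
      unfolding nn_m2[OF borel_measurable_indicator[OF AB]] emeasure_fertility_pair_Q[OF B]
      by (intro nn_integral_cong) (auto simp: indicator_times split: split_indicator)
    finally show "emeasure m2 (A \<times> B) = (\<integral>\<^sup>+w\<in>A \<inter> E0. emeasure (fertility h (mk p w) \<Otimes>\<^sub>M Q) B \<partial>M)" .
  qed
  have "m1 = m2"
  proof (rule measure_eqI_generator_eq[OF Int_stable_pair_measure_generator[of "H n" ?B], where \<Omega>="space (H n) \<times> space ?B"])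
    \<comment> \<open>The measures are finite on parents with bounded total fertility, and vanish off \<open>E0\<close>.\<close>
    define K where "K i = {w \<in> space M. kappa h (mk p w) \<le> of_nat i \<or> w \<notin> E0}" for i :: nat
    have K: "K i \<in> sets (H n)" for i
    proof -
      have [measurable]: "mk p \<in> borel_measurable (H n)" "E0 \<in> sets (H n)"
        using len E0 by (auto intro: H_mk)
      have "{w \<in> space (H n). kappa h (mk p w) \<le> of_nat i \<or> w \<notin> E0} \<in> sets (H n)"
        by measurable
      then show ?thesis by (simp add: K_def)
    qed
    let ?A = "\<lambda>i. K i \<times> (UNIV :: (real \<times> 'a) set)"
    show "range ?A \<subseteq> {a \<times> b |a b. a \<in> sets (H n) \<and> b \<in> sets ?B}"
    proof (rule image_subsetI)
      show "?A i \<in> {a \<times> b |a b. a \<in> sets (H n) \<and> b \<in> sets ?B}" for i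
        by (intro CollectI exI[of _ "K i"] exI[of _ UNIV]) (simp add: K)
    qed
    have "\<exists>i. w \<in> K i" if "w \<in> space M" for w
    proof (cases "w \<in> E0")
      case True
      then have "kappa h (mk p w) < \<infinity>" by (simp add: E0_def)
      then obtain i :: nat where "kappa h (mk p w) \<le> of_nat i"
        using ennreal_Ex_less_of_nat[of "kappa h (mk p w)"] by (auto intro: less_imp_le)
      then show ?thesis using that by (auto simp: K_def)
    qed (use that in \<open>auto simp: K_def\<close>)
    then show "(\<Union>i. ?A i) = space (H n) \<times> space ?B"
      by (auto simp: K_def)
    show "emeasure m1 (?A i) \<noteq> \<infinity>" for i
    proof -
      have "emeasure m1 (?A i) = (\<integral>\<^sup>+w\<in>K i \<inter> E0. kappa h (mk p w) \<partial>M)"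
        using rect(1)[OF K, of UNIV] emeasure_fertility_pair_Q_Times[of UNIV] Q.emeasure_space_1 by simp
      also have "\<dots> \<le> (\<integral>\<^sup>+w. of_nat i \<partial>M)"
        by (intro nn_integral_mono) (auto simp: K_def split: split_indicator)
      also have "\<dots> < \<infinity>" by (simp add: emeasure_space_1 ennreal_of_nat_eq_real_of_nat)
      finally show ?thesis by simp
    qed
    show "emeasure m1 X = emeasure m2 X" if "X \<in> {a \<times> b |a b. a \<in> sets (H n) \<and> b \<in> sets ?B}" for X
      using that rect by auto
    show "{a \<times> b |a b. a \<in> sets (H n) \<and> b \<in> sets ?B} \<subseteq> Pow (space (H n) \<times> space ?B)"
      by (rule pair_measure_closed)
  qed (simp_all only: m1_def m2_def sets_pair_measure sets_distr)
  then have eq: "(\<integral>\<^sup>+x. G x \<partial>m1) = (\<integral>\<^sup>+x. G x \<partial>m2)" by simp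
  have ae: "AE w in M. indicator E0 w = (indicator (generation n w) p :: ennreal)"
    using AE_kappa_finite_generation[of n] AE_space
    by eventually_elim (auto simp: E0_def split: split_indicator)
  have "(\<integral>\<^sup>+w. (\<Sum>l. G (w, dl (child p l) w, mk (child p l) w) * indicator (litter p w) l)
        * indicator (generation n w) p \<partial>M) = (\<integral>\<^sup>+x. G x \<partial>m1)"
    unfolding nn_m1[OF G] by (rule nn_integral_cong_AE) (use ae in eventually_elim, simp)
  also have "\<dots> = (\<integral>\<^sup>+w. (\<integral>\<^sup>+s. \<integral>\<^sup>+b. birth_rate h s (mk p w) * G (w, s, b) \<partial>Q \<partial>lborel)
        * indicator (generation n w) p \<partial>M)"
    unfolding eq nn_m2[OF G] by (rule nn_integral_cong_AE) (use ae in eventually_elim, simp)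
  finally show ?thesis .
qed

text \<open>
  The sum over the individuals of generation \<open>n\<close>, as an integral for the counting measure, so that the
  interchange theorems for integrals apply to it.
\<close>
definition gen_sum :: "nat \<Rightarrow> 'w \<Rightarrow> ('i \<times> nat list \<Rightarrow> ennreal) \<Rightarrow> ennreal" where
  "gen_sum n w F = (\<integral>\<^sup>+p. F p * indicator (generation n w) p \<partial>count_space UNIV)"

definition parent :: "'i \<times> nat list \<Rightarrow> 'i \<times> nat list" where
  "parent q = (fst q, butlast (snd q))"

lemma parent_child [simp]: "parent (child p l) = p"
  by (simp add: parent_def child_def)

lemma gen_sum_mono: "(\<And>p. p \<in> generation n w \<Longrightarrow> F p \<le> F' p) \<Longrightarrow> gen_sum n w F \<le> gen_sum n w F'"
  unfolding gen_sum_def by (intro nn_integral_mono) (auto split: split_indicator)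

lemma gen_sum_cong: "(\<And>p. p \<in> generation n w \<Longrightarrow> F p = F' p) \<Longrightarrow> gen_sum n w F = gen_sum n w F'"
  unfolding gen_sum_def by (intro nn_integral_cong) (auto split: split_indicator)

lemma gen_sum_add: "gen_sum n w (\<lambda>p. F p + F' p) = gen_sum n w F + gen_sum n w F'"
  unfolding gen_sum_def by (subst nn_integral_add[symmetric]) (auto simp: distrib_right)

lemma gen_sum_cmult: "gen_sum n w (\<lambda>p. c * F p) = c * gen_sum n w F"
  unfolding gen_sum_def by (subst nn_integral_cmult[symmetric]) (auto simp: mult.assoc)

lemma gen_sum_Suc: "gen_sum (Suc n) w F = gen_sum n w (\<lambda>p. \<Sum>l. F (child p l) * indicator (litter p w) l)"
proof -
  let ?S = "SIGMA p:generation n w. litter p w"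
  have "gen_sum (Suc n) w F = (\<integral>\<^sup>+x\<in>?S. F ((\<lambda>(p, l). child p l) x) \<partial>count_space UNIV)"
    unfolding gen_sum_def
    by (rule nn_integral_count_compose_bij[symmetric])
      (auto simp: bij_betw_def inj_on_def generation_Suc)
  also have "\<dots> = (\<integral>\<^sup>+p. \<integral>\<^sup>+l. F (child p l) * indicator ?S (p, l) \<partial>count_space UNIV \<partial>count_space UNIV)"
    using nn_integral_fst_count_space[where f="\<lambda>x. F ((\<lambda>(p, l). child p l) x) * indicator ?S x"]
    by simp
  also have "\<dots> = gen_sum n w (\<lambda>p. \<Sum>l. F (child p l) * indicator (litter p w) l)"
    unfolding gen_sum_def
    by (intro nn_integral_cong, subst nn_integral_count_space_nat[symmetric])
      (auto intro!: nn_integral_cong simp: indicator_def)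
  finally show ?thesis .
qed

lemma suminf_indicator_generation:
  "(\<Sum>n. c * indicator (generation n w) p) = c * indicator {p. snd p \<in> individuals (W (fst p) w)} p"
  for c :: ennreal
proof -
  have "(\<Sum>n. c * indicator (generation n w) p) = (\<Sum>n\<in>{length (snd p)}. c * indicator (generation n w) p)"
    by (rule suminf_finite) (auto simp: generation_def)
  also have "\<dots> = c * indicator (generation (length (snd p)) w) p"
    by (subst sum.insert) (simp_all only: finite.emptyI empty_iff not_False_eq_True sum.empty add_0_right)
  finally show ?thesis by (simp add: indicator_def generation_def)
qed

lemma suminf_gen_sum:
  "(\<Sum>n. gen_sum n w F) = (\<integral>\<^sup>+p\<in>{p. snd p \<in> individuals (W (fst p) w)}. F p \<partial>count_space UNIV)"
  unfolding gen_sum_def suminf_indicator_generation[symmetric] by (rule nn_integral_suminf[symmetric]) simp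

lemma measurable_gen_sum [measurable]:
  assumes [measurable]: "\<And>p. (\<lambda>w. F w p) \<in> borel_measurable M"
  shows "(\<lambda>w. gen_sum n w (F w)) \<in> borel_measurable M"
proof -
  have "(\<lambda>(p, w). F w p * indicator (generation n w) p) \<in> borel_measurable (count_space UNIV \<Otimes>\<^sub>M M)"
    by (intro measurable_pair_measure_countable1) auto
  then have "(\<lambda>(w, p). F w p * indicator (generation n w) p) \<in> borel_measurable (M \<Otimes>\<^sub>M count_space UNIV)"
    by (subst measurable_pair_swap_iff) simp
  then show ?thesis
    unfolding gen_sum_def
    by (intro sigma_finite_measure.borel_measurable_nn_integral sigma_finite_measure_count_space_countable) auto
qed

lemma nn_integral_gen_sum:
  assumes [measurable]: "\<And>p. (\<lambda>w. F w p) \<in> borel_measurable M"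
  shows "(\<integral>\<^sup>+w. gen_sum n w (F w) \<partial>M)
    = (\<integral>\<^sup>+p. \<integral>\<^sup>+w. F w p * indicator (generation n w) p \<partial>M \<partial>count_space UNIV)"
proof -
  interpret K: sigma_finite_measure "count_space (UNIV :: ('i \<times> nat list) set)"
    by (rule sigma_finite_measure_count_space_countable) auto
  interpret pair_sigma_finite "count_space (UNIV :: ('i \<times> nat list) set)" M ..
  show ?thesis
    unfolding gen_sum_def
    by (rule Fubini'[where f="\<lambda>p w. F w p * indicator (generation n w) p"])
      (intro measurable_pair_measure_countable1, auto)
qed

theorem campbell:
  assumes G: "\<And>p. G p \<in> borel_measurable (H n \<Otimes>\<^sub>M borel)"
  shows "(\<integral>\<^sup>+w. gen_sum (Suc n) w (\<lambda>q. G (parent q) (w, dl q w, mk q w)) \<partial>M)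
    = (\<integral>\<^sup>+w. gen_sum n w (\<lambda>p. \<integral>\<^sup>+s. \<integral>\<^sup>+b. birth_rate h s (mk p w) * G p (w, s, b) \<partial>Q \<partial>lborel) \<partial>M)"
proof -
  have m1 [measurable]: "(\<lambda>w. G p (w, dl q w, mk q w)) \<in> borel_measurable M" for p q
    by (rule measurable_compose[OF _ G]) (intro measurable_Pair borel_measurable_Pair; measurable)
  have m2: "(\<lambda>w. \<integral>\<^sup>+s. \<integral>\<^sup>+b. birth_rate h s (mk p w) * G p (w, s, b) \<partial>Q \<partial>lborel) \<in> borel_measurable M" for p
  proof -
    have [measurable]: "(\<lambda>x. G p (fst (fst x), snd (fst x), snd x)) \<in> borel_measurable ((M \<Otimes>\<^sub>M lborel) \<Otimes>\<^sub>M Q)"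
      by (rule measurable_compose[OF _ G]) (intro measurable_Pair borel_measurable_Pair; measurable)
    show ?thesis by measurable
  qed
  have "(\<integral>\<^sup>+w. gen_sum (Suc n) w (\<lambda>q. G (parent q) (w, dl q w, mk q w)) \<partial>M)
    = (\<integral>\<^sup>+w. gen_sum n w (\<lambda>p. \<Sum>l. G p (w, dl (child p l) w, mk (child p l) w) * indicator (litter p w) l) \<partial>M)"
    unfolding gen_sum_Suc parent_child ..
  also have "\<dots> = (\<integral>\<^sup>+p. \<integral>\<^sup>+w. (\<Sum>l. G p (w, dl (child p l) w, mk (child p l) w) * indicator (litter p w) l)
      * indicator (generation n w) p \<partial>M \<partial>count_space UNIV)"
    by (rule nn_integral_gen_sum) measurable
  also have "\<dots> = (\<integral>\<^sup>+p. \<integral>\<^sup>+w. (\<integral>\<^sup>+s. \<integral>\<^sup>+b. birth_rate h s (mk p w) * G p (w, s, b) \<partial>Q \<partial>lborel)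
      * indicator (generation n w) p \<partial>M \<partial>count_space UNIV)"
  proof (rule nn_integral_cong)
    fix p
    show "(\<integral>\<^sup>+w. (\<Sum>l. G p (w, dl (child p l) w, mk (child p l) w) * indicator (litter p w) l)
        * indicator (generation n w) p \<partial>M)
      = (\<integral>\<^sup>+w. (\<integral>\<^sup>+s. \<integral>\<^sup>+b. birth_rate h s (mk p w) * G p (w, s, b) \<partial>Q \<partial>lborel)
        * indicator (generation n w) p \<partial>M)"
    proof (cases "length (snd p) = n")
      case True
      then show ?thesis by (rule campbell_litter[OF _ G])
    next
      case False
      then have "p \<notin> generation n w" for w by (simp add: generation_def)
      then show ?thesis by simp
    qed
  qed
  also have "\<dots> = (\<integral>\<^sup>+w. gen_sum n w (\<lambda>p. \<integral>\<^sup>+s. \<integral>\<^sup>+b. birth_rate h s (mk p w) * G p (w, s, b) \<partial>Q \<partial>lborel) \<partial>M)"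
    by (rule nn_integral_gen_sum[symmetric]) (rule m2)
  finally show ?thesis .
qed

end

context cascades begin

lemma integral_offspring_event:
  fixes Z :: "'w \<Rightarrow> complex"
  assumes J: "finite J"
    and len: "\<And>j. j \<in> J \<Longrightarrow> length (snd (p j)) = n"
    and B: "\<And>j. j \<in> J \<Longrightarrow> B j \<in> sets borel"
    and disj: "\<And>j j'. j \<in> J \<Longrightarrow> j' \<in> J \<Longrightarrow> j \<noteq> j' \<Longrightarrow> p j = p j' \<Longrightarrow> B j \<inter> B j' = {}"
    and Z [measurable]: "Z \<in> borel_measurable (H n)" and Z_le: "\<And>w. norm (Z w) \<le> 1"
    and ex: "\<And>w. w \<in> space M \<Longrightarrow> Z w \<noteq> 0 \<Longrightarrow> \<forall>j\<in>J. p j \<in> generation n w"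
  shows "(\<integral>w. Z w * of_bool (\<forall>j\<in>J. tally (brood (p j) (B j) w) = of_nat (k j)) \<partial>M)
    = (\<integral>w. Z w * of_real (\<Prod>j\<in>J. poisson_weight (emeasure (fertility h (mk (p j) w) \<Otimes>\<^sub>M Q) (B j)) (k j)) \<partial>M)"
proof -
  have ZM [measurable]: "Z \<in> borel_measurable M" using Z by (rule measurable_H_M)
  note B [measurable]
  let ?b = "\<lambda>w. \<forall>j\<in>J. tally (brood (p j) (B j) w) = of_nat (k j)"
  let ?w = "\<lambda>w. \<Prod>j\<in>J. poisson_weight (emeasure (fertility h (mk (p j) w) \<Otimes>\<^sub>M Q) (B j)) (k j)"
  have b [measurable]: "Measurable.pred M ?b"
    by (rule pred_intros_finite(3)[OF J]) (use measurable_tally_brood B in measurable)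
  have b' [measurable]: "(\<lambda>w. of_bool (?b w) :: real) \<in> borel_measurable M"
    "(\<lambda>w. of_bool (?b w) :: complex) \<in> borel_measurable M"
    by (rule measurable_compose[OF b], simp)+
  have w [measurable]: "?w \<in> borel_measurable M" by measurable
  have w_le: "\<bar>?w w\<bar> \<le> 1" "0 \<le> ?w w" for w
    by (auto intro!: prod_nonneg prod_le_1 simp: abs_prod poisson_weight_le_1)
  have ib: "integrable M (\<lambda>w. Z w * of_bool (?b w))"
    using Z_le by (intro integrable_const_bound[where B=1]) (auto simp: norm_mult)
  have iw: "integrable M (\<lambda>w. Z w * of_real (?w w))"
    using Z_le w_le
    by (intro integrable_const_bound[where B=1] AE_I2)
      (auto simp: norm_mult simp del: of_real_prod intro!: mult_le_one)
  have re_im: "(\<integral>w. Re (Z w) * of_bool (?b w) \<partial>M) = (\<integral>w. Re (Z w) * ?w w \<partial>M)"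
    "(\<integral>w. Im (Z w) * of_bool (?b w) \<partial>M) = (\<integral>w. Im (Z w) * ?w w \<partial>M)"
  proof -
    have *: "(\<integral>w. r (Z w) * of_bool (?b w) \<partial>M) = (\<integral>w. r (Z w) * ?w w \<partial>M)"
      if [measurable]: "r \<in> borel_measurable borel" and r: "\<And>z. \<bar>r z\<bar> \<le> norm z" for r :: "complex \<Rightarrow> real"
    proof (rule integral_offspring_event_real)
      show "\<bar>r (Z w)\<bar> \<le> 1" for w using r Z_le by (rule order_trans)
      show "\<forall>j\<in>J. p j \<in> generation n w" if "w \<in> space M" "r (Z w) \<noteq> 0" for w
      proof -
        have "Z w \<noteq> 0" using that(2) r[of 0] by auto
        then show ?thesis by (rule ex[OF that(1)])
      qed
    qed (use J len B disj in auto)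
    show "(\<integral>w. Re (Z w) * of_bool (?b w) \<partial>M) = (\<integral>w. Re (Z w) * ?w w \<partial>M)"
      by (rule *) (auto simp: abs_Re_le_cmod)
    show "(\<integral>w. Im (Z w) * of_bool (?b w) \<partial>M) = (\<integral>w. Im (Z w) * ?w w \<partial>M)"
      by (rule *) (auto simp: abs_Im_le_cmod)
  qed
  show ?thesis
  proof (rule complex_eqI)
    have "Re (\<integral>w. Z w * of_bool (?b w) \<partial>M) = (\<integral>w. Re (Z w) * of_bool (?b w) \<partial>M)"
      unfolding integral_Re[OF ib, symmetric] by (intro Bochner_Integration.integral_cong) auto
    also have "\<dots> = Re (\<integral>w. Z w * of_real (?w w) \<partial>M)"
      unfolding integral_Re[OF iw, symmetric] re_im by (intro Bochner_Integration.integral_cong) (simp_all del: of_real_prod)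
    finally show "Re (\<integral>w. Z w * of_bool (?b w) \<partial>M) = Re (\<integral>w. Z w * of_real (?w w) \<partial>M)" .
    have "Im (\<integral>w. Z w * of_bool (?b w) \<partial>M) = (\<integral>w. Im (Z w) * of_bool (?b w) \<partial>M)"
      unfolding integral_Im[OF ib, symmetric] by (intro Bochner_Integration.integral_cong) auto
    also have "\<dots> = Im (\<integral>w. Z w * of_real (?w w) \<partial>M)"
      unfolding integral_Im[OF iw, symmetric] re_im by (intro Bochner_Integration.integral_cong) (simp_all del: of_real_prod)
    finally show "Im (\<integral>w. Z w * of_bool (?b w) \<partial>M) = Im (\<integral>w. Z w * of_real (?w w) \<partial>M)" .
  qed
qed

end

section \<open>Active clusters\<close>

text \<open>
  The clusters under study are those with index in the random set \<open>A\<close>: the whole family for a single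
  cascade, the immigrants of \<open>[0, t]\<close> for a Hawkes process. Their ancestors' marks have mean measure
  \<open>m * Q\<close>, as the marks of all later generations have a multiple of \<open>Q\<close> as mean measure.
\<close>
locale active_cascades = cascades Q h M \<G> W
  for Q :: "'a::polish_space measure" and h :: "real \<Rightarrow> 'a \<Rightarrow> real" and M :: "'w measure"
    and \<G> :: "'w measure" and W :: "'i::countable \<Rightarrow> 'w \<Rightarrow> 'a cascade_tree" +
  fixes A :: "'w \<Rightarrow> 'i set" and m :: ennreal
  assumes A: "\<And>i. Measurable.pred \<G> (\<lambda>w. i \<in> A w)"
    and m: "m < \<infinity>"
    and root_mean: "\<And>\<psi>. \<psi> \<in> borel_measurable borel \<Longrightarrow>
      (\<integral>\<^sup>+w. gen_sum 0 w (\<lambda>p. indicator (A w) (fst p) * \<psi> (mk p w)) \<partial>M) = m * (\<integral>\<^sup>+a. \<psi> a \<partial>Q)"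
begin

definition active :: "nat \<Rightarrow> 'w \<Rightarrow> ('i \<times> nat list) set" where
  "active n w = {p \<in> generation n w. fst p \<in> A w}"

lemma H_A [measurable]: "Measurable.pred (H n) (\<lambda>w. i \<in> A w)"
  using A by (rule measurable_G_H)

lemma H_active: "k \<le> n \<Longrightarrow> Measurable.pred (H n) (\<lambda>w. p \<in> active k w)"
proof -
  assume "k \<le> n"
  then have [measurable]: "Measurable.pred (H n) (\<lambda>w. p \<in> generation k w)" by (rule H_generation)
  show ?thesis unfolding active_def mem_Collect_eq by measurable
qed

lemma measurable_active [measurable]: "Measurable.pred M (\<lambda>w. p \<in> active n w)"
  using H_active[OF order_refl] by (rule measurable_H_M)

text \<open>
  The mark of a child has law \<open>Q\<close> whatever its parent, so each generation multiplies the mean number of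
  individuals by the mean total fertility.
\<close>
lemma mean_active:
  assumes [measurable]: "\<psi> \<in> borel_measurable borel"
  shows "(\<integral>\<^sup>+w. gen_sum n w (\<lambda>p. indicator (A w) (fst p) * \<psi> (mk p w)) \<partial>M)
    = m * (\<integral>\<^sup>+a. kappa h a \<partial>Q) ^ n * (\<integral>\<^sup>+a. \<psi> a \<partial>Q)"
  using assms
proof (induction n arbitrary: \<psi>)
  case 0
  then show ?case by (simp add: root_mean)
next
  case (Suc n)
  note [measurable] = Suc.prems
  define G where "G p x = indicator (A (fst x)) (fst p) * \<psi> (snd (snd x))" for p :: "'i \<times> nat list" and x :: "'w \<times> real \<times> 'a"
  have "(\<lambda>x::real \<times> 'a. \<psi> (snd x)) \<in> borel_measurable borel"
    unfolding borel_prod[symmetric] by measurable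
  from measurable_compose[OF measurable_snd this]
  have [measurable]: "(\<lambda>x. \<psi> (snd (snd x))) \<in> borel_measurable (H n \<Otimes>\<^sub>M (borel :: (real \<times> 'a) measure))" .
  have G: "G p \<in> borel_measurable (H n \<Otimes>\<^sub>M borel)" for p
    unfolding G_def by measurable
  have fst_parent: "fst (parent q) = fst q" for q by (simp add: parent_def)
  have "(\<integral>\<^sup>+w. gen_sum (Suc n) w (\<lambda>p. indicator (A w) (fst p) * \<psi> (mk p w)) \<partial>M)
    = (\<integral>\<^sup>+w. gen_sum n w (\<lambda>p. \<integral>\<^sup>+s. \<integral>\<^sup>+b. birth_rate h s (mk p w) * G p (w, s, b) \<partial>Q \<partial>lborel) \<partial>M)"
    using campbell[where G=G, OF G] by (simp add: G_def fst_parent)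
  also have "\<dots> = (\<integral>\<^sup>+w. gen_sum n w (\<lambda>p. indicator (A w) (fst p) * (kappa h (mk p w) * (\<integral>\<^sup>+b. \<psi> b \<partial>Q))) \<partial>M)"
    by (intro nn_integral_cong gen_sum_cong)
      (simp add: G_def nn_integral_cmult nn_integral_multc kappa_eq mult_ac)
  also have "\<dots> = m * (\<integral>\<^sup>+a. kappa h a \<partial>Q) ^ n * (\<integral>\<^sup>+a. kappa h a * (\<integral>\<^sup>+b. \<psi> b \<partial>Q) \<partial>Q)"
    by (rule Suc.IH) measurable
  also have "(\<integral>\<^sup>+a. kappa h a * (\<integral>\<^sup>+b. \<psi> b \<partial>Q) \<partial>Q) = (\<integral>\<^sup>+a. kappa h a \<partial>Q) * (\<integral>\<^sup>+b. \<psi> b \<partial>Q)"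
    by (rule nn_integral_multc) measurable
  finally show ?case by (simp add: mult_ac)
qed

lemma gen_sum_active: "gen_sum n w (\<lambda>p. indicator (A w) (fst p) * F p)
    = (\<integral>\<^sup>+p. F p * indicator (active n w) p \<partial>count_space UNIV)"
  unfolding gen_sum_def by (intro nn_integral_cong) (auto simp: active_def split: split_indicator)

lemma AE_finite_active: "AE w in M. \<forall>n. finite (active n w)"
proof (unfold AE_all_countable, rule allI)
  fix n
  have "(\<integral>\<^sup>+w. gen_sum n w (\<lambda>p. indicator (A w) (fst p) * (\<lambda>_. 1) (mk p w)) \<partial>M)
      = m * (\<integral>\<^sup>+a. kappa h a \<partial>Q) ^ n"
    by (subst mean_active) (simp_all add: Q.emeasure_space_1[simplified])
  moreover have "m * (\<integral>\<^sup>+a. kappa h a \<partial>Q) ^ n < \<infinity>"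
    using m mean_kappa by (auto simp: ennreal_mult_less_top power_less_top_ennreal intro: order_less_trans)
  ultimately have "AE w in M. gen_sum n w (\<lambda>p. indicator (A w) (fst p) * (\<lambda>_. 1) (mk p w)) \<noteq> \<infinity>"
    by (intro nn_integral_noteq_infinite) auto
  then show "AE w in M. finite (active n w)"
  proof eventually_elim
    case (elim w)
    then show ?case
      using gen_sum_active[of n w "\<lambda>_. 1"] by (auto simp: emeasure_count_space split: if_splits)
  qed
qed

lemma child_in_active: "child p l \<in> active (Suc n) w \<longleftrightarrow> p \<in> active n w \<and> l \<in> litter p w"
  by (auto simp: active_def child_in_generation) (simp_all add: child_def)

lemma active_Suc: "active (Suc n) w = (\<lambda>(p, l). child p l) ` (SIGMA p:active n w. litter p w)"
proof (intro set_eqI iffI)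
  fix q assume q: "q \<in> active (Suc n) w"
  then have "q \<in> generation (Suc n) w" by (simp add: active_def)
  then obtain p l where "q = child p l" unfolding generation_Suc by auto
  with q show "q \<in> (\<lambda>(p, l). child p l) ` (SIGMA p:active n w. litter p w)"
    by (intro image_eqI[of _ _ "(p, l)"]) (auto simp: child_in_active)
qed (auto simp: child_in_active)

lemma finite_litter: "finite (active (Suc n) w) \<Longrightarrow> p \<in> active n w \<Longrightarrow> finite (litter p w)"
  by (rule inj_on_finite[of "child p" _ "active (Suc n) w"])
    (auto simp: inj_on_def child_in_active)

lemma prod_active_Suc:
  fixes F :: "'i \<times> nat list \<Rightarrow> complex"
  assumes "finite (active n w)" and "finite (active (Suc n) w)"
  shows "(\<Prod>q\<in>active (Suc n) w. F q) = (\<Prod>p\<in>active n w. \<Prod>l\<in>litter p w. F (child p l))"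
proof -
  have "(\<Prod>q\<in>active (Suc n) w. F q) = (\<Prod>(p, l)\<in>(SIGMA p:active n w. litter p w). F (child p l))"
    unfolding active_Suc by (subst prod.reindex) (auto simp: inj_on_def case_prod_unfold)
  also have "\<dots> = (\<Prod>p\<in>active n w. \<Prod>l\<in>litter p w. F (child p l))"
    using assms by (subst prod.Sigma) (auto intro: finite_litter)
  finally show ?thesis .
qed

lemma length_active: "p \<in> active n w \<Longrightarrow> length (snd p) = n"
  by (simp add: active_def generation_def)

lemma H_prod_active:
  fixes \<psi> :: "'a \<Rightarrow> complex"
  assumes "k \<le> n" and [measurable]: "\<psi> \<in> borel_measurable borel"
  shows "(\<lambda>w. \<Prod>p\<in>active k w. \<psi> (mk p w)) \<in> borel_measurable (H n)"
proof -
  have "(\<lambda>w. \<Prod>p\<in>active k w. if length (snd p) = k then \<psi> (mk p w) else 1) \<in> borel_measurable (H n)"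
  proof (rule borel_measurable_prod_random_set)
    fix p :: "'i \<times> nat list"
    show "(\<lambda>w. if length (snd p) = k then \<psi> (mk p w) else 1) \<in> borel_measurable (H n)"
      using H_mk[of p n] assms(1) by (cases "length (snd p) = k") auto
    show "Measurable.pred (H n) (\<lambda>w. p \<in> active k w)" using assms(1) by (rule H_active)
  qed
  also have "(\<lambda>w. \<Prod>p\<in>active k w. if length (snd p) = k then \<psi> (mk p w) else 1) = (\<lambda>w. \<Prod>p\<in>active k w. \<psi> (mk p w))"
    by (intro ext prod.cong) (auto dest: length_active)
  finally show ?thesis .
qed


section \<open>The generating functional of the generations\<close>

text \<open>
  The parents form a fixed set here. The product of \<open>\<psi>\<close> depends on the marks of the children alone, so
  that only sets of the form \<open>UNIV \<times> S\<close> are counted, with mean \<open>kappa * Q S\<close>.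
\<close>
lemma integral_prod_litters:
  fixes Z :: "'w \<Rightarrow> complex" and \<psi> :: "'a \<Rightarrow> complex"
  assumes F: "finite F" and len: "\<And>p. p \<in> F \<Longrightarrow> length (snd p) = n"
    and Z: "Z \<in> borel_measurable (H n)" and Z_le: "\<And>w. norm (Z w) \<le> 1"
    and ex: "\<And>w. w \<in> space M \<Longrightarrow> Z w \<noteq> 0 \<Longrightarrow> F \<subseteq> active n w"
    and \<psi>: "\<psi> \<in> borel_measurable borel" "\<And>a. norm (\<psi> a) \<le> 1"
  shows "(\<integral>w. Z w * (\<Prod>p\<in>F. \<Prod>l\<in>litter p w. \<psi> (mk (child p l) w)) \<partial>M)
    = (\<integral>w. Z w * (\<Prod>p\<in>F. exp (of_real (enn2real (kappa h (mk p w))) * ((\<integral>a. \<psi> a \<partial>Q) - 1))) \<partial>M)"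
proof -
  have [measurable]: "Z \<in> borel_measurable M" using Z by (rule measurable_H_M)
  have fin: "AE w in M. Z w \<noteq> 0 \<longrightarrow> (\<forall>p\<in>F. finite (litter p w))"
    using AE_finite_active AE_space
  proof eventually_elim
    case (elim w)
    then show ?case using ex[of w] finite_litter[of n w] by blast
  qed
  show ?thesis
  proof (rule integral_prod_poisson_marks[OF Q.prob_space_axioms F])
    show "integrable M Z" using Z_le by (intro integrable_const_bound[where B=1]) auto
    show "AE w in M. Z w \<noteq> 0 \<longrightarrow> (\<forall>p\<in>F. finite (litter p w))" by (rule fin)
    fix C :: "complex set" and S :: "complex \<Rightarrow> 'a set" and k :: "('i \<times> nat list) \<times> complex \<Rightarrow> nat"
    assume C: "finite C" and S: "\<And>c. c \<in> C \<Longrightarrow> S c \<in> sets Q" and disj: "disjoint_family_on S C"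
    let ?J = "F \<times> C"
    define B where "B j = (UNIV :: real set) \<times> S (snd j)" for j :: "('i \<times> nat list) \<times> complex"
    have B: "B j \<in> sets borel" if "j \<in> ?J" for j
    proof -
      have [measurable]: "S (snd j) \<in> sets borel" using S that by auto
      show ?thesis unfolding B_def borel_prod[symmetric] by measurable
    qed
    have ev: "(\<integral>w. Z w * of_bool (\<forall>j\<in>?J. tally (brood (fst j) (B j) w) = of_nat (k j)) \<partial>M)
      = (\<integral>w. Z w * of_real (\<Prod>j\<in>?J. poisson_weight (emeasure (fertility h (mk (fst j) w) \<Otimes>\<^sub>M Q) (B j)) (k j)) \<partial>M)"
    proof (rule integral_offspring_event)
      show "B j \<inter> B j' = {}" if "j \<in> ?J" "j' \<in> ?J" "j \<noteq> j'" "fst j = fst j'" for j j'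
        using that disj by (cases j; cases j') (auto simp: B_def disjoint_family_on_def)
      show "\<forall>j\<in>?J. fst j \<in> generation n w" if "w \<in> space M" "Z w \<noteq> 0" for w
        using ex[OF that] by (auto simp: active_def)
    qed (use F C len B Z Z_le in auto)
    have brood_eq: "brood (fst j) (B j) w = {l \<in> litter (fst j) w. mk (child (fst j) l) w \<in> S (snd j)}" for j w
      by (auto simp: brood_def B_def)
    have "(\<integral>w. Z w * of_real (\<Prod>j\<in>?J. poisson_weight (emeasure (fertility h (mk (fst j) w) \<Otimes>\<^sub>M Q) (B j)) (k j)) \<partial>M)
      = (\<integral>w. Z w * of_real (\<Prod>j\<in>?J. poisson_weight
           (ennreal (enn2real (kappa h (mk (fst j) w)) * measure Q (S (snd j)))) (k j)) \<partial>M)"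
    proof (rule integral_cong_AE)
      note [measurable] = B
      show "(\<lambda>w. Z w * of_real (\<Prod>j\<in>?J. poisson_weight (emeasure (fertility h (mk (fst j) w) \<Otimes>\<^sub>M Q) (B j)) (k j))) \<in> borel_measurable M"
        by measurable
      show "(\<lambda>w. Z w * of_real (\<Prod>j\<in>?J. poisson_weight
         (ennreal (enn2real (kappa h (mk (fst j) w)) * measure Q (S (snd j)))) (k j))) \<in> borel_measurable M"
        by measurable
      show "AE w in M. Z w * of_real (\<Prod>j\<in>?J. poisson_weight (emeasure (fertility h (mk (fst j) w) \<Otimes>\<^sub>M Q) (B j)) (k j))
        = Z w * of_real (\<Prod>j\<in>?J. poisson_weight
         (ennreal (enn2real (kappa h (mk (fst j) w)) * measure Q (S (snd j)))) (k j))"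
        using AE_kappa_finite_generation[of n] AE_space
      proof eventually_elim
        case (elim w)
        show ?case
        proof (cases "Z w = 0")
          case False
          have "emeasure (fertility h (mk (fst j) w) \<Otimes>\<^sub>M Q) (B j)
            = ennreal (enn2real (kappa h (mk (fst j) w)) * measure Q (S (snd j)))" if j: "j \<in> ?J" for j
          proof -
            have "fst j \<in> generation n w" using ex[OF elim(2) False] j by (auto simp: active_def)
            then have "ennreal (enn2real (kappa h (mk (fst j) w))) = kappa h (mk (fst j) w)"
              using elim(1) by simp
            moreover have "S (snd j) \<in> sets borel" using S j by auto
            ultimately show ?thesis
              unfolding B_def by (simp add: emeasure_fertility_pair_Q_Times Q.emeasure_eq_measure ennreal_mult)
          qed
          then show ?thesis by (simp cong: prod.cong)
        qed simp
      qed
    qed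
    with ev show "(\<integral>w. Z w * of_bool (\<forall>j\<in>?J. tally
        {l \<in> litter (fst j) w. mk (child (fst j) l) w \<in> S (snd j)} = of_nat (k j)) \<partial>M)
      = (\<integral>w. Z w * of_real (\<Prod>j\<in>?J. poisson_weight
           (ennreal (enn2real (kappa h (mk (fst j) w)) * measure Q (S (snd j)))) (k j)) \<partial>M)"
      unfolding brood_eq by simp
  qed (use \<psi> in auto)
qed

end

context active_cascades begin

text \<open>
  The random set of parents is first restricted to the labels with code below \<open>m\<close>. Then it takes finitely
  many values, each on an event of the history, and the case of a fixed set applies. As \<open>m\<close> grows, the
  products stabilise because the generation is finite.
\<close>
lemma integral_prod_active_Suc:
  fixes Z :: "'w \<Rightarrow> complex" and \<psi> :: "'a \<Rightarrow> complex"
  assumes Z: "Z \<in> borel_measurable (H n)" and Z_le: "\<And>w. norm (Z w) \<le> 1"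
    and \<psi> [measurable]: "\<psi> \<in> borel_measurable borel" and \<psi>_le: "\<And>a. norm (\<psi> a) \<le> 1"
  shows "(\<integral>w. Z w * (\<Prod>q\<in>active (Suc n) w. \<psi> (mk q w)) \<partial>M)
    = (\<integral>w. Z w * (\<Prod>p\<in>active n w. exp (of_real (enn2real (kappa h (mk p w))) * ((\<integral>a. \<psi> a \<partial>Q) - 1))) \<partial>M)"
proof -
  have ZM [measurable]: "Z \<in> borel_measurable M" using Z by (rule measurable_H_M)
  define X where "X p w = (\<Prod>l\<in>litter p w. \<psi> (mk (child p l) w))" for p w
  define Y where "Y p w = exp (of_real (enn2real (kappa h (mk p w))) * ((\<integral>a. \<psi> a \<partial>Q) - 1))" for p w
  have X [measurable]: "X p \<in> borel_measurable M" for p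
    unfolding X_def by (intro borel_measurable_prod_random_set) measurable
  have Y [measurable]: "Y p \<in> borel_measurable M" for p
    unfolding Y_def by measurable
  have X_le: "norm (X p w) \<le> 1" for p w
    unfolding X_def by (intro norm_prod_le_1 \<psi>_le)
  have Y_le: "norm (Y p w) \<le> 1" for p w
    unfolding Y_def
    by (intro poisson_gf_norm_le_1 enn2real_nonneg Q.norm_expectation_le_1 \<psi>_le) simp
  define P where "P m = {p :: 'i \<times> nat list. to_nat p < m \<and> length (snd p) = n}" for m
  have P: "finite (P m)" for m
  proof -
    have "finite {p :: 'i \<times> nat list. to_nat p < m}"
      by (subst finite_iff_to_nat_bounded) auto
    then show ?thesis by (rule rev_finite_subset) (auto simp: P_def)
  qed
  have finite_stage: "(\<integral>w. Z w * (\<Prod>p\<in>P m \<inter> active n w. X p w) \<partial>M)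
      = (\<integral>w. Z w * (\<Prod>p\<in>P m \<inter> active n w. Y p w) \<partial>M)" for m
  proof -
    define D where "D F = {w \<in> space M. P m \<inter> active n w = F}" for F
    have D: "D F \<in> sets (H n)" if "F \<subseteq> P m" for F
    proof -
      have [measurable]: "Measurable.pred (H n) (\<lambda>w. p \<in> active n w)" for p
        by (rule H_active) simp
      have "D F = {w \<in> space (H n). \<forall>p\<in>P m. p \<in> active n w \<longleftrightarrow> p \<in> F}"
        using that by (auto simp: D_def)
      also have "\<dots> \<in> sets (H n)" using P by measurable
      finally show ?thesis .
    qed
    have split: "(\<integral>w. Z w * (\<Prod>p\<in>P m \<inter> active n w. V p w) \<partial>M)
        = (\<Sum>F\<in>Pow (P m). \<integral>w. (Z w * indicator (D F) w) * (\<Prod>p\<in>F. V p w) \<partial>M)"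
      if V [measurable]: "\<And>p. V p \<in> borel_measurable M" and V_le: "\<And>p w. norm (V p w) \<le> 1" for V
    proof -
      have "(\<integral>w. Z w * (\<Prod>p\<in>P m \<inter> active n w. V p w) \<partial>M)
        = (\<integral>w. (\<Sum>F\<in>Pow (P m). (Z w * indicator (D F) w) * (\<Prod>p\<in>F. V p w)) \<partial>M)"
      proof (rule Bochner_Integration.integral_cong[OF refl])
        fix w assume w: "w \<in> space M"
        let ?F = "P m \<inter> active n w"
        have "(\<Sum>F\<in>Pow (P m). (Z w * indicator (D F) w) * (\<Prod>p\<in>F. V p w))
          = (\<Sum>F\<in>Pow (P m). if F = ?F then Z w * (\<Prod>p\<in>F. V p w) else 0)"
          using w by (intro sum.cong) (auto simp: D_def)
        also have "\<dots> = Z w * (\<Prod>p\<in>?F. V p w)"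
          using P by (subst sum.delta) auto
        finally show "Z w * (\<Prod>p\<in>?F. V p w) = (\<Sum>F\<in>Pow (P m). (Z w * indicator (D F) w) * (\<Prod>p\<in>F. V p w))" ..
      qed
      also have "\<dots> = (\<Sum>F\<in>Pow (P m). \<integral>w. (Z w * indicator (D F) w) * (\<Prod>p\<in>F. V p w) \<partial>M)"
      proof (rule Bochner_Integration.integral_sum)
        fix F assume "F \<in> Pow (P m)"
        then have [measurable]: "D F \<in> sets M" using D sets_H_subset by auto
        show "integrable M (\<lambda>w. (Z w * indicator (D F) w) * (\<Prod>p\<in>F. V p w))"
        proof (rule integrable_const_bound[where B=1])
          show "AE w in M. norm ((Z w * indicator (D F) w) * (\<Prod>p\<in>F. V p w)) \<le> 1"
            unfolding norm_mult using Z_le V_le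
            by (intro AE_I2 mult_le_one norm_prod_le_1) (auto split: split_indicator)
        qed measurable
      qed
      finally show ?thesis .
    qed
    have "(\<integral>w. (Z w * indicator (D F) w) * (\<Prod>p\<in>F. X p w) \<partial>M)
        = (\<integral>w. (Z w * indicator (D F) w) * (\<Prod>p\<in>F. Y p w) \<partial>M)" if F: "F \<in> Pow (P m)" for F
      unfolding X_def Y_def
    proof (rule integral_prod_litters)
      show "finite F" using F P by (auto intro: finite_subset)
      show "length (snd p) = n" if "p \<in> F" for p using that F by (auto simp: P_def)
      show "(\<lambda>w. Z w * indicator (D F) w) \<in> borel_measurable (H n)"
        using Z D[of F] F by (intro borel_measurable_times borel_measurable_indicator) auto
      show "norm (Z w * indicator (D F) w) \<le> 1" for w
        using Z_le[of w] by (auto split: split_indicator)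
      show "F \<subseteq> active n w" if "w \<in> space M" "Z w * indicator (D F) w \<noteq> 0" for w
        using that by (auto simp: D_def split: split_indicator_asm)
    qed (use \<psi>_le in auto)
    then show ?thesis
      by (simp only: split[of X, OF X X_le] split[of Y, OF Y Y_le] cong: sum.cong)
  qed
  have limit: "(\<lambda>m. \<integral>w. Z w * (\<Prod>p\<in>P m \<inter> active n w. V p w) \<partial>M)
      \<longlonglongrightarrow> (\<integral>w. Z w * (\<Prod>p\<in>active n w. V p w) \<partial>M)"
    if V [measurable]: "\<And>p. V p \<in> borel_measurable M" and V_le: "\<And>p w. norm (V p w) \<le> 1" for V
  proof (rule integral_dominated_convergence[where w="\<lambda>_. 1"])
    show "(\<lambda>w. Z w * (\<Prod>p\<in>active n w. V p w)) \<in> borel_measurable M"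
      by (intro borel_measurable_times borel_measurable_prod_random_set) measurable
    show "(\<lambda>w. Z w * (\<Prod>p\<in>P m \<inter> active n w. V p w)) \<in> borel_measurable M" for m
      by (intro borel_measurable_times borel_measurable_prod_random_set)
        (unfold Int_iff, measurable)
    show "AE w in M. norm (Z w * (\<Prod>p\<in>P m \<inter> active n w. V p w)) \<le> 1" for m
      unfolding norm_mult by (intro AE_I2 mult_le_one norm_prod_le_1 V_le Z_le norm_ge_zero)
    show "AE w in M. (\<lambda>m. Z w * (\<Prod>p\<in>P m \<inter> active n w. V p w)) \<longlonglongrightarrow> Z w * (\<Prod>p\<in>active n w. V p w)"
      using AE_finite_active
    proof eventually_elim
      case (elim w)
      then have fin: "finite (active n w)" by simp
      obtain m0 where m0: "\<And>p. p \<in> active n w \<Longrightarrow> to_nat p < m0"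
        using fin unfolding finite_iff_to_nat_bounded by auto
      have "P m \<inter> active n w = active n w" if "m0 \<le> m" for m
        using that by (auto simp: P_def dest: length_active intro: order_less_le_trans[OF m0])
      then show ?case
        by (intro tendsto_eventually eventually_sequentiallyI[of m0]) simp
    qed
  qed auto
  have "(\<integral>w. Z w * (\<Prod>p\<in>active n w. X p w) \<partial>M) = (\<integral>w. Z w * (\<Prod>p\<in>active n w. Y p w) \<partial>M)"
    using LIMSEQ_unique[OF limit[of X, OF X X_le, unfolded finite_stage] limit[of Y, OF Y Y_le]] .
  moreover have "(\<integral>w. Z w * (\<Prod>q\<in>active (Suc n) w. \<psi> (mk q w)) \<partial>M)
      = (\<integral>w. Z w * (\<Prod>p\<in>active n w. X p w) \<partial>M)"
  proof (rule integral_cong_AE)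
    show "(\<lambda>w. Z w * (\<Prod>q\<in>active (Suc n) w. \<psi> (mk q w))) \<in> borel_measurable M"
      by (intro borel_measurable_times borel_measurable_prod_random_set) measurable
    show "(\<lambda>w. Z w * (\<Prod>p\<in>active n w. X p w)) \<in> borel_measurable M"
      by (intro borel_measurable_times borel_measurable_prod_random_set) measurable
    show "AE w in M. Z w * (\<Prod>q\<in>active (Suc n) w. \<psi> (mk q w)) = Z w * (\<Prod>p\<in>active n w. X p w)"
      using AE_finite_active by eventually_elim (simp add: prod_active_Suc X_def)
  qed
  ultimately show ?thesis by (simp add: Y_def)
qed

end

context hawkes_kernel begin

text \<open>
  The generating functional, at \<open>g\<close>, of the marks in generations \<open>0\<close> to \<open>k\<close> of a cascade whose ancestor
  has mark \<open>a\<close>.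
\<close>
primrec cluster_gf :: "('a \<Rightarrow> complex) \<Rightarrow> nat \<Rightarrow> 'a \<Rightarrow> complex" where
  "cluster_gf g 0 a = g a"
| "cluster_gf g (Suc k) a = g a * exp (of_real (enn2real (kappa h a)) * ((\<integral>b. cluster_gf g k b \<partial>Q) - 1))"

lemma measurable_cluster_gf [measurable]:
  assumes [measurable]: "g \<in> borel_measurable borel"
  shows "cluster_gf g k \<in> borel_measurable borel"
proof (cases k)
  case (Suc j)
  have "(\<lambda>a. g a * exp (of_real (enn2real (kappa h a)) * ((\<integral>b. cluster_gf g j b \<partial>Q) - 1))) \<in> borel_measurable borel"
    by measurable
  then show ?thesis by (simp add: Suc fun_eq_iff cong: measurable_cong)
qed (simp add: assms cong: measurable_cong)

lemma norm_cluster_gf_le_1: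
  assumes [measurable]: "g \<in> borel_measurable borel" and g: "\<And>a. norm (g a) \<le> 1"
  shows "norm (cluster_gf g k a) \<le> 1"
proof (induction k arbitrary: a)
  case (Suc k)
  then show ?case
    by (auto simp: norm_mult simp del: norm_exp_eq_Re intro!: mult_le_one g poisson_gf_norm_le_1 Q.norm_expectation_le_1)
qed (simp add: g)

end

context active_cascades begin

text \<open>
  The last generation is integrated out given the earlier ones, which turns \<open>cluster_gf g k\<close> on
  generation \<open>n + 1\<close> into \<open>cluster_gf g (k + 1)\<close> on generation \<open>n\<close>; then the next, down to the roots.
\<close>
theorem generating_functional:
  fixes g :: "'a \<Rightarrow> complex"
  assumes g [measurable]: "g \<in> borel_measurable borel" and g_le: "\<And>a. norm (g a) \<le> 1"
  shows "(\<integral>w. (\<Prod>j<Suc n. \<Prod>p\<in>active j w. g (mk p w)) \<partial>M)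
    = (\<integral>w. (\<Prod>p\<in>active 0 w. cluster_gf g n (mk p w)) \<partial>M)"
proof -
  have "(\<integral>w. (\<Prod>j<n. \<Prod>p\<in>active j w. g (mk p w)) * (\<Prod>p\<in>active n w. cluster_gf g k (mk p w)) \<partial>M)
    = (\<integral>w. (\<Prod>p\<in>active 0 w. cluster_gf g (n + k) (mk p w)) \<partial>M)" for k n
  proof (induction n arbitrary: k)
    case (Suc n)
    have "(\<integral>w. (\<Prod>j<Suc n. \<Prod>p\<in>active j w. g (mk p w)) * (\<Prod>p\<in>active (Suc n) w. cluster_gf g k (mk p w)) \<partial>M)
      = (\<integral>w. (\<Prod>j<Suc n. \<Prod>p\<in>active j w. g (mk p w))
          * (\<Prod>p\<in>active n w. exp (of_real (enn2real (kappa h (mk p w))) * ((\<integral>a. cluster_gf g k a \<partial>Q) - 1))) \<partial>M)"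
      by (rule integral_prod_active_Suc)
        (use g_le in \<open>auto intro!: borel_measurable_times borel_measurable_prod H_prod_active norm_prod_le_1 norm_cluster_gf_le_1 mult_le_one simp: norm_mult\<close>)
    also have "\<dots> = (\<integral>w. (\<Prod>j<n. \<Prod>p\<in>active j w. g (mk p w)) * (\<Prod>p\<in>active n w. cluster_gf g (Suc k) (mk p w)) \<partial>M)"
      by (simp add: prod.distrib mult.assoc)
    also have "\<dots> = (\<integral>w. (\<Prod>p\<in>active 0 w. cluster_gf g (Suc n + k) (mk p w)) \<partial>M)"
      using Suc.IH[of "Suc k"] by simp
    finally show ?case .
  qed simp
  from this[of n 0] show ?thesis by simp
qed

end

section \<open>Claims\<close>

locale claim_kernel = hawkes_kernel Q h
  for Q :: "'a::polish_space measure" and h :: "real \<Rightarrow> 'a \<Rightarrow> real" +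
  fixes f :: "'a \<Rightarrow> real"
  assumes f [measurable]: "f \<in> borel_measurable borel" and f_nonneg: "\<And>a. 0 \<le> f a"
    and f2: "(\<integral>\<^sup>+a. ennreal ((f a)\<^sup>2) \<partial>Q) < \<infinity>"
begin

lemma mean_f_finite: "(\<integral>\<^sup>+a. ennreal (f a) \<partial>Q) < \<infinity>"
proof -
  have "(\<integral>\<^sup>+a. ennreal (f a) \<partial>Q) \<le> (\<integral>\<^sup>+a. ennreal 1 + ennreal ((f a)\<^sup>2) \<partial>Q)"
  proof (rule nn_integral_mono)
    fix a
    have "f a \<le> 1 + (f a)\<^sup>2"
      using sum_squares_ge_zero[of "f a - 1" 0] f_nonneg[of a]
      by (simp add: power2_eq_square algebra_simps)
    then have "ennreal (f a) \<le> ennreal (1 + (f a)\<^sup>2)" by (rule ennreal_leI)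
    also have "\<dots> = ennreal 1 + ennreal ((f a)\<^sup>2)" by (rule ennreal_plus) auto
    finally show "ennreal (f a) \<le> ennreal 1 + ennreal ((f a)\<^sup>2)" .
  qed
  also have "\<dots> = 1 + (\<integral>\<^sup>+a. ennreal ((f a)\<^sup>2) \<partial>Q)"
    by (subst nn_integral_add) (auto simp: Q.emeasure_space_1[simplified])
  also have "\<dots> < \<infinity>" using f2 by simp
  finally show ?thesis .
qed

definition claim_gf :: "real \<Rightarrow> nat \<Rightarrow> 'a \<Rightarrow> complex" where
  "claim_gf \<theta> = cluster_gf (\<lambda>a. iexp (\<theta> * f a))"

lemma measurable_claim_gf [measurable]: "claim_gf \<theta> n \<in> borel_measurable borel"
  unfolding claim_gf_def by (rule measurable_cluster_gf) measurable

lemma norm_claim_gf_le_1: "norm (claim_gf \<theta> n a) \<le> 1"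
  unfolding claim_gf_def by (rule norm_cluster_gf_le_1) auto

end

locale claim_cascades = claim_kernel Q h f + active_cascades Q h M \<G> W A m
  for Q :: "'a::polish_space measure" and h :: "real \<Rightarrow> 'a \<Rightarrow> real" and f :: "'a \<Rightarrow> real"
    and M :: "'w measure" and \<G> :: "'w measure" and W :: "'i::countable \<Rightarrow> 'w \<Rightarrow> 'a cascade_tree"
    and A :: "'w \<Rightarrow> 'i set" and m :: ennreal
begin

definition claims :: "'w \<Rightarrow> ennreal" where
  "claims w = (\<Sum>n. gen_sum n w (\<lambda>p. indicator (A w) (fst p) * ennreal (f (mk p w))))"

lemma measurable_claims [measurable]: "claims \<in> borel_measurable M"
  unfolding claims_def[abs_def] by measurable

lemma mean_claims:
  "(\<integral>\<^sup>+w. claims w \<partial>M) < \<infinity>"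
proof -
  obtain r where r: "(\<integral>\<^sup>+a. kappa h a \<partial>Q) = ennreal r" "0 \<le> r"
    using mean_kappa by (cases "\<integral>\<^sup>+a. kappa h a \<partial>Q") auto
  then have "r < 1" using mean_kappa by (simp add: ennreal_less_one_iff)
  have ma: "(\<integral>\<^sup>+w. gen_sum n w (\<lambda>p. indicator (A w) (fst p) * ennreal (f (mk p w))) \<partial>M)
      = m * ennreal r ^ n * (\<integral>\<^sup>+a. ennreal (f a) \<partial>Q)" for n
    using mean_active[of "\<lambda>a. ennreal (f a)" n] by (simp add: r)
  have "(\<integral>\<^sup>+w. claims w \<partial>M)
      = (\<Sum>n. m * ennreal r ^ n * (\<integral>\<^sup>+a. ennreal (f a) \<partial>Q))"
    unfolding claims_def by (subst nn_integral_suminf) (simp_all add: ma)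
  also have "\<dots> = m * (\<integral>\<^sup>+a. ennreal (f a) \<partial>Q) * (\<Sum>n. ennreal (r ^ n))"
    using r by (simp add: ennreal_power mult_ac)
  also have "(\<Sum>n. ennreal (r ^ n)) = ennreal (1 / (1 - r))"
    using r \<open>r < 1\<close> by (intro suminf_ennreal_eq geometric_sums) auto
  finally show ?thesis
    using m mean_f_finite by (simp add: ennreal_mult_less_top)
qed

lemma AE_claims_finite: "AE w in M. claims w < \<infinity>"
  using nn_integral_noteq_infinite[of claims M] mean_claims by (auto simp: less_top)

lemma claims_LIMSEQ:
  assumes fin: "\<And>n. finite (active n w)" and "claims w < \<infinity>"
  shows "(\<lambda>n. \<Sum>j<Suc n. \<Sum>p\<in>active j w. f (mk p w)) \<longlonglongrightarrow> enn2real (claims w)"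
proof -
  define c where "c j = (\<Sum>p\<in>active j w. f (mk p w))" for j
  have c_nonneg: "0 \<le> c j" for j
    unfolding c_def using f_nonneg by (intro sum_nonneg)
  have "gen_sum j w (\<lambda>p. indicator (A w) (fst p) * ennreal (f (mk p w))) = ennreal (c j)" for j
  proof -
    have "gen_sum j w (\<lambda>p. indicator (A w) (fst p) * ennreal (f (mk p w)))
      = (\<integral>\<^sup>+p. ennreal (f (mk p w)) \<partial>count_space (active j w))"
      unfolding gen_sum_active by (rule nn_integral_count_space_indicator[symmetric]) simp
    also have "\<dots> = ennreal (c j)"
      using fin f_nonneg by (simp add: nn_integral_count_space_finite c_def)
    finally show ?thesis .
  qed
  then have claims_eq: "claims w = (\<Sum>j. ennreal (c j))"
    by (simp only: claims_def)
  have sm: "summable c"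
  proof (rule summable_suminf_not_top[OF c_nonneg])
    show "(\<Sum>j. ennreal (c j)) \<noteq> \<top>"
      unfolding claims_eq[symmetric] using assms(2) by simp
  qed
  have "claims w = ennreal (suminf c)"
    unfolding claims_eq by (rule suminf_ennreal2[OF c_nonneg sm])
  then have "enn2real (claims w) = suminf c"
    using suminf_nonneg[OF sm c_nonneg] by simp
  then have "c sums enn2real (claims w)"
    using sm by (simp add: sums_iff)
  then have "(\<lambda>n. \<Sum>j<Suc n. c j) \<longlonglongrightarrow> enn2real (claims w)"
    unfolding sums_def by (rule LIMSEQ_Suc)
  then show ?thesis unfolding c_def .
qed

text \<open>
  The claims of the first \<open>n\<close> generations increase to an almost surely finite total, because the mean
  sizes of the generations decay geometrically.
\<close>
theorem char_claims_LIMSEQ: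
  "(\<lambda>n. \<integral>w. (\<Prod>p\<in>active 0 w. claim_gf \<theta> n (mk p w)) \<partial>M)
    \<longlonglongrightarrow> (\<integral>w. iexp (\<theta> * enn2real (claims w)) \<partial>M)"
proof -
  have "(\<lambda>n. \<integral>w. (\<Prod>j<Suc n. \<Prod>p\<in>active j w. iexp (\<theta> * f (mk p w))) \<partial>M)
    \<longlonglongrightarrow> (\<integral>w. iexp (\<theta> * enn2real (claims w)) \<partial>M)"
  proof (rule integral_dominated_convergence[where w="\<lambda>_. 1"])
    show "(\<lambda>w. iexp (\<theta> * enn2real (claims w))) \<in> borel_measurable M" by measurable
    show "(\<lambda>w. \<Prod>j<Suc n. \<Prod>p\<in>active j w. iexp (\<theta> * f (mk p w))) \<in> borel_measurable M" for n
      by (intro borel_measurable_prod borel_measurable_prod_random_set) measurable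
    show "AE w in M. norm (\<Prod>j<Suc n. \<Prod>p\<in>active j w. iexp (\<theta> * f (mk p w))) \<le> 1" for n
      by (intro AE_I2 norm_prod_le_1) simp
    show "AE w in M. (\<lambda>n. \<Prod>j<Suc n. \<Prod>p\<in>active j w. iexp (\<theta> * f (mk p w)))
        \<longlonglongrightarrow> iexp (\<theta> * enn2real (claims w))"
      using AE_finite_active AE_claims_finite
    proof eventually_elim
      case (elim w)
      have "(\<Prod>j<Suc n. \<Prod>p\<in>active j w. iexp (\<theta> * f (mk p w)))
        = iexp (\<theta> * (\<Sum>j<Suc n. \<Sum>p\<in>active j w. f (mk p w)))" for n
        using elim(1) by (simp add: exp_sum[symmetric] sum_distrib_left del: prod.lessThan_Suc sum.lessThan_Suc)
      moreover have "(\<lambda>n. iexp (\<theta> * (\<Sum>j<Suc n. \<Sum>p\<in>active j w. f (mk p w)))) \<longlonglongrightarrow> iexp (\<theta> * enn2real (claims w))"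
        using elim by (intro tendsto_intros claims_LIMSEQ) auto
      ultimately show ?case by simp
    qed
  qed auto
  then show ?thesis
    unfolding claim_gf_def by (subst (asm) generating_functional) auto
qed

end

text \<open>
  For a divergent sum both sides are \<open>0\<close> by convention.
\<close>
lemma infsum_eq_enn2real_nn_integral:
  fixes f :: "'b \<Rightarrow> real"
  assumes "\<And>x. x \<in> B \<Longrightarrow> 0 \<le> f x"
  shows "(\<Sum>\<^sub>\<infinity>x\<in>B. f x) = enn2real (\<integral>\<^sup>+x. ennreal (f x) \<partial>count_space B)"
proof (cases "integrable (count_space B) f")
  case True
  then have "(\<Sum>\<^sub>\<infinity>x\<in>B. f x) = infsetsum f B"
    by (intro infsetsum_infsum[symmetric]) (simp add: abs_summable_on_def)
  also have "\<dots> = enn2real (\<integral>\<^sup>+x. ennreal (f x) \<partial>count_space B)"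
    unfolding infsetsum_def using assms by (intro integral_eq_nn_integral) auto
  finally show ?thesis .
next
  case False
  have "\<not> f summable_on B"
    using False abs_summable_equivalent[of f B] summable_on_iff_abs_summable_on_real[of f B]
    by (simp add: abs_summable_on_def)
  moreover have "(\<integral>\<^sup>+x. ennreal (f x) \<partial>count_space B) = \<infinity>"
  proof (rule ccontr)
    assume "(\<integral>\<^sup>+x. ennreal (f x) \<partial>count_space B) \<noteq> \<infinity>"
    then have "integrable (count_space B) f"
      using assms by (intro integrableI_nonneg) (auto simp: less_top)
    with False show False ..
  qed
  ultimately show ?thesis by (simp add: infsum_not_exists)
qed

context claim_kernel begin

text \<open>
  What is used of \<open>D\<close>: it is the total of one cascade whose ancestor's mark has law \<open>Q\<close>, so its
  characteristic function is the limit of the integrals of \<open>claim_gf\<close>; the ancestor's own claim is a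
  lower bound.
\<close>
lemma single_cluster:
  fixes D :: "'v \<Rightarrow> real"
  assumes N: "prob_space N" and D: "cluster_total N Q h f D"
  shows "D \<in> borel_measurable N"
    and "w \<in> space N \<Longrightarrow> 0 \<le> D w"
    and "(\<integral>\<^sup>+w. ennreal (D w) \<partial>N) < \<infinity>"
    and "(\<integral>\<^sup>+a. ennreal ((f a)\<^sup>2) \<partial>Q) \<le> (\<integral>\<^sup>+w. ennreal ((D w)\<^sup>2) \<partial>N)"
    and "(\<lambda>n. \<integral>a. claim_gf \<theta> n a \<partial>Q) \<longlonglongrightarrow> (\<integral>w. iexp (\<theta> * D w) \<partial>N)"
proof -
  interpret N: prob_space N by fact
  from D obtain W where root: "distr N borel (\<lambda>w. mark (W w) []) = Q"
    and W: "independent_cascades N Q h (sigma (space N) {}) {()} (\<lambda>_. W)"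
    and D_eq: "\<And>w. w \<in> space N \<Longrightarrow> D w = (\<Sum>\<^sub>\<infinity>u\<in>individuals (W w). f (mark (W w) u))"
    unfolding cluster_total_def by blast
  have root_meas: "(\<lambda>w. mark (W w) []) \<in> borel_measurable N"
    using W unfolding independent_cascades_def by auto
  have ae: "AE w in N. kappa h (mark (W w) []) < \<infinity>"
  proof -
    have "AE a in distr N borel (\<lambda>w. mark (W w) []). kappa h a < \<infinity>"
      unfolding root by (rule AE_kappa_finite)
    then show ?thesis
      using root_meas by (subst (asm) AE_distr_iff) auto
  qed
  interpret C: cascades Q h N "sigma (space N) {}" "\<lambda>_::unit. W"
  proof unfold_locales
    show "subalgebra N (sigma (space N) {})"
      by (auto simp: subalgebra_def space_measure_of_conv sets_measure_of_conv sigma_sets_empty_eq)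
    show "independent_cascades N Q h (sigma (space N) {}) UNIV (\<lambda>_::unit. W)"
      using W by (simp add: UNIV_unit)
  qed (rule ae)
  have gen_sum0: "C.gen_sum 0 w F = F ((), [])" for w F
  proof -
    have "C.gen_sum 0 w F = (\<integral>\<^sup>+p. F p * indicator {((), [])} p \<partial>count_space UNIV)"
      unfolding C.gen_sum_def
      by (intro nn_integral_cong) (auto simp: C.generation_def individuals_def split: split_indicator)
    also have "\<dots> = F ((), [])" by (subst nn_integral_indicator_singleton) auto
    finally show ?thesis .
  qed
  interpret C: claim_cascades Q h f N "sigma (space N) {}" "\<lambda>_::unit. W" "\<lambda>_. UNIV" 1
  proof unfold_locales
    fix \<psi> :: "'a \<Rightarrow> ennreal" assume [measurable]: "\<psi> \<in> borel_measurable borel"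
    have "(\<integral>\<^sup>+w. \<psi> (mark (W w) []) \<partial>N) = (\<integral>\<^sup>+a. \<psi> a \<partial>distr N borel (\<lambda>w. mark (W w) []))"
      by (rule nn_integral_distr[symmetric]) (use root_meas in auto)
    then show "(\<integral>\<^sup>+w. C.gen_sum 0 w (\<lambda>p. indicator UNIV (fst p) * \<psi> (C.mk p w)) \<partial>N) = 1 * (\<integral>\<^sup>+a. \<psi> a \<partial>Q)"
      by (simp add: gen_sum0 C.mk_def root)
  qed auto
  have D_claims: "D w = enn2real (C.claims w)" if "w \<in> space N" for w
  proof -
    have "C.claims w = (\<integral>\<^sup>+p\<in>{p :: unit \<times> nat list. snd p \<in> individuals (W w)}. ennreal (f (mark (W w) (snd p))) \<partial>count_space UNIV)"
      unfolding C.claims_def C.suminf_gen_sum C.mk_def by simp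
    also have "\<dots> = (\<integral>\<^sup>+u\<in>individuals (W w). ennreal (f (mark (W w) u)) \<partial>count_space UNIV)"
      by (rule nn_integral_count_compose_bij[where g="snd :: unit \<times> nat list \<Rightarrow> nat list"])
        (auto simp: bij_betw_def inj_on_def image_iff)
    finally show ?thesis
      unfolding D_eq[OF that] using f_nonneg
      by (subst infsum_eq_enn2real_nn_integral) (auto simp: nn_integral_count_space_indicator)
  qed
  show D_meas: "D \<in> borel_measurable N"
    by (subst measurable_cong[OF D_claims]) measurable
  show "0 \<le> D w" if "w \<in> space N" for w
    using D_claims[OF that] by simp
  have D_ae: "AE w in N. ennreal (D w) = C.claims w"
    using C.AE_claims_finite AE_space by eventually_elim (simp add: D_claims)
  show "(\<integral>\<^sup>+w. ennreal (D w) \<partial>N) < \<infinity>"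
    using C.mean_claims by (simp add: nn_integral_cong_AE[OF D_ae])
  show "(\<integral>\<^sup>+a. ennreal ((f a)\<^sup>2) \<partial>Q) \<le> (\<integral>\<^sup>+w. ennreal ((D w)\<^sup>2) \<partial>N)"
  proof -
    have "(\<integral>\<^sup>+a. ennreal ((f a)\<^sup>2) \<partial>Q) = (\<integral>\<^sup>+a. ennreal ((f a)\<^sup>2) \<partial>distr N borel (\<lambda>w. mark (W w) []))"
      unfolding root ..
    also have "\<dots> = (\<integral>\<^sup>+w. ennreal ((f (mark (W w) []))\<^sup>2) \<partial>N)"
      by (rule nn_integral_distr) (use root_meas in auto)
    also have "\<dots> \<le> (\<integral>\<^sup>+w. ennreal ((D w)\<^sup>2) \<partial>N)"
    proof (rule nn_integral_mono_AE)
      show "AE w in N. ennreal ((f (mark (W w) []))\<^sup>2) \<le> ennreal ((D w)\<^sup>2)"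
        using D_ae AE_space
      proof eventually_elim
        case (elim w)
        have "ennreal (f (mark (W w) [])) = C.gen_sum 0 w (\<lambda>p. indicator UNIV (fst p) * ennreal (f (C.mk p w)))"
          by (simp add: gen_sum0 C.mk_def)
        also have "\<dots> = (\<Sum>n\<in>{0}. C.gen_sum n w (\<lambda>p. indicator UNIV (fst p) * ennreal (f (C.mk p w))))" by simp
        also have "\<dots> \<le> C.claims w"
          unfolding C.claims_def by (rule sum_le_suminf) auto
        also have "\<dots> = ennreal (D w)" using elim by simp
        finally have "f (mark (W w) []) \<le> D w"
          using D_claims[OF elim(2)] by simp
        then show ?case using f_nonneg by (intro ennreal_leI power_mono)
      qed
    qed
    finally show ?thesis .
  qed
  have "(\<integral>w. (\<Prod>p\<in>C.active 0 w. claim_gf \<theta> n (C.mk p w)) \<partial>N) = (\<integral>a. claim_gf \<theta> n a \<partial>Q)" for n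
  proof -
    have "C.active 0 w = {((), [])}" for w
      by (auto simp: C.active_def C.generation_def individuals_def)
    then have "(\<integral>w. (\<Prod>p\<in>C.active 0 w. claim_gf \<theta> n (C.mk p w)) \<partial>N) = (\<integral>w. claim_gf \<theta> n (mark (W w) []) \<partial>N)"
      by (simp add: C.mk_def)
    also have "\<dots> = (\<integral>a. claim_gf \<theta> n a \<partial>distr N borel (\<lambda>w. mark (W w) []))"
      by (rule integral_distr[symmetric]) (use root_meas in auto)
    finally show ?thesis unfolding root .
  qed
  moreover have "(\<integral>w. iexp (\<theta> * enn2real (C.claims w)) \<partial>N) = (\<integral>w. iexp (\<theta> * D w) \<partial>N)"
    by (intro Bochner_Integration.integral_cong) (auto simp: D_claims)
  ultimately show "(\<lambda>n. \<integral>a. claim_gf \<theta> n a \<partial>Q) \<longlonglongrightarrow> (\<integral>w. iexp (\<theta> * D w) \<partial>N)"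
    using C.char_claims_LIMSEQ[of \<theta>] by simp
qed

end

section \<open>The second moment of a cluster total\<close>

text \<open>
  The real part enters linearly and the imaginary part quadratically. This is what makes \<open>1 - Re \<phi>(\<theta>)\<close> of
  order \<open>\<theta>\<^sup>2\<close> below.
\<close>
lemma one_minus_Re_exp_le:
  assumes "Re w \<le> 0"
  shows "1 - Re (exp w) \<le> - Re w + (Im w)\<^sup>2 / 2"
proof -
  have c: "1 - cos y \<le> y\<^sup>2 / 2" for y :: real
  proof -
    have "1 - cos y = 2 * (sin (y / 2))\<^sup>2" using cos_double_sin[of "y / 2"] by simp
    also have "(sin (y / 2))\<^sup>2 \<le> (y / 2)\<^sup>2" unfolding abs_le_square_iff[symmetric] by (rule abs_sin_x_le_abs_x)
    finally show ?thesis by (simp add: power2_eq_square)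
  qed
  have "1 - Re (exp w) = (1 - exp (Re w)) + exp (Re w) * (1 - cos (Im w))"
    by (simp add: Re_exp algebra_simps)
  also have "1 - exp (Re w) \<le> - Re w" using exp_ge_add_one_self[of "Re w"] by linarith
  also have "exp (Re w) * (1 - cos (Im w)) \<le> 1 * (1 - cos (Im w))"
    using assms by (intro mult_right_mono) auto
  also have "1 * (1 - cos (Im w)) \<le> (Im w)\<^sup>2 / 2" using c by simp
  finally show ?thesis by simp
qed

context claim_kernel begin

text \<open>
  Passage to the limit in the recursion that defines \<open>claim_gf\<close>.
\<close>
lemma mean_iexp_fixpoint:
  assumes lim: "(\<lambda>n. \<integral>a. claim_gf \<theta> n a \<partial>Q) \<longlonglongrightarrow> \<phi>"
  shows "\<phi> = (\<integral>a. iexp (\<theta> * f a) * exp (of_real (enn2real (kappa h a)) * (\<phi> - 1)) \<partial>Q)"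
proof -
  have le: "norm (\<integral>a. claim_gf \<theta> n a \<partial>Q) \<le> 1" for n
    by (intro Q.norm_expectation_le_1 norm_claim_gf_le_1) measurable
  have "(\<lambda>n. \<integral>a. claim_gf \<theta> (Suc n) a \<partial>Q)
    \<longlonglongrightarrow> (\<integral>a. iexp (\<theta> * f a) * exp (of_real (enn2real (kappa h a)) * (\<phi> - 1)) \<partial>Q)"
  proof (rule integral_dominated_convergence[where w="\<lambda>_. 1"])
    show "(\<lambda>a. iexp (\<theta> * f a) * exp (of_real (enn2real (kappa h a)) * (\<phi> - 1))) \<in> borel_measurable Q"
      by measurable
    show "AE a in Q. (\<lambda>n. claim_gf \<theta> (Suc n) a)
        \<longlonglongrightarrow> iexp (\<theta> * f a) * exp (of_real (enn2real (kappa h a)) * (\<phi> - 1))"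
      using lim unfolding claim_gf_def cluster_gf.simps by (intro AE_I2 tendsto_intros)
    show "AE a in Q. norm (claim_gf \<theta> (Suc n) a) \<le> 1" for n
      by (intro AE_I2 norm_claim_gf_le_1)
  qed auto
  then show ?thesis
    by (rule LIMSEQ_unique[OF LIMSEQ_Suc[OF lim]])
qed

text \<open>
  Write \<open>R = 1 - Re \<phi>(\<theta>)\<close>. The real part of the fixed point equation gives
  \<open>R \<le> E\<kappa> R + \<theta>\<^sup>2 E f\<^sup>2 + E \<kappa>\<^sup>2 (Im \<phi>(\<theta>))\<^sup>2\<close>, and \<open>\<bar>Im \<phi>(\<theta>)\<bar> \<le> \<bar>\<theta>\<bar> E D\<close>. As \<open>E\<kappa> < 1\<close>, it follows that
  \<open>R = E (1 - cos (\<theta> D))\<close> is at most a constant times \<open>\<theta>\<^sup>2\<close>. Fatou's lemma applied to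
  \<open>2 (1 - cos (\<theta> D)) / \<theta>\<^sup>2\<close>, which tends to \<open>D\<^sup>2\<close>, bounds \<open>E D\<^sup>2\<close>.
\<close>
lemma single_cluster_second_moment:
  fixes D :: "'v \<Rightarrow> real"
  assumes N: "prob_space N" and D: "cluster_total N Q h f D"
    and kappa2: "(\<integral>\<^sup>+a. (kappa h a)\<^sup>2 \<partial>Q) < \<infinity>"
  shows "(\<integral>\<^sup>+w. ennreal ((D w)\<^sup>2) \<partial>N) < \<infinity>"
proof -
  interpret N: prob_space N by fact
  note [measurable] = single_cluster(1)[OF N D]
  note D_nonneg = single_cluster(2)[OF N D]
  have int_D: "integrable N D"
    using single_cluster(3)[OF N D] D_nonneg by (intro integrableI_nonneg AE_I2) auto
  define \<phi> where "\<phi> \<theta> = (\<integral>w. iexp (\<theta> * D w) \<partial>N)" for \<theta>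
  define kr where "kr a = enn2real (kappa h a)" for a
  have [measurable]: "kr \<in> borel_measurable borel" unfolding kr_def by measurable
  have kr_ae: "AE a in Q. ennreal (kr a) = kappa h a"
    using AE_kappa_finite by eventually_elim (simp add: kr_def)
  have kr_nonneg: "0 \<le> kr a" for a by (simp add: kr_def)
  have int_kr: "integrable Q kr"
    using mean_kappa kr_nonneg nn_integral_cong_AE[OF kr_ae]
    by (intro integrableI_nonneg) (auto simp: less_top intro: order_less_trans)
  have int_kr2: "integrable Q (\<lambda>a. (kr a)\<^sup>2)"
  proof (intro integrableI_nonneg)
    have "(\<integral>\<^sup>+a. ennreal ((kr a)\<^sup>2) \<partial>Q) = (\<integral>\<^sup>+a. (kappa h a)\<^sup>2 \<partial>Q)"
      using kr_ae by (intro nn_integral_cong_AE) (auto simp: ennreal_power[symmetric] kr_nonneg)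
    then show "(\<integral>\<^sup>+a. ennreal ((kr a)\<^sup>2) \<partial>Q) < \<infinity>" using kappa2 by simp
  qed auto
  have int_f2: "integrable Q (\<lambda>a. (f a)\<^sup>2)"
    using f2 by (intro integrableI_nonneg) auto
  define k where "k = (\<integral>a. kr a \<partial>Q)"
  have k1: "k < 1"
  proof -
    have "ennreal k = (\<integral>\<^sup>+a. ennreal (kr a) \<partial>Q)"
      unfolding k_def using int_kr kr_nonneg by (intro nn_integral_eq_integral[symmetric]) auto
    also have "\<dots> < 1" using mean_kappa nn_integral_cong_AE[OF kr_ae] by simp
    finally show ?thesis using kr_nonneg by (simp add: ennreal_less_one_iff k_def)
  qed
  define C where "C = (\<integral>a. (f a)\<^sup>2 \<partial>Q) + (\<integral>a. (kr a)\<^sup>2 \<partial>Q) * (\<integral>w. D w \<partial>N)\<^sup>2"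
  have int_e: "integrable N (\<lambda>w. iexp (\<theta> * D w))" for \<theta>
    by (intro N.integrable_const_bound[where B=1]) auto
  have Re_phi: "Re (\<phi> \<theta>) = (\<integral>w. cos (\<theta> * D w) \<partial>N)" for \<theta>
    unfolding \<phi>_def integral_Re[OF int_e, symmetric] by (simp add: Re_exp)
  have Im_phi: "Im (\<phi> \<theta>) = (\<integral>w. sin (\<theta> * D w) \<partial>N)" for \<theta>
    unfolding \<phi>_def integral_Im[OF int_e, symmetric] by (simp add: Im_exp)
  have bound: "(1 - k) * (\<integral>w. 1 - cos (\<theta> * D w) \<partial>N) \<le> \<theta>\<^sup>2 * C" for \<theta>
  proof -
    have fix_eq: "\<phi> \<theta> = (\<integral>a. iexp (\<theta> * f a) * exp (of_real (kr a) * (\<phi> \<theta> - 1)) \<partial>Q)"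
      unfolding kr_def \<phi>_def by (rule mean_iexp_fixpoint[OF single_cluster(5)[OF N D]])
    have cos_int: "integrable N (\<lambda>w. cos (\<theta> * D w))"
      by (intro N.integrable_const_bound[where B=1]) auto
    have R: "1 - Re (\<phi> \<theta>) = (\<integral>w. 1 - cos (\<theta> * D w) \<partial>N)"
      unfolding Re_phi using cos_int by (simp add: N.prob_space)
    have R_nonneg: "0 \<le> 1 - Re (\<phi> \<theta>)"
      unfolding R by (intro integral_nonneg_AE) auto
    have Im_le: "(Im (\<phi> \<theta>))\<^sup>2 \<le> \<theta>\<^sup>2 * (\<integral>w. D w \<partial>N)\<^sup>2"
    proof -
      have "\<bar>Im (\<phi> \<theta>)\<bar> \<le> (\<integral>w. \<bar>sin (\<theta> * D w)\<bar> \<partial>N)"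
        unfolding Im_phi by (rule integral_abs_bound)
      also have "\<dots> \<le> (\<integral>w. \<bar>\<theta>\<bar> * D w \<partial>N)"
      proof (rule integral_mono)
        show "integrable N (\<lambda>w. \<bar>sin (\<theta> * D w)\<bar>)"
          by (intro N.integrable_const_bound[where B=1]) auto
        show "integrable N (\<lambda>w. \<bar>\<theta>\<bar> * D w)" using int_D by simp
        show "\<bar>sin (\<theta> * D w)\<bar> \<le> \<bar>\<theta>\<bar> * D w" if "w \<in> space N" for w
          using abs_sin_x_le_abs_x[of "\<theta> * D w"] D_nonneg[OF that] by (simp add: abs_mult)
      qed
      also have "\<dots> = \<bar>\<theta>\<bar> * (\<integral>w. D w \<partial>N)" by simp
      finally have "\<bar>Im (\<phi> \<theta>)\<bar> \<le> \<bar>\<bar>\<theta>\<bar> * (\<integral>w. D w \<partial>N)\<bar>" by linarith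
      then show ?thesis by (simp add: abs_le_square_iff power_mult_distrib)
    qed
    let ?w = "\<lambda>a. iexp (\<theta> * f a) * exp (of_real (kr a) * (\<phi> \<theta> - 1))"
    have w_le: "norm (?w a) \<le> 1" for a
      using R_nonneg kr_nonneg[of a] by (auto simp: norm_mult mult_nonneg_nonpos)
    have int_w: "integrable Q ?w"
      using w_le by (intro Q.integrable_const_bound[where B=1]) auto
    have "1 - Re (\<phi> \<theta>) = (\<integral>a. 1 - Re (?w a) \<partial>Q)"
    proof -
      have "Re (\<phi> \<theta>) = (\<integral>a. Re (?w a) \<partial>Q)"
        by (subst fix_eq) (rule integral_Re[OF int_w, symmetric])
      then show ?thesis using integrable_Re[OF int_w] by (simp add: Q.prob_space[simplified])
    qed
    also have "\<dots> \<le> (\<integral>a. kr a * (1 - Re (\<phi> \<theta>)) + (\<theta>\<^sup>2 * (f a)\<^sup>2 + (kr a)\<^sup>2 * (Im (\<phi> \<theta>))\<^sup>2) \<partial>Q)"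
    proof (rule integral_mono)
      show "integrable Q (\<lambda>a. 1 - Re (?w a))" using integrable_Re[OF int_w] by simp
      show "integrable Q (\<lambda>a. kr a * (1 - Re (\<phi> \<theta>)) + (\<theta>\<^sup>2 * (f a)\<^sup>2 + (kr a)\<^sup>2 * (Im (\<phi> \<theta>))\<^sup>2))"
        using int_kr int_kr2 int_f2 by simp
      fix a
      define z where "z = \<i> * of_real (\<theta> * f a) + of_real (kr a) * (\<phi> \<theta> - 1)"
      have w_eq: "?w a = exp z" by (simp add: exp_add z_def)
      moreover have "1 - Re (exp z) \<le> - Re z + (Im z)\<^sup>2 / 2"
        using R_nonneg kr_nonneg[of a] by (intro one_minus_Re_exp_le) (simp add: mult_nonneg_nonpos z_def)
      moreover have "(Im z)\<^sup>2 / 2 \<le> \<theta>\<^sup>2 * (f a)\<^sup>2 + (kr a)\<^sup>2 * (Im (\<phi> \<theta>))\<^sup>2"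
      proof -
        have "(x + y)\<^sup>2 / 2 \<le> x\<^sup>2 + y\<^sup>2" for x y :: real
          using sum_squares_ge_zero[of "x - y" 0] by (simp add: power2_eq_square algebra_simps)
        from this[of "\<theta> * f a" "kr a * Im (\<phi> \<theta>)"] show ?thesis by (simp add: power_mult_distrib z_def)
      qed
      moreover have "- Re z = kr a * (1 - Re (\<phi> \<theta>))" by (simp add: algebra_simps z_def)
      ultimately show "1 - Re (?w a) \<le> kr a * (1 - Re (\<phi> \<theta>)) + (\<theta>\<^sup>2 * (f a)\<^sup>2 + (kr a)\<^sup>2 * (Im (\<phi> \<theta>))\<^sup>2)"
        unfolding w_eq by linarith
    qed
    also have "\<dots> = k * (1 - Re (\<phi> \<theta>)) + (\<theta>\<^sup>2 * (\<integral>a. (f a)\<^sup>2 \<partial>Q) + (\<integral>a. (kr a)\<^sup>2 \<partial>Q) * (Im (\<phi> \<theta>))\<^sup>2)"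
      using int_kr int_kr2 int_f2 by (simp add: k_def)
    also have "\<dots> \<le> k * (1 - Re (\<phi> \<theta>)) + \<theta>\<^sup>2 * C"
    proof -
      have "(\<integral>a. (kr a)\<^sup>2 \<partial>Q) * (Im (\<phi> \<theta>))\<^sup>2 \<le> (\<integral>a. (kr a)\<^sup>2 \<partial>Q) * (\<theta>\<^sup>2 * (\<integral>w. D w \<partial>N)\<^sup>2)"
        by (intro mult_left_mono Im_le integral_nonneg_AE) auto
      then show ?thesis by (simp add: C_def algebra_simps)
    qed
    finally have "(1 - k) * (1 - Re (\<phi> \<theta>)) \<le> \<theta>\<^sup>2 * C" by (simp add: algebra_simps)
    then show ?thesis unfolding R .
  qed
  \<comment> \<open>\<open>2 (1 - cos (\<theta> D)) / \<theta>\<^sup>2\<close> at \<open>\<theta> = 1 / (n + 1)\<close>.\<close>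
  define u where "u n w = 2 * (1 - cos (D w / real (Suc n))) * (real (Suc n))\<^sup>2" for n w
  have u_nonneg: "0 \<le> u n w" for n w by (simp add: u_def)
  have u_lim: "(\<lambda>n. u n w) \<longlonglongrightarrow> (D w)\<^sup>2" for w
  proof (cases "D w = 0")
    case False
    have lim0: "(\<lambda>n. D w / 2 / real (Suc n)) \<longlonglongrightarrow> 0"
      by (intro real_tendsto_divide_at_top[OF tendsto_const] filterlim_compose[OF filterlim_real_sequentially filterlim_Suc])
    have eq: "u n w = (D w)\<^sup>2 * (sinc (D w / 2 / real (Suc n)))\<^sup>2" for n
    proof -
      define s where "s = real (Suc n)"
      define y where "y = D w / 2 / s"
      have "0 < s" by (simp add: s_def)
      then have D_eq: "D w = 2 * y * s" and "y \<noteq> 0" and "D w / s = 2 * y"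
        using False by (auto simp: y_def)
      then have "1 - cos (D w / s) = 2 * (sin y)\<^sup>2"
        using cos_double_sin[of y] by simp
      then have "u n w = (2 * y * s)\<^sup>2 * (sinc y)\<^sup>2"
        using \<open>y \<noteq> 0\<close> unfolding u_def s_def[symmetric]
        by (simp add: power_divide power_mult_distrib)
      then have "u n w = (D w)\<^sup>2 * (sinc y)\<^sup>2" by (simp only: D_eq)
      then show ?thesis unfolding y_def s_def .
    qed
    have "(\<lambda>n. (D w)\<^sup>2 * (sinc (D w / 2 / real (Suc n)))\<^sup>2) \<longlonglongrightarrow> (D w)\<^sup>2 * (sinc 0)\<^sup>2"
      by (intro tendsto_intros isCont_tendsto_compose[OF isCont_sinc lim0])
    then show ?thesis unfolding eq by simp
  qed (simp add: u_def)
  have "(\<integral>\<^sup>+w. ennreal ((D w)\<^sup>2) \<partial>N) = (\<integral>\<^sup>+w. liminf (\<lambda>n. ennreal (u n w)) \<partial>N)"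
    by (intro nn_integral_cong lim_imp_Liminf[symmetric] tendsto_ennrealI u_lim) simp
  also have "\<dots> \<le> liminf (\<lambda>n. \<integral>\<^sup>+w. ennreal (u n w) \<partial>N)"
    by (rule nn_integral_liminf) (simp add: u_def)
  also have "\<dots> \<le> liminf (\<lambda>n::nat. ennreal (2 * C / (1 - k)))"
  proof (intro Liminf_mono always_eventually allI)
    fix n
    have int_u: "integrable N (u n)"
      unfolding u_def by (intro integrable_mult_left integrable_mult_right N.integrable_const_bound[where B=2]) auto
    have "(\<integral>w. u n w \<partial>N) = 2 * (real (Suc n))\<^sup>2 * (\<integral>w. 1 - cos (1 / real (Suc n) * D w) \<partial>N)"
    proof -
      have "u n = (\<lambda>w. 2 * (real (Suc n))\<^sup>2 * (1 - cos (1 / real (Suc n) * D w)))"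
        by (simp add: u_def fun_eq_iff algebra_simps del: of_nat_Suc)
      then show ?thesis by (simp only: integral_mult_right_zero)
    qed
    also have "\<dots> \<le> 2 * (real (Suc n))\<^sup>2 * ((1 / real (Suc n))\<^sup>2 * C / (1 - k))"
      using bound[of "1 / real (Suc n)"] k1
      by (intro mult_left_mono) (simp_all add: pos_le_divide_eq mult.commute del: of_nat_Suc)
    also have "\<dots> = 2 * C / (1 - k)"
      by (simp add: power_divide del: of_nat_Suc)
    finally have "(\<integral>w. u n w \<partial>N) \<le> 2 * C / (1 - k)" .
    then show "(\<integral>\<^sup>+w. ennreal (u n w) \<partial>N) \<le> ennreal (2 * C / (1 - k))"
      using int_u u_nonneg by (subst nn_integral_eq_integral) (auto intro: ennreal_leI)
  qed
  also have "\<dots> < \<infinity>" by (simp add: Liminf_const)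
  finally show ?thesis .
qed

end

section \<open>Immigrants\<close>

text \<open>
  The arrival set \<open>J\<close> of the immigrants is the half-line or the whole line in the two versions of the
  process. What matters is that it contains \<open>[0, \<infinity>)\<close>.
\<close>
locale hawkes = claim_kernel Q h f + prob_space M
  for Q :: "'a::polish_space measure" and h :: "real \<Rightarrow> 'a \<Rightarrow> real" and f :: "'a \<Rightarrow> real"
    and M :: "'w measure" +
  fixes \<nu> :: real and J :: "real set" and \<Gamma> :: "nat \<Rightarrow> 'w \<Rightarrow> real" and W :: "nat \<Rightarrow> 'w \<Rightarrow> 'a cascade_tree"
  assumes \<nu>: "0 < \<nu>"
    and J [measurable]: "J \<in> sets borel" and J_sup: "{0..} \<subseteq> J"
    and \<Gamma> [measurable]: "\<And>i. \<Gamma> i \<in> borel_measurable M"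
    and immigrants: "poisson_process M (density lborel (\<lambda>s. ennreal \<nu> * indicator J s) \<Otimes>\<^sub>M Q)
          (\<lambda>w. distr (count_space UNIV) borel (\<lambda>i. (\<Gamma> i w, mark (W i w) [])))"
    and clusters: "independent_cascades M Q h
          (vimage_algebra (space M) (\<lambda>w i. \<Gamma> i w) (PiM UNIV (\<lambda>_. borel))) UNIV W"
begin

abbreviation "\<G> \<equiv> vimage_algebra (space M) (\<lambda>w i. \<Gamma> i w) (PiM (UNIV :: nat set) (\<lambda>_. borel))"

definition \<Lambda> :: "(real \<times> 'a) measure" where
  "\<Lambda> = density lborel (\<lambda>s. ennreal \<nu> * indicator J s) \<Otimes>\<^sub>M Q"

lemma sets_\<Lambda>: "sets \<Lambda> = sets borel"
proof -
  have "sets \<Lambda> = sets (borel \<Otimes>\<^sub>M Q)"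
    unfolding \<Lambda>_def by (intro sets_pair_measure_cong) simp_all
  then show ?thesis by (simp only: sets_borel_pair_Q)
qed

lemma measurable_root [measurable]: "(\<lambda>w. mark (W i w) []) \<in> borel_measurable M"
  using clusters unfolding independent_cascades_def by auto

definition arrivals :: "(real \<times> 'a) set \<Rightarrow> 'w \<Rightarrow> nat set" where
  "arrivals B w = {i. (\<Gamma> i w, mark (W i w) []) \<in> B}"

lemma immigrant_count:
  "B \<in> sets borel \<Longrightarrow> emeasure (distr (count_space UNIV) borel (\<lambda>i. (\<Gamma> i w, mark (W i w) []))) B
    = tally (arrivals B w)"
  unfolding arrivals_def by (subst emeasure_point_measure) auto

lemma measurable_arrivals [measurable]:
  assumes [measurable]: "B \<in> sets borel"
  shows "Measurable.pred M (\<lambda>w. i \<in> arrivals B w)"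
  unfolding arrivals_def mem_Collect_eq by measurable

lemma measurable_tally_arrivals [measurable]:
  assumes [measurable]: "B \<in> sets borel"
  shows "(\<lambda>w. tally (arrivals B w)) \<in> borel_measurable M"
  by measurable

lemma arrivals_law:
  assumes "B \<in> sets borel"
  shows "prob {w \<in> space M. tally (arrivals B w) = of_nat k} = poisson_weight (emeasure \<Lambda> B) k"
  using immigrants assms sets_\<Lambda> unfolding poisson_process_def \<Lambda>_def[symmetric]
  by (simp add: immigrant_count)

lemma arrivals_indep:
  fixes n :: nat
  assumes "\<And>j. j < n \<Longrightarrow> B j \<in> sets borel" and "disjoint_family_on B {..<n}"
  shows "indep_vars (\<lambda>_. borel) (\<lambda>j w. tally (arrivals (B j) w)) {..<n}"
proof -
  have "indep_vars (\<lambda>_. borel) (\<lambda>j w. emeasure (distr (count_space UNIV) borel (\<lambda>i. (\<Gamma> i w, mark (W i w) []))) (B j)) {..<n}"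
    using immigrants[unfolded poisson_process_def \<Lambda>_def[symmetric], THEN conjunct2, THEN conjunct2,
        THEN spec[where x=n], THEN spec[where x=B], THEN mp] assms by (simp add: sets_\<Lambda>)
  then show ?thesis
    by (rule indep_vars_cong[THEN iffD1, rotated -1]) (use assms(1) in \<open>auto simp: immigrant_count\<close>)
qed

lemma arrivals_mean:
  assumes B [measurable]: "B \<in> sets borel"
  shows "(\<integral>\<^sup>+w. tally (arrivals B w) \<partial>M) = emeasure \<Lambda> B"
proof (cases "emeasure \<Lambda> B = \<infinity>")
  case False
  have "(\<integral>\<^sup>+w\<in>space M. tally (arrivals B w) \<partial>M) = (\<integral>\<^sup>+w\<in>space M. emeasure \<Lambda> B \<partial>M)"
  proof (rule nn_integral_poisson_count)
    show "finite_measure M" by unfold_locales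
    show "tally (arrivals B w) = \<infinity> \<or> tally (arrivals B w) \<in> range of_nat" for w
      by (rule tally_cases)
    show "emeasure M {w \<in> space M. tally (arrivals B w) = of_nat k}
      = (\<integral>\<^sup>+w\<in>space M. ennreal (poisson_weight (emeasure \<Lambda> B) k) \<partial>M)" for k
      unfolding emeasure_eq_measure arrivals_law[OF B] by (simp add: emeasure_space_1)
  qed (use False in \<open>auto simp: less_top\<close>)
  then show ?thesis by (simp add: emeasure_space_1)
next
  case True
  have "AE w in M. tally (arrivals B w) \<noteq> of_nat k" for k
  proof (rule AE_I[where N="{w \<in> space M. tally (arrivals B w) = of_nat k}"])
    show "emeasure M {w \<in> space M. tally (arrivals B w) = of_nat k} = 0"
      unfolding emeasure_eq_measure arrivals_law[OF B] by (simp add: True poisson_weight_def)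
  qed auto
  then have "AE w in M. \<forall>k::nat. tally (arrivals B w) \<noteq> of_nat k"
    unfolding AE_all_countable by simp
  then have "AE w in M. tally (arrivals B w) = \<infinity>"
  proof eventually_elim
    case (elim w)
    then show ?case
      by (cases "finite (arrivals B w)") (auto simp: emeasure_count_space_finite emeasure_count_space_infinite)
  qed
  then have "(\<integral>\<^sup>+w. tally (arrivals B w) \<partial>M) = (\<integral>\<^sup>+w. \<infinity> \<partial>M)"
    by (rule nn_integral_cong_AE)
  then show ?thesis using True by (simp add: emeasure_space_1)
qed

text \<open>
  The law of the counts determines the mean measure on every Borel set, hence the means of all sums over
  immigrants.
\<close>
lemma immigrant_mean:
  assumes G [measurable]: "G \<in> borel_measurable borel"
  shows "(\<integral>\<^sup>+w. (\<Sum>i. G (\<Gamma> i w, mark (W i w) [])) \<partial>M)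
    = (\<integral>\<^sup>+x. \<integral>\<^sup>+a. ennreal \<nu> * indicator J x * G (x, a) \<partial>Q \<partial>lborel)"
proof -
  let ?K = "count_space (UNIV :: nat set)"
  define t where "t x = (\<Gamma> (fst x) (snd x), mark (W (fst x) (snd x)) [])" for x :: "nat \<times> 'w"
  have t [measurable]: "t \<in> borel_measurable (?K \<Otimes>\<^sub>M M)"
    unfolding t_def by (intro measurable_pair_measure_countable1) auto
  have nn: "(\<integral>\<^sup>+x. F x \<partial>distr (?K \<Otimes>\<^sub>M M) borel t) = (\<integral>\<^sup>+w. (\<Sum>i. F (\<Gamma> i w, mark (W i w) [])) \<partial>M)"
    if F [measurable]: "F \<in> borel_measurable borel" for F
  proof -
    have "(\<integral>\<^sup>+x. F x \<partial>distr (?K \<Otimes>\<^sub>M M) borel t) = (\<integral>\<^sup>+x. F (t x) \<partial>(?K \<Otimes>\<^sub>M M))"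
      by (subst nn_integral_distr) auto
    also have "\<dots> = (\<integral>\<^sup>+w. (\<Sum>i. F (\<Gamma> i w, mark (W i w) [])) \<partial>M)"
      by (subst nn_integral_count_space_pair) (auto simp: t_def)
    finally show ?thesis .
  qed
  have eq: "distr (?K \<Otimes>\<^sub>M M) borel t = \<Lambda>"
  proof (rule measure_eqI)
    fix B assume "B \<in> sets (distr (?K \<Otimes>\<^sub>M M) borel t)"
    then have B [measurable]: "B \<in> sets borel" by simp
    have "emeasure (distr (?K \<Otimes>\<^sub>M M) borel t) B = (\<integral>\<^sup>+x. indicator B x \<partial>distr (?K \<Otimes>\<^sub>M M) borel t)"
      by simp
    also have "\<dots> = (\<integral>\<^sup>+w. tally (arrivals B w) \<partial>M)"
      unfolding nn[OF borel_measurable_indicator[OF B]] tally_eq_suminf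
      by (intro nn_integral_cong suminf_cong) (auto simp: arrivals_def split: split_indicator)
    also have "\<dots> = emeasure \<Lambda> B" by (rule arrivals_mean[OF B])
    finally show "emeasure (distr (?K \<Otimes>\<^sub>M M) borel t) B = emeasure \<Lambda> B" .
  qed (simp add: sets_\<Lambda>)
  have GQ: "G \<in> borel_measurable (lborel \<Otimes>\<^sub>M Q)"
  proof -
    have "G \<in> borel_measurable (borel \<Otimes>\<^sub>M borel)" unfolding borel_prod by (rule G)
    then show ?thesis by measurable
  qed
  have "(\<integral>\<^sup>+w. (\<Sum>i. G (\<Gamma> i w, mark (W i w) [])) \<partial>M) = (\<integral>\<^sup>+x. G x \<partial>\<Lambda>)"
    unfolding eq[symmetric] by (rule nn[OF G, symmetric])
  also have "\<dots> = (\<integral>\<^sup>+x. \<integral>\<^sup>+a. G (x, a) \<partial>Q \<partial>density lborel (\<lambda>s. ennreal \<nu> * indicator J s))"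
    unfolding \<Lambda>_def by (rule Q.nn_integral_fst[symmetric]) (use GQ in measurable)
  also have "\<dots> = (\<integral>\<^sup>+x. ennreal \<nu> * indicator J x * (\<integral>\<^sup>+a. G (x, a) \<partial>Q) \<partial>lborel)"
    by (subst nn_integral_density) (use GQ in measurable)
  also have "\<dots> = (\<integral>\<^sup>+x. \<integral>\<^sup>+a. ennreal \<nu> * indicator J x * G (x, a) \<partial>Q \<partial>lborel)"
    by (intro nn_integral_cong nn_integral_cmult[symmetric]) (use GQ in measurable)
  finally show ?thesis .
qed

lemma root_kappa_finite: "AE w in M. kappa h (mark (W i w) []) < \<infinity>"
proof -
  define G where "G x = (indicator {\<infinity>} (kappa h (snd x)) :: ennreal)" for x :: "real \<times> 'a"
  have "G \<in> borel_measurable (borel \<Otimes>\<^sub>M borel)" unfolding G_def by measurable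
  then have G [measurable]: "G \<in> borel_measurable borel" unfolding borel_prod .
  have "(\<integral>\<^sup>+a. indicator {\<infinity>} (kappa h a) \<partial>Q) = (\<integral>\<^sup>+a. 0 \<partial>Q)"
    using AE_kappa_finite by (intro nn_integral_cong_AE) (auto split: split_indicator)
  then have "(\<integral>\<^sup>+w. (\<Sum>i. G (\<Gamma> i w, mark (W i w) [])) \<partial>M) = 0"
    by (subst immigrant_mean[OF G]) (simp add: G_def nn_integral_cmult)
  then have "AE w in M. (\<Sum>i. G (\<Gamma> i w, mark (W i w) [])) = 0"
    by (subst (asm) nn_integral_0_iff_AE) auto
  then show ?thesis
  proof eventually_elim
    case (elim w)
    have "G (\<Gamma> i w, mark (W i w) []) \<le> (\<Sum>i. G (\<Gamma> i w, mark (W i w) []))"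
      using sum_le_suminf[of "\<lambda>i. G (\<Gamma> i w, mark (W i w) [])" "{i}"] by simp
    then show ?case using elim by (auto simp: G_def less_top split: split_indicator_asm)
  qed
qed

lemma subalgebra_\<G>: "subalgebra M \<G>"
proof -
  have "(\<lambda>w i. \<Gamma> i w) \<in> measurable M (PiM (UNIV :: nat set) (\<lambda>_. borel))"
    by (intro measurable_PiM_single') (auto simp: space_PiM)
  then show ?thesis
    by (auto simp: subalgebra_def sets_vimage_algebra2 space_PiM dest: measurable_sets)
qed

sublocale cascades Q h M \<G> W
  by unfold_locales (rule subalgebra_\<G> clusters root_kappa_finite)+

lemma \<G>_\<Gamma>: "\<Gamma> i \<in> borel_measurable \<G>"
proof -
  have "(\<lambda>w i. \<Gamma> i w) \<in> measurable \<G> (PiM (UNIV :: nat set) (\<lambda>_. borel))"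
    by (rule measurable_vimage_algebra1) (auto simp: space_PiM)
  from measurable_compose[OF this measurable_component_singleton[of i]] show ?thesis by simp
qed

lemma gen_sum_0: "gen_sum 0 w F = (\<Sum>i. F (i, []))"
proof -
  have "gen_sum 0 w F = (\<integral>\<^sup>+p\<in>range (\<lambda>i. (i, [])). F p \<partial>count_space UNIV)"
    unfolding gen_sum_def
    by (intro nn_integral_cong) (auto simp: generation_def individuals_def split: split_indicator)
  also have "\<dots> = (\<integral>\<^sup>+i\<in>UNIV. F (i, []) \<partial>count_space UNIV)"
    by (rule nn_integral_count_compose_bij[symmetric]) (auto simp: bij_betw_def inj_on_def)
  also have "\<dots> = (\<Sum>i. F (i, []))" by (simp add: nn_integral_count_space_nat)
  finally show ?thesis .
qed

end

section \<open>Positions of the individuals\<close>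

lemma measurable_fst_borel [measurable]:
  "fst \<in> measurable (borel :: ('a::second_countable_topology \<times> 'b::second_countable_topology) measure) borel"
  unfolding borel_prod[symmetric] by measurable

lemma measurable_snd_borel [measurable]:
  "snd \<in> measurable (borel :: ('a::second_countable_topology \<times> 'b::second_countable_topology) measure) borel"
  unfolding borel_prod[symmetric] by measurable

context cascades begin

lemma length_generation: "p \<in> generation n w \<Longrightarrow> length (snd p) = n"
  by (simp add: generation_def)

text \<open>
  The integrand matters only for labels of the generation at hand, and its measurability with respect
  to the history can only be expected for these.
\<close>
lemma campbell_generation:
  assumes G: "\<And>p. length (snd p) = n \<Longrightarrow> G p \<in> borel_measurable (H n \<Otimes>\<^sub>M borel)"
  shows "(\<integral>\<^sup>+w. gen_sum (Suc n) w (\<lambda>q. G (parent q) (w, dl q w, mk q w)) \<partial>M)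
    = (\<integral>\<^sup>+w. gen_sum n w (\<lambda>p. \<integral>\<^sup>+s. \<integral>\<^sup>+b. birth_rate h s (mk p w) * G p (w, s, b) \<partial>Q \<partial>lborel) \<partial>M)"
proof -
  define G' where "G' p = (if length (snd p) = n then G p else (\<lambda>_. 0))" for p
  have "(\<integral>\<^sup>+w. gen_sum (Suc n) w (\<lambda>q. G (parent q) (w, dl q w, mk q w)) \<partial>M)
    = (\<integral>\<^sup>+w. gen_sum (Suc n) w (\<lambda>q. G' (parent q) (w, dl q w, mk q w)) \<partial>M)"
    by (intro nn_integral_cong gen_sum_cong) (auto simp: G'_def parent_def dest: length_generation)
  also have "\<dots> = (\<integral>\<^sup>+w. gen_sum n w (\<lambda>p. \<integral>\<^sup>+s. \<integral>\<^sup>+b. birth_rate h s (mk p w) * G' p (w, s, b) \<partial>Q \<partial>lborel) \<partial>M)"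
    by (rule campbell) (use G in \<open>auto simp: G'_def\<close>)
  also have "\<dots> = (\<integral>\<^sup>+w. gen_sum n w (\<lambda>p. \<integral>\<^sup>+s. \<integral>\<^sup>+b. birth_rate h s (mk p w) * G p (w, s, b) \<partial>Q \<partial>lborel) \<partial>M)"
    by (intro nn_integral_cong gen_sum_cong) (auto simp: G'_def dest: length_generation)
  finally show ?thesis .
qed

end

context hawkes_kernel begin

text \<open>
  Integrating over the position \<open>x\<close> of the parent first, with the delay \<open>s\<close> of the child fixed, makes the
  translation invariance of Lebesgue measure available.
\<close>
lemma nn_integral_fertility_swap:
  fixes Y :: "real \<Rightarrow> real \<Rightarrow> ennreal"
  assumes [measurable]: "(\<lambda>x. Y (fst x) (snd x)) \<in> borel_measurable (borel \<Otimes>\<^sub>M borel)"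
  shows "(\<integral>\<^sup>+x. \<integral>\<^sup>+a. \<integral>\<^sup>+s. birth_rate h s a * Y x s \<partial>lborel \<partial>Q \<partial>lborel)
    = (\<integral>\<^sup>+a. \<integral>\<^sup>+s. birth_rate h s a * (\<integral>\<^sup>+x. Y x s \<partial>lborel) \<partial>lborel \<partial>Q)"
proof -
  interpret LQ: pair_sigma_finite lborel Q ..
  have Y [measurable (raw)]: "(\<lambda>x. Y (g x) (k x)) \<in> borel_measurable L"
    if "g \<in> borel_measurable L" "k \<in> borel_measurable L" for g k and L :: "'z measure"
    using measurable_compose[OF measurable_Pair[OF that] assms] by simp
  have "(\<integral>\<^sup>+x. \<integral>\<^sup>+a. \<integral>\<^sup>+s. birth_rate h s a * Y x s \<partial>lborel \<partial>Q \<partial>lborel)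
      = (\<integral>\<^sup>+a. \<integral>\<^sup>+x. \<integral>\<^sup>+s. birth_rate h s a * Y x s \<partial>lborel \<partial>lborel \<partial>Q)"
    by (rule LQ.Fubini'[symmetric]) measurable
  also have "\<dots> = (\<integral>\<^sup>+a. \<integral>\<^sup>+s. \<integral>\<^sup>+x. birth_rate h s a * Y x s \<partial>lborel \<partial>lborel \<partial>Q)"
    by (intro nn_integral_cong lborel_pair.Fubini'[symmetric]) measurable
  also have "\<dots> = (\<integral>\<^sup>+a. \<integral>\<^sup>+s. birth_rate h s a * (\<integral>\<^sup>+x. Y x s \<partial>lborel) \<partial>lborel \<partial>Q)"
    by (intro nn_integral_cong nn_integral_cmult) measurable
  finally show ?thesis .
qed

abbreviation "kbar \<equiv> (\<integral>\<^sup>+a. kappa h a \<partial>Q)"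

text \<open>
  The mean of \<open>min s t\<close> for the mean fertility measure \<open>E \<mu>\<^sub>A(ds)\<close>. Multiplied by \<open>2 \<nu>\<close>, it bounds
  the mean number of children of immigrants that are separated from their parent by an end of \<open>[0, t]\<close>.
\<close>
definition truncated_delay :: "real \<Rightarrow> ennreal" where
  "truncated_delay t = (\<integral>\<^sup>+a. \<integral>\<^sup>+s. birth_rate h s a * ennreal (min s t) \<partial>lborel \<partial>Q)"

end

text \<open>
  One of the two positions lies in \<open>[0, t]\<close> and the other does not. As a pseudo-metric it can be summed
  along the line of descent from an immigrant to an individual.
\<close>
definition straddles :: "real \<Rightarrow> real \<Rightarrow> real \<Rightarrow> ennreal" where
  "straddles t x y = of_bool ((x \<in> {0..t}) \<noteq> (y \<in> {0..t}))"

lemma straddles_self [simp]: "straddles t x x = 0"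
  by (simp add: straddles_def)

lemma straddles_triangle: "straddles t x z \<le> straddles t x y + straddles t y z"
  by (auto simp: straddles_def)

lemma measurable_straddles [measurable (raw)]:
  assumes [measurable]: "f \<in> borel_measurable M" "g \<in> borel_measurable M"
  shows "(\<lambda>x. straddles t (f x) (g x)) \<in> borel_measurable M"
  unfolding straddles_def of_bool_def by measurable

text \<open>
  The points from which a step of length \<open>s\<close> crosses \<open>0\<close> form an interval of length \<open>s\<close>, and likewise for
  \<open>t\<close>. On the other hand, a step that enters or leaves \<open>[0, t]\<close> starts or ends in this interval.
\<close>
lemma nn_integral_straddles_le:
  assumes "0 \<le> s" and "0 \<le> t"
  shows "(\<integral>\<^sup>+x. straddles t (x + s) x \<partial>lborel) \<le> 2 * ennreal (min s t)"
proof -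
  have "(\<integral>\<^sup>+x. straddles t (x + s) x \<partial>lborel) \<le> (\<integral>\<^sup>+x. indicator {-s..0} x + indicator {t - s..t} x \<partial>lborel)"
    using assms by (intro nn_integral_mono) (auto simp: straddles_def split: split_indicator)
  also have "\<dots> = ennreal s + ennreal s"
    using assms by (subst nn_integral_add) auto
  finally have 1: "(\<integral>\<^sup>+x. straddles t (x + s) x \<partial>lborel) \<le> 2 * ennreal s" by (simp add: mult_2)
  have "(\<integral>\<^sup>+x. straddles t (x + s) x \<partial>lborel) \<le> (\<integral>\<^sup>+x. indicator {0..t} x + indicator {- s..t - s} x \<partial>lborel)"
    using assms by (intro nn_integral_mono) (auto simp: straddles_def split: split_indicator)
  also have "\<dots> = ennreal t + ennreal t"
    using assms by (subst nn_integral_add) auto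
  finally have 2: "(\<integral>\<^sup>+x. straddles t (x + s) x \<partial>lborel) \<le> 2 * ennreal t" by (simp add: mult_2)
  from 1 2 show ?thesis by (simp add: min_def)
qed

context hawkes begin

definition birth_time :: "nat \<times> nat list \<Rightarrow> 'w \<Rightarrow> real" where
  "birth_time p w = \<Gamma> (fst p) w + birth (snd p) (W (fst p) w)"

lemma H_\<Gamma> [measurable]: "\<Gamma> i \<in> borel_measurable (H n)"
  using \<G>_\<Gamma> by (rule measurable_G_H)

lemma H_birth_time: "length (snd p) \<le> n \<Longrightarrow> birth_time p \<in> borel_measurable (H n)"
  unfolding birth_time_def[abs_def] by (intro borel_measurable_add H_\<Gamma> H_birth)

lemma measurable_birth_time [measurable]: "birth_time p \<in> borel_measurable M"
  using H_birth_time[OF order_refl] by (rule measurable_H_M)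

lemma birth_time_parent:
  assumes "q \<in> generation (Suc n) w"
  shows "birth_time q w = birth_time (parent q) w + dl q w"
proof -
  from assms obtain p l where "q = child p l" unfolding generation_Suc by auto
  then show ?thesis by (simp add: birth_time_def dl_def child_def parent_def birth_snoc)
qed

text \<open>
  The immigrants arrive at rate at most \<open>\<nu>\<close>. Delays translate Lebesgue measure into itself, so the rate of
  each generation is the mean total fertility times that of the previous one, with marks of law \<open>Q\<close>.
\<close>
lemma intensity_le:
  assumes F [measurable]: "F \<in> borel_measurable (borel :: (real \<times> 'a) measure)"
  shows "(\<integral>\<^sup>+w. gen_sum n w (\<lambda>p. F (birth_time p w, mk p w)) \<partial>M)
    \<le> kbar ^ n * (ennreal \<nu> * (\<integral>\<^sup>+x. \<integral>\<^sup>+a. F (x, a) \<partial>Q \<partial>lborel))"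
  using F
proof (induction n arbitrary: F)
  case 0
  note [measurable] = 0
  have [measurable]: "F \<in> borel_measurable (borel \<Otimes>\<^sub>M borel)" unfolding borel_prod by (rule 0)
  have "(\<integral>\<^sup>+w. gen_sum 0 w (\<lambda>p. F (birth_time p w, mk p w)) \<partial>M)
    = (\<integral>\<^sup>+x. \<integral>\<^sup>+a. ennreal \<nu> * indicator J x * F (x, a) \<partial>Q \<partial>lborel)"
    unfolding gen_sum_0 by (subst immigrant_mean[OF 0, symmetric]) (simp add: birth_time_def mk_def)
  also have "\<dots> \<le> (\<integral>\<^sup>+x. \<integral>\<^sup>+a. ennreal \<nu> * F (x, a) \<partial>Q \<partial>lborel)"
    by (intro nn_integral_mono) (auto split: split_indicator)
  also have "\<dots> = (\<integral>\<^sup>+x. ennreal \<nu> * (\<integral>\<^sup>+a. F (x, a) \<partial>Q) \<partial>lborel)"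
    by (intro nn_integral_cong nn_integral_cmult) measurable
  also have "\<dots> = ennreal \<nu> * (\<integral>\<^sup>+x. \<integral>\<^sup>+a. F (x, a) \<partial>Q \<partial>lborel)"
    by (rule nn_integral_cmult) measurable
  finally show ?case by simp
next
  case (Suc n)
  note F [measurable] = Suc.prems
  have F' [measurable]: "F \<in> borel_measurable (borel \<Otimes>\<^sub>M borel)" unfolding borel_prod by (rule F)
  define g where "g y = (\<integral>\<^sup>+b. F (y, b) \<partial>Q)" for y
  have g [measurable]: "g \<in> borel_measurable borel" unfolding g_def by measurable
  define K where "K x = (\<integral>\<^sup>+s. birth_rate h s (snd x) * g (fst x + s) \<partial>lborel)" for x :: "real \<times> 'a"
  have K: "K \<in> borel_measurable borel" unfolding K_def by measurable
  have "(\<integral>\<^sup>+w. gen_sum (Suc n) w (\<lambda>q. F (birth_time q w, mk q w)) \<partial>M)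
    = (\<integral>\<^sup>+w. gen_sum (Suc n) w (\<lambda>q. (\<lambda>p x. F (birth_time p (fst x) + fst (snd x), snd (snd x))) (parent q) (w, dl q w, mk q w)) \<partial>M)"
    by (intro nn_integral_cong gen_sum_cong) (simp add: birth_time_parent)
  also have "\<dots> = (\<integral>\<^sup>+w. gen_sum n w (\<lambda>p. \<integral>\<^sup>+s. \<integral>\<^sup>+b. birth_rate h s (mk p w)
      * (\<lambda>p x. F (birth_time p (fst x) + fst (snd x), snd (snd x))) p (w, s, b) \<partial>Q \<partial>lborel) \<partial>M)"
  proof (rule campbell_generation)
    fix p :: "nat \<times> nat list" assume "length (snd p) = n"
    then have [measurable]: "birth_time p \<in> borel_measurable (H n)" by (intro H_birth_time) simp
    show "(\<lambda>x. F (birth_time p (fst x) + fst (snd x), snd (snd x))) \<in> borel_measurable (H n \<Otimes>\<^sub>M borel)"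
      by measurable
  qed
  also have "\<dots> = (\<integral>\<^sup>+w. gen_sum n w (\<lambda>p. K (birth_time p w, mk p w)) \<partial>M)"
    unfolding K_def g_def fst_conv snd_conv
    by (intro nn_integral_cong gen_sum_cong nn_integral_cmult) measurable
  also have "\<dots> \<le> kbar ^ n * (ennreal \<nu> * (\<integral>\<^sup>+x. \<integral>\<^sup>+a. K (x, a) \<partial>Q \<partial>lborel))"
    by (rule Suc.IH[OF K])
  also have "(\<integral>\<^sup>+x. \<integral>\<^sup>+a. K (x, a) \<partial>Q \<partial>lborel) = kbar * (\<integral>\<^sup>+x. \<integral>\<^sup>+a. F (x, a) \<partial>Q \<partial>lborel)"
  proof -
    have shift: "(\<integral>\<^sup>+x. g (x + s) \<partial>lborel) = (\<integral>\<^sup>+x. g x \<partial>lborel)" for s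
      using nn_integral_real_affine[OF g, of 1 s] by (simp add: add.commute)
    have "(\<integral>\<^sup>+x. \<integral>\<^sup>+a. K (x, a) \<partial>Q \<partial>lborel)
      = (\<integral>\<^sup>+a. \<integral>\<^sup>+s. birth_rate h s a * (\<integral>\<^sup>+x. g (x + s) \<partial>lborel) \<partial>lborel \<partial>Q)"
      unfolding K_def fst_conv snd_conv by (rule nn_integral_fertility_swap) measurable
    also have "\<dots> = kbar * (\<integral>\<^sup>+x. g x \<partial>lborel)"
      unfolding shift by (simp add: nn_integral_multc kappa_eq)
    finally show ?thesis by (simp add: g_def)
  qed
  finally show ?case by (simp add: mult_ac)
qed


section \<open>Claims separated from their immigrant\<close>

text \<open>
  The mean of the sum of \<open>\<psi>\<close> over the individuals of generation \<open>n\<close> that are separated from their immigrant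
  by an end of \<open>[0, t]\<close>.
\<close>
definition mismatch :: "real \<Rightarrow> nat \<Rightarrow> ('a \<Rightarrow> ennreal) \<Rightarrow> ennreal" where
  "mismatch t n \<psi> = (\<integral>\<^sup>+w. gen_sum n w (\<lambda>p. straddles t (birth_time p w) (\<Gamma> (fst p) w) * \<psi> (mk p w)) \<partial>M)"

lemma mismatch_0: "mismatch t 0 \<psi> = 0"
  by (simp add: mismatch_def gen_sum_0 birth_time_def)

text \<open>
  A child is separated from the immigrant only if its parent is, or if it is separated from its parent.
  The first case contributes the children of separated parents, the second at most a step across an end
  from parents spread out at the rate of generation \<open>n\<close>.
\<close>
lemma mismatch_Suc:
  assumes t: "0 \<le> t" and [measurable]: "\<psi> \<in> borel_measurable borel"
  shows "mismatch t (Suc n) \<psi>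
    \<le> (mismatch t n (kappa h) + kbar ^ n * (ennreal \<nu> * (2 * truncated_delay t))) * (\<integral>\<^sup>+b. \<psi> b \<partial>Q)"
proof -
  let ?m = "\<integral>\<^sup>+b. \<psi> b \<partial>Q"
  define K where "K x = (\<integral>\<^sup>+s. birth_rate h s (snd x) * straddles t (fst x + s) (fst x) \<partial>lborel)" for x :: "real \<times> 'a"
  have K [measurable]: "K \<in> borel_measurable borel" unfolding K_def by measurable
  have KM [measurable]: "(\<lambda>w. K (birth_time p w, mk p w)) \<in> borel_measurable M" for p
    by (rule measurable_compose[OF borel_measurable_Pair K]) measurable
  have "mismatch t (Suc n) \<psi>
    = (\<integral>\<^sup>+w. gen_sum (Suc n) w (\<lambda>q. (\<lambda>p x. straddles t (birth_time p (fst x) + fst (snd x)) (\<Gamma> (fst p) (fst x)) * \<psi> (snd (snd x)))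
        (parent q) (w, dl q w, mk q w)) \<partial>M)"
    unfolding mismatch_def by (intro nn_integral_cong gen_sum_cong) (simp add: birth_time_parent, simp add: parent_def)
  also have "\<dots> = (\<integral>\<^sup>+w. gen_sum n w (\<lambda>p. \<integral>\<^sup>+s. \<integral>\<^sup>+b. birth_rate h s (mk p w)
      * (\<lambda>p x. straddles t (birth_time p (fst x) + fst (snd x)) (\<Gamma> (fst p) (fst x)) * \<psi> (snd (snd x))) p (w, s, b) \<partial>Q \<partial>lborel) \<partial>M)"
  proof (rule campbell_generation)
    fix p :: "nat \<times> nat list" assume "length (snd p) = n"
    then have [measurable]: "birth_time p \<in> borel_measurable (H n)" by (intro H_birth_time) simp
    show "(\<lambda>x. straddles t (birth_time p (fst x) + fst (snd x)) (\<Gamma> (fst p) (fst x)) * \<psi> (snd (snd x))) \<in> borel_measurable (H n \<Otimes>\<^sub>M borel)"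
      by measurable
  qed
  also have "\<dots> = (\<integral>\<^sup>+w. gen_sum n w (\<lambda>p. (\<integral>\<^sup>+s. birth_rate h s (mk p w)
      * straddles t (birth_time p w + s) (\<Gamma> (fst p) w) \<partial>lborel) * ?m) \<partial>M)"
    unfolding fst_conv snd_conv
    by (intro nn_integral_cong gen_sum_cong)
      (simp add: nn_integral_cmult nn_integral_multc mult.assoc[symmetric])
  also have "\<dots> \<le> (\<integral>\<^sup>+w. gen_sum n w (\<lambda>p. ?m * (straddles t (birth_time p w) (\<Gamma> (fst p) w) * kappa h (mk p w) + K (birth_time p w, mk p w))) \<partial>M)"
  proof (intro nn_integral_mono gen_sum_mono)
    fix w p
    have "(\<integral>\<^sup>+s. birth_rate h s (mk p w) * straddles t (birth_time p w + s) (\<Gamma> (fst p) w) \<partial>lborel)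
      \<le> (\<integral>\<^sup>+s. birth_rate h s (mk p w) * straddles t (birth_time p w) (\<Gamma> (fst p) w)
          + birth_rate h s (mk p w) * straddles t (birth_time p w + s) (birth_time p w) \<partial>lborel)"
      unfolding distrib_left[symmetric]
      by (intro nn_integral_mono mult_left_mono)
        (auto intro: order_trans[OF straddles_triangle[where y="birth_time p w"]] simp: add.commute)
    also have "\<dots> = kappa h (mk p w) * straddles t (birth_time p w) (\<Gamma> (fst p) w) + K (birth_time p w, mk p w)"
      by (subst nn_integral_add) (auto simp: nn_integral_multc kappa_eq K_def)
    finally show "(\<integral>\<^sup>+s. birth_rate h s (mk p w) * straddles t (birth_time p w + s) (\<Gamma> (fst p) w) \<partial>lborel) * ?m
      \<le> ?m * (straddles t (birth_time p w) (\<Gamma> (fst p) w) * kappa h (mk p w) + K (birth_time p w, mk p w))"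
      by (subst mult.commute) (auto intro!: mult_left_mono simp: mult.commute)
  qed
  also have "\<dots> = ?m * (mismatch t n (kappa h) + (\<integral>\<^sup>+w. gen_sum n w (\<lambda>p. K (birth_time p w, mk p w)) \<partial>M))"
    unfolding gen_sum_cmult gen_sum_add mismatch_def by (simp add: nn_integral_cmult nn_integral_add)
  also have "\<dots> \<le> ?m * (mismatch t n (kappa h) + kbar ^ n * (ennreal \<nu> * (2 * truncated_delay t)))"
  proof (intro mult_left_mono add_left_mono)
    have "(\<integral>\<^sup>+w. gen_sum n w (\<lambda>p. K (birth_time p w, mk p w)) \<partial>M)
      \<le> kbar ^ n * (ennreal \<nu> * (\<integral>\<^sup>+x. \<integral>\<^sup>+a. K (x, a) \<partial>Q \<partial>lborel))"
      by (rule intensity_le[OF K])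
    also have "(\<integral>\<^sup>+x. \<integral>\<^sup>+a. K (x, a) \<partial>Q \<partial>lborel)
      = (\<integral>\<^sup>+a. \<integral>\<^sup>+s. birth_rate h s a * (\<integral>\<^sup>+x. straddles t (x + s) x \<partial>lborel) \<partial>lborel \<partial>Q)"
      unfolding K_def fst_conv snd_conv by (rule nn_integral_fertility_swap) measurable
    also have "\<dots> \<le> (\<integral>\<^sup>+a. \<integral>\<^sup>+s. 2 * (birth_rate h s a * ennreal (min s t)) \<partial>lborel \<partial>Q)"
    proof (intro nn_integral_mono)
      fix a s
      show "birth_rate h s a * (\<integral>\<^sup>+x. straddles t (x + s) x \<partial>lborel) \<le> 2 * (birth_rate h s a * ennreal (min s t))"
      proof (cases "0 \<le> s")
        case True
        have "birth_rate h s a * (\<integral>\<^sup>+x. straddles t (x + s) x \<partial>lborel) \<le> birth_rate h s a * (2 * ennreal (min s t))"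
          using nn_integral_straddles_le[OF True t] by (rule mult_left_mono) simp
        then show ?thesis by (simp add: mult_ac)
      qed (simp add: birth_rate_def)
    qed
    also have "\<dots> = 2 * truncated_delay t"
      unfolding truncated_delay_def by (simp add: nn_integral_cmult)
    finally show "(\<integral>\<^sup>+w. gen_sum n w (\<lambda>p. K (birth_time p w, mk p w)) \<partial>M) \<le> kbar ^ n * (ennreal \<nu> * (2 * truncated_delay t))"
      by (simp add: mult_left_mono)
  qed auto
  finally show ?thesis by (simp add: mult.commute)
qed

text \<open>
  The recursion multiplies by \<open>kbar\<close> and adds a multiple of \<open>kbar ^ n\<close>, whence the linear factor.
\<close>
lemma mismatch_le:
  assumes t: "0 \<le> t" and \<psi>: "\<psi> \<in> borel_measurable borel"
  shows "mismatch t (Suc n) \<psi> \<le> of_nat (Suc n) * kbar ^ n * (ennreal \<nu> * (2 * truncated_delay t)) * (\<integral>\<^sup>+b. \<psi> b \<partial>Q)"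
  using \<psi>
proof (induction n arbitrary: \<psi>)
  case 0
  show ?case using mismatch_Suc[OF t 0, of 0] by (simp add: mismatch_0)
next
  case (Suc n)
  let ?c = "ennreal \<nu> * (2 * truncated_delay t)"
  have "mismatch t (Suc (Suc n)) \<psi> \<le> (mismatch t (Suc n) (kappa h) + kbar ^ Suc n * ?c) * (\<integral>\<^sup>+b. \<psi> b \<partial>Q)"
    by (rule mismatch_Suc[OF t Suc.prems])
  also have "\<dots> \<le> (of_nat (Suc n) * kbar ^ n * ?c * kbar + kbar ^ Suc n * ?c) * (\<integral>\<^sup>+b. \<psi> b \<partial>Q)"
    by (intro mult_right_mono add_right_mono Suc.IH) auto
  also have "of_nat (Suc n) * kbar ^ n * ?c * kbar + kbar ^ Suc n * ?c = of_nat (Suc (Suc n)) * kbar ^ Suc n * ?c"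
    by (simp add: algebra_simps)
  finally show ?case .
qed

definition mismatched_claims :: "real \<Rightarrow> 'w \<Rightarrow> ennreal" where
  "mismatched_claims t w = (\<Sum>n. gen_sum n w (\<lambda>p. straddles t (birth_time p w) (\<Gamma> (fst p) w) * ennreal (f (mk p w))))"

definition settled_claims :: "real \<Rightarrow> 'w \<Rightarrow> ennreal" where
  "settled_claims t w = (\<Sum>n. gen_sum n w (\<lambda>p. indicator {0..t} (birth_time p w) * ennreal (f (mk p w))))"

definition cluster_claims :: "real \<Rightarrow> 'w \<Rightarrow> ennreal" where
  "cluster_claims t w = (\<Sum>n. gen_sum n w (\<lambda>p. indicator {0..t} (\<Gamma> (fst p) w) * ennreal (f (mk p w))))"

lemma measurable_claim_sums [measurable]:
  "mismatched_claims t \<in> borel_measurable M" "settled_claims t \<in> borel_measurable M" "cluster_claims t \<in> borel_measurable M"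
  unfolding mismatched_claims_def[abs_def] settled_claims_def[abs_def] cluster_claims_def[abs_def] by measurable

lemma settled_le: "settled_claims t w \<le> cluster_claims t w + mismatched_claims t w"
  and cluster_le: "cluster_claims t w \<le> settled_claims t w + mismatched_claims t w"
proof -
  have *: "(\<Sum>n. gen_sum n w F) \<le> (\<Sum>n. gen_sum n w F') + (\<Sum>n. gen_sum n w F'')" if "\<And>p. F p \<le> F' p + F'' p" for F F' F''
  proof -
    have "(\<Sum>n. gen_sum n w F) \<le> (\<Sum>n. gen_sum n w F' + gen_sum n w F'')"
      unfolding gen_sum_add[symmetric] by (intro suminf_le gen_sum_mono that) auto
    also have "\<dots> = (\<Sum>n. gen_sum n w F') + (\<Sum>n. gen_sum n w F'')"
      by (rule suminf_add[symmetric]) auto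
    finally show ?thesis .
  qed
  show "settled_claims t w \<le> cluster_claims t w + mismatched_claims t w"
    unfolding settled_claims_def cluster_claims_def mismatched_claims_def
    by (rule *) (auto simp: straddles_def split: split_indicator)
  show "cluster_claims t w \<le> settled_claims t w + mismatched_claims t w"
    unfolding settled_claims_def cluster_claims_def mismatched_claims_def
    by (rule *) (auto simp: straddles_def split: split_indicator)
qed

text \<open>
  The bounds for the generations are summable, since \<open>\<Sum>(n + 1) r\<^sup>n = (1 - r)\<^sup>-\<^sup>2\<close>.
\<close>
lemma mean_mismatched_claims:
  obtains K :: real where "0 \<le> K"
    "\<And>t. 0 \<le> t \<Longrightarrow> (\<integral>\<^sup>+w. mismatched_claims t w \<partial>M) \<le> ennreal K * truncated_delay t"
proof -
  obtain r where r: "kbar = ennreal r" "0 \<le> r"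
    using mean_kappa by (cases kbar) auto
  then have r1: "r < 1" using mean_kappa by (simp add: ennreal_less_one_iff)
  obtain e where e: "(\<integral>\<^sup>+a. ennreal (f a) \<partial>Q) = ennreal e" "0 \<le> e"
    using mean_f_finite by (cases "\<integral>\<^sup>+a. ennreal (f a) \<partial>Q") auto
  define G where "G = 1 / (1 - r)\<^sup>2"
  have G_nonneg: "0 \<le> G" by (simp add: G_def)
  have "(\<integral>\<^sup>+w. mismatched_claims t w \<partial>M) \<le> ennreal (G * \<nu> * 2 * e) * truncated_delay t" if t: "0 \<le> t" for t
  proof -
    have "(\<integral>\<^sup>+w. mismatched_claims t w \<partial>M) = (\<Sum>n. mismatch t n (\<lambda>a. ennreal (f a)))"
      unfolding mismatched_claims_def mismatch_def by (rule nn_integral_suminf) measurable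
    also have "\<dots> = (\<Sum>n. mismatch t (Suc n) (\<lambda>a. ennreal (f a)))"
    proof -
      have "(\<lambda>n. mismatch t (Suc n) (\<lambda>a. ennreal (f a))) sums (\<Sum>n. mismatch t (Suc n) (\<lambda>a. ennreal (f a)))"
        by (rule summable_sums) simp
      from sums_unique[OF sums_Suc[OF this]] show ?thesis by (simp add: mismatch_0)
    qed
    also have "\<dots> \<le> (\<Sum>n. ennreal (real (Suc n) * r ^ n) * (ennreal \<nu> * (2 * truncated_delay t) * ennreal e))"
    proof (intro suminf_le)
      fix n
      have "mismatch t (Suc n) (\<lambda>a. ennreal (f a)) \<le> of_nat (Suc n) * kbar ^ n * (ennreal \<nu> * (2 * truncated_delay t)) * (\<integral>\<^sup>+a. ennreal (f a) \<partial>Q)"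
        by (rule mismatch_le[OF t]) measurable
      also have "\<dots> = ennreal (real (Suc n) * r ^ n) * (ennreal \<nu> * (2 * truncated_delay t) * ennreal e)"
        using r by (simp add: e(1) ennreal_mult ennreal_power ennreal_of_nat_eq_real_of_nat mult.assoc del: of_nat_Suc)
      finally show "mismatch t (Suc n) (\<lambda>a. ennreal (f a)) \<le> ennreal (real (Suc n) * r ^ n) * (ennreal \<nu> * (2 * truncated_delay t) * ennreal e)" .
    qed auto
    also have "\<dots> = (\<Sum>n. ennreal (real (Suc n) * r ^ n)) * (ennreal \<nu> * (2 * truncated_delay t) * ennreal e)"
      by (rule ennreal_suminf_multc)
    also have "(\<Sum>n. ennreal (real (Suc n) * r ^ n)) = ennreal G"
      using r r1 geometric_deriv_sums[of r] by (intro suminf_ennreal_eq) (auto simp: G_def)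
    also have "ennreal G * (ennreal \<nu> * (2 * truncated_delay t) * ennreal e) = ennreal (G * \<nu> * 2 * e) * truncated_delay t"
      using e \<nu> G_nonneg by (simp add: ennreal_mult mult_ac)
    finally show ?thesis .
  qed
  moreover have "0 \<le> G * \<nu> * 2 * e" using e \<nu> G_nonneg by simp
  ultimately show thesis by (intro that[of "G * \<nu> * 2 * e"]) auto
qed

end

context hawkes begin

section \<open>Clusters of the immigrants of a bounded interval\<close>

definition arrived :: "real \<Rightarrow> 'w \<Rightarrow> nat set" where
  "arrived t w = {i. \<Gamma> i w \<in> {0..t}}"

lemma mean_arrived:
  assumes t: "0 \<le> t" and [measurable]: "\<psi> \<in> borel_measurable borel"
  shows "(\<integral>\<^sup>+w. (\<Sum>i. indicator (arrived t w) i * \<psi> (mark (W i w) [])) \<partial>M) = ennreal (\<nu> * t) * (\<integral>\<^sup>+a. \<psi> a \<partial>Q)"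
proof -
  define G where "G x = indicator {0..t} (fst x) * \<psi> (snd x)" for x :: "real \<times> 'a"
  have G [measurable]: "G \<in> borel_measurable borel" unfolding G_def by measurable
  have "(\<integral>\<^sup>+w. (\<Sum>i. indicator (arrived t w) i * \<psi> (mark (W i w) [])) \<partial>M)
      = (\<integral>\<^sup>+w. (\<Sum>i. G (\<Gamma> i w, mark (W i w) [])) \<partial>M)"
    by (intro nn_integral_cong suminf_cong) (simp add: G_def arrived_def indicator_def)
  also have "\<dots> = (\<integral>\<^sup>+x. \<integral>\<^sup>+a. ennreal \<nu> * indicator J x * G (x, a) \<partial>Q \<partial>lborel)"
    by (rule immigrant_mean[OF G])
  also have "\<dots> = (\<integral>\<^sup>+x. (ennreal \<nu> * (\<integral>\<^sup>+a. \<psi> a \<partial>Q)) * indicator {0..t} x \<partial>lborel)"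
  proof (rule nn_integral_cong)
    fix x
    have "x \<in> {0..t} \<Longrightarrow> x \<in> J" using J_sup by auto
    then show "(\<integral>\<^sup>+a. ennreal \<nu> * indicator J x * G (x, a) \<partial>Q) = (ennreal \<nu> * (\<integral>\<^sup>+a. \<psi> a \<partial>Q)) * indicator {0..t} x"
      by (auto simp: G_def nn_integral_cmult split: split_indicator)
  qed
  also have "\<dots> = ennreal (\<nu> * t) * (\<integral>\<^sup>+a. \<psi> a \<partial>Q)"
    using t \<nu> by (subst nn_integral_cmult_indicator) (auto simp: ennreal_mult mult_ac)
  finally show ?thesis .
qed

lemma AE_finite_arrived:
  assumes t: "0 \<le> t"
  shows "AE w in M. finite (arrived t w)"
proof -
  have [measurable]: "Measurable.pred M (\<lambda>w. i \<in> arrived t w)" for i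
    unfolding arrived_def mem_Collect_eq by measurable
  have "(\<integral>\<^sup>+w. (\<Sum>i. indicator (arrived t w) i) \<partial>M) = ennreal (\<nu> * t)"
    using mean_arrived[OF t, of "\<lambda>_. 1"] by (simp add: Q.emeasure_space_1[simplified])
  then have "AE w in M. (\<Sum>i. indicator (arrived t w) i :: ennreal) \<noteq> \<infinity>"
    by (intro nn_integral_noteq_infinite) auto
  then show ?thesis
    unfolding tally_eq_suminf[symmetric]
    by eventually_elim (auto simp: emeasure_count_space split: if_splits)
qed

lemma emeasure_\<Lambda>_Times:
  assumes t: "0 \<le> t" and S: "S \<in> sets borel"
  shows "emeasure \<Lambda> ({0..t} \<times> S) = ennreal (\<nu> * t * measure Q S)"
proof -
  have "emeasure (density lborel (\<lambda>s. ennreal \<nu> * indicator J s)) {0..t}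
      = (\<integral>\<^sup>+s. ennreal \<nu> * indicator J s * indicator {0..t} s \<partial>lborel)"
    by (rule emeasure_density) measurable
  also have "\<dots> = (\<integral>\<^sup>+s. ennreal \<nu> * indicator {0..t} s \<partial>lborel)"
    using J_sup by (intro nn_integral_cong) (auto split: split_indicator)
  also have "\<dots> = ennreal (\<nu> * t)"
    using t \<nu> by (subst nn_integral_cmult_indicator) (auto simp: ennreal_mult)
  finally show ?thesis
    unfolding \<Lambda>_def using S t \<nu>
    by (subst Q.emeasure_pair_measure_Times) (auto simp: Q.emeasure_eq_measure ennreal_mult)
qed

text \<open>
  The immigrants of \<open>[0, t]\<close> are the points of one fictitious parent with a Poisson number of children of
  mean \<open>\<nu> * t\<close>, and nothing to condition on.
\<close>
lemma integral_prod_arrived: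
  fixes \<psi> :: "'a \<Rightarrow> complex"
  assumes t: "0 \<le> t" and \<psi> [measurable]: "\<psi> \<in> borel_measurable borel" and \<psi>_le: "\<And>a. norm (\<psi> a) \<le> 1"
  shows "(\<integral>w. (\<Prod>i\<in>arrived t w. \<psi> (mark (W i w) [])) \<partial>M) = exp (of_real (\<nu> * t) * ((\<integral>a. \<psi> a \<partial>Q) - 1))"
proof -
  have arr [measurable]: "Measurable.pred M (\<lambda>w. i \<in> arrived t w)" for i
    unfolding arrived_def mem_Collect_eq by measurable
  have "(\<integral>w. 1 * (\<Prod>p\<in>{()}. \<Prod>i\<in>arrived t w. \<psi> (mark (W i w) [])) \<partial>M)
    = (\<integral>w. 1 * (\<Prod>p\<in>{()}. exp (of_real (\<nu> * t) * ((\<integral>a. \<psi> a \<partial>Q) - 1))) \<partial>M)"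
  proof (rule integral_prod_poisson_marks[OF Q.prob_space_axioms, where x="\<lambda>_ i w. mark (W i w) []"
        and L="\<lambda>_. arrived t" and R="\<lambda>_ _. \<nu> * t"])
    show "AE w in M. (1::complex) \<noteq> 0 \<longrightarrow> (\<forall>p\<in>{()}. finite (arrived t w))"
      using AE_finite_arrived[OF t] by simp
    show "0 \<le> \<nu> * t" using t \<nu> by simp
    fix C :: "complex set" and S :: "complex \<Rightarrow> 'a set" and k :: "unit \<times> complex \<Rightarrow> nat"
    assume C: "finite C" and S: "\<And>c. c \<in> C \<Longrightarrow> S c \<in> sets Q" and disj: "disjoint_family_on S C"
    define B where "B c = {0..t} \<times> S c" for c
    have B: "B c \<in> sets borel" if "c \<in> C" for c
    proof -
      have [measurable]: "S c \<in> sets borel" using S that by auto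
      show ?thesis unfolding B_def borel_prod[symmetric] by measurable
    qed
    have arr_eq: "{i \<in> arrived t w. mark (W i w) [] \<in> S c} = arrivals (B c) w" for c w
      by (auto simp: arrived_def arrivals_def B_def)
    define V where "V c = {w \<in> space M. tally (arrivals (B c) w) = of_nat (k ((), c))}" for c
    have V: "V c \<in> sets M" if "c \<in> C" for c
      unfolding V_def using measurable_tally_arrivals[OF B[OF that]] by measurable
    have prob_V: "prob (V c) = poisson_weight (ennreal (\<nu> * t * measure Q (S c))) (k ((), c))" if "c \<in> C" for c
      using S[OF that] unfolding V_def arrivals_law[OF B[OF that]]
      by (simp add: B_def emeasure_\<Lambda>_Times[OF t])
    have inter: "prob (space M \<inter> (\<Inter>c\<in>C. V c)) = (\<Prod>c\<in>C. prob (V c))"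
    proof (cases "C = {}")
      case False
      obtain e where e: "bij_betw e {..<card C} C"
        using ex_bij_betw_nat_finite[OF C] by (auto simp: atLeast0LessThan)
      have eC: "e j \<in> C" if "j < card C" for j using bij_betwE[OF e] that by auto
      have ne: "{..<card C} \<noteq> {}" using False C by (simp add: lessThan_empty_iff)
      have im: "e ` {..<card C} = C" by (rule bij_betw_imp_surj_on[OF e])
      have disjB: "disjoint_family_on (\<lambda>j. B (e j)) {..<card C}"
      proof (unfold disjoint_family_on_def, intro ballI impI)
        fix i j assume ij: "i \<in> {..<card C}" "j \<in> {..<card C}" "i \<noteq> j"
        then have "e i \<noteq> e j" using bij_betw_imp_inj_on[OF e] by (auto simp: inj_on_def)
        then have "S (e i) \<inter> S (e j) = {}"
          using disj eC ij by (simp add: disjoint_family_on_def)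
        then show "B (e i) \<inter> B (e j) = {}" by (auto simp: B_def)
      qed
      have iv: "indep_vars (\<lambda>_. borel) (\<lambda>j w. tally (arrivals (B (e j)) w)) {..<card C}"
        by (rule arrivals_indep) (use B eC disjB in auto)
      have "prob (\<Inter>j\<in>{..<card C}. (\<lambda>w. tally (arrivals (B (e j)) w)) -` {of_nat (k ((), e j))} \<inter> space M)
        = (\<Prod>j\<in>{..<card C}. prob ((\<lambda>w. tally (arrivals (B (e j)) w)) -` {of_nat (k ((), e j))} \<inter> space M))"
        by (rule indep_varsD[OF iv ne]) auto
      moreover have "(\<lambda>w. tally (arrivals (B (e j)) w)) -` {of_nat (k ((), e j))} \<inter> space M = V (e j)" for j
        by (auto simp: V_def)
      ultimately have "prob (\<Inter>j\<in>{..<card C}. V (e j)) = (\<Prod>j\<in>{..<card C}. prob (V (e j)))" by simp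
      moreover have "(\<Inter>j\<in>{..<card C}. V (e j)) = space M \<inter> (\<Inter>c\<in>C. V c)"
      proof -
        have "(\<Inter>j\<in>{..<card C}. V (e j)) = (\<Inter>c\<in>e ` {..<card C}. V c)" by (rule image_image[symmetric, THEN arg_cong])
        also have "\<dots> = (\<Inter>c\<in>C. V c)" by (simp only: im)
        also have "\<dots> = space M \<inter> (\<Inter>c\<in>C. V c)"
        proof -
          have "V c \<subseteq> space M" for c by (auto simp: V_def)
          then show ?thesis using False by blast
        qed
        finally show ?thesis .
      qed
      moreover have "(\<Prod>j\<in>{..<card C}. prob (V (e j))) = (\<Prod>c\<in>C. prob (V c))"
        by (rule prod.reindex_bij_betw[OF e])
      ultimately show ?thesis by simp
    qed (simp add: prob_space)
    have UV: "space M \<inter> (\<Inter>c\<in>C. V c) \<in> sets M"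
      using C V by (cases "C = {}") auto
    have prod_unit: "(\<Prod>j\<in>{()} \<times> C. F j) = (\<Prod>c\<in>C. F ((), c))" for F :: "unit \<times> complex \<Rightarrow> real"
    proof -
      have e: "{()} \<times> C = Pair () ` C" by auto
      show ?thesis unfolding e by (subst prod.reindex) (auto simp: inj_on_def)
    qed
    have "(\<integral>w. (1::complex) * of_bool (\<forall>j\<in>{()} \<times> C. tally (arrivals (B (snd j)) w) = of_nat (k j)) \<partial>M)
      = (\<integral>w. complex_of_real (indicat_real (space M \<inter> (\<Inter>c\<in>C. V c)) w) \<partial>M)"
      by (intro Bochner_Integration.integral_cong) (auto simp: V_def indicator_def)
    also have "\<dots> = of_real (\<Prod>c\<in>C. prob (V c))"
      using UV inter by simp
    also have "\<dots> = (\<integral>w. (1::complex) * of_real (\<Prod>j\<in>{()} \<times> C. poisson_weight (ennreal (\<nu> * t * measure Q (S (snd j)))) (k j)) \<partial>M)"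
      unfolding prod_unit snd_conv using prob_V by (simp add: prob_space)
    finally show "(\<integral>w. (1::complex) * of_bool (\<forall>j\<in>{()} \<times> C. tally
        {l \<in> arrived t w. mark (W l w) [] \<in> S (snd j)} = of_nat (k j)) \<partial>M)
      = (\<integral>w. (1::complex) * of_real (\<Prod>j\<in>{()} \<times> C. poisson_weight (ennreal (\<nu> * t * measure Q (S (snd j)))) (k j)) \<partial>M)"
      unfolding arr_eq .
  qed (use \<psi>_le in auto)
  then show ?thesis by (simp add: prob_space)
qed

text \<open>
  The integrals of \<open>claim_gf\<close> that converge to the characteristic function \<open>\<phi>\<close> of \<open>D\<close> in the case of a single
  cascade appear here in the exponent.
\<close>
theorem char_cluster_claims:
  assumes t: "0 \<le> t" and lim: "(\<lambda>n. \<integral>a. claim_gf \<theta> n a \<partial>Q) \<longlonglongrightarrow> \<phi>"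
  shows "AE w in M. cluster_claims t w < \<infinity>"
    and "(\<integral>w. iexp (\<theta> * enn2real (cluster_claims t w)) \<partial>M) = exp (of_real (\<nu> * t) * (\<phi> - 1))"
proof -
  interpret C: claim_cascades Q h f M \<G> W "arrived t" "ennreal (\<nu> * t)"
  proof unfold_locales
    show "Measurable.pred \<G> (\<lambda>w. i \<in> arrived t w)" for i
      using \<G>_\<Gamma>[of i] unfolding arrived_def mem_Collect_eq by measurable
    fix \<psi> :: "'a \<Rightarrow> ennreal" assume \<psi>: "\<psi> \<in> borel_measurable borel"
    show "(\<integral>\<^sup>+w. gen_sum 0 w (\<lambda>p. indicator (arrived t w) (fst p) * \<psi> (mk p w)) \<partial>M) = ennreal (\<nu> * t) * (\<integral>\<^sup>+a. \<psi> a \<partial>Q)"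
      using mean_arrived[OF t \<psi>] by (simp add: gen_sum_0 mk_def)
  qed simp
  have claims_eq: "C.claims = cluster_claims t"
    by (intro ext) (simp add: C.claims_def cluster_claims_def arrived_def indicator_def)
  show "AE w in M. cluster_claims t w < \<infinity>"
    using C.AE_claims_finite unfolding claims_eq .
  have "C.active 0 w = (\<lambda>i. (i, [])) ` arrived t w" for w
    by (auto simp: C.active_def generation_def individuals_def)
  then have "(\<integral>w. (\<Prod>p\<in>C.active 0 w. claim_gf \<theta> n (mk p w)) \<partial>M)
    = (\<integral>w. (\<Prod>i\<in>arrived t w. claim_gf \<theta> n (mark (W i w) [])) \<partial>M)" for n
    by (simp add: prod.reindex inj_on_def mk_def)
  also have "\<dots> n = exp (of_real (\<nu> * t) * ((\<integral>a. claim_gf \<theta> n a \<partial>Q) - 1))" for n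
    by (rule integral_prod_arrived[OF t]) (auto intro: norm_claim_gf_le_1)
  finally have "(\<lambda>n. exp (of_real (\<nu> * t) * ((\<integral>a. claim_gf \<theta> n a \<partial>Q) - 1)))
      \<longlonglongrightarrow> (\<integral>w. iexp (\<theta> * enn2real (cluster_claims t w)) \<partial>M)"
    using C.char_claims_LIMSEQ[of \<theta>] by (simp add: claims_eq)
  moreover have "(\<lambda>n. exp (of_real (\<nu> * t) * ((\<integral>a. claim_gf \<theta> n a \<partial>Q) - 1))) \<longlonglongrightarrow> exp (of_real (\<nu> * t) * (\<phi> - 1))"
    by (intro tendsto_intros lim)
  ultimately show "(\<integral>w. iexp (\<theta> * enn2real (cluster_claims t w)) \<partial>M) = exp (of_real (\<nu> * t) * (\<phi> - 1))"
    by (rule LIMSEQ_unique)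
qed

text \<open>
  The Bochner integral that defines \<open>total_claims\<close> is \<open>0\<close> when it does not exist, as is \<open>enn2real \<infinity>\<close>; so
  the identity holds pointwise and yields the measurability of \<open>total_claims\<close>.
\<close>
lemma total_claims_eq:
  assumes N: "N w = distr (count_space (SIGMA i:UNIV. individuals (W i w))) borel
             (\<lambda>(i, u). (\<Gamma> i w + birth u (W i w), mark (W i w) u))"
  shows "total_claims f N t w = enn2real (settled_claims t w)"
proof -
  let ?S = "SIGMA i:UNIV. individuals (W i w)"
  let ?g = "\<lambda>p. indicator {0..t} (birth_time p w) * ennreal (f (mk p w))"
  have m: "(\<lambda>x. indicat_real ({0..t} \<times> UNIV) x *\<^sub>R (case x of (s, a) \<Rightarrow> f a)) \<in> borel_measurable (borel :: (real \<times> 'a) measure)"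
  proof -
    have "(\<lambda>x. indicat_real {0..t} (fst x) * f (snd x)) \<in> borel_measurable (borel :: (real \<times> 'a) measure)"
      by measurable
    also have "(\<lambda>x. indicat_real {0..t} (fst x) * f (snd x)) = (\<lambda>x. indicat_real ({0..t} \<times> UNIV) x *\<^sub>R (case x of (s, a) \<Rightarrow> f a))"
      by (auto simp: fun_eq_iff indicator_def)
    finally show ?thesis .
  qed
  have "total_claims f N t w = enn2real (\<integral>\<^sup>+x. ennreal (indicat_real ({0..t} \<times> UNIV) x *\<^sub>R (case x of (s, a) \<Rightarrow> f a)) \<partial>N w)"
    unfolding total_claims_def set_lebesgue_integral_def
    using m f_nonneg by (intro integral_eq_nn_integral) (auto simp: N split: prod.split)
  also have "(\<integral>\<^sup>+x. ennreal (indicat_real ({0..t} \<times> UNIV) x *\<^sub>R (case x of (s, a) \<Rightarrow> f a)) \<partial>N w)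
      = (\<integral>\<^sup>+p. ?g p \<partial>count_space ?S)"
    unfolding N using m
    by (subst nn_integral_distr)
      (auto intro!: nn_integral_cong simp: birth_time_def mk_def split: split_indicator)
  also have "\<dots> = settled_claims t w"
    unfolding settled_claims_def suminf_gen_sum
    by (subst nn_integral_count_space_indicator) (auto intro!: nn_integral_cong simp: indicator_def)
  finally show ?thesis .
qed

end

context hawkes_kernel begin

section \<open>The tail condition\<close>

definition mean_tail :: "real \<Rightarrow> ennreal" where
  "mean_tail t = (\<integral>\<^sup>+a. emeasure (fertility h a) {t<..} \<partial>Q)"

lemma mean_tail_eq: "mean_tail t = (\<integral>\<^sup>+a. \<integral>\<^sup>+s. birth_rate h s a * indicator {t<..} s \<partial>lborel \<partial>Q)"
  unfolding mean_tail_def fertility_eq_density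
  by (intro nn_integral_cong emeasure_density) measurable

lemma mean_tail_le_1: "mean_tail t \<le> 1"
proof -
  have "mean_tail t \<le> kbar"
    unfolding mean_tail_eq kappa_eq by (intro nn_integral_mono) (auto split: split_indicator)
  then show ?thesis using mean_kappa by simp
qed

text \<open>
  \<open>min s t\<close> is the length of \<open>{u \<in> {0..t}. u < s}\<close>.
\<close>
lemma truncated_delay_eq_integral:
  assumes t: "0 \<le> t"
  shows "truncated_delay t = (\<integral>\<^sup>+u. indicator {0..t} u * mean_tail u \<partial>lborel)"
proof -
  have [measurable]: "(\<lambda>x. indicator {0..t} (fst x) * indicator {fst x<..} (snd x) :: ennreal)
      \<in> borel_measurable (borel \<Otimes>\<^sub>M (borel :: real measure))"
  proof -
    have "(\<lambda>x. indicator {0..t} (fst x) * of_bool (fst x < snd x) :: ennreal) \<in> borel_measurable (borel \<Otimes>\<^sub>M (borel :: real measure))"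
      unfolding of_bool_def by measurable
    also have "(\<lambda>x::real \<times> real. indicator {0..t} (fst x) * of_bool (fst x < snd x) :: ennreal)
        = (\<lambda>x. indicator {0..t} (fst x) * indicator {fst x<..} (snd x))"
      by (auto simp: fun_eq_iff indicator_def)
    finally show ?thesis .
  qed
  have "(\<integral>\<^sup>+u. indicator {0..t} u * mean_tail u \<partial>lborel)
      = (\<integral>\<^sup>+u. \<integral>\<^sup>+a. \<integral>\<^sup>+s. birth_rate h s a * (indicator {0..t} u * indicator {u<..} s) \<partial>lborel \<partial>Q \<partial>lborel)"
    unfolding mean_tail_eq by (intro nn_integral_cong) (auto split: split_indicator)
  also have "\<dots> = (\<integral>\<^sup>+a. \<integral>\<^sup>+s. birth_rate h s a * (\<integral>\<^sup>+u. indicator {0..t} u * indicator {u<..} s \<partial>lborel) \<partial>lborel \<partial>Q)"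
    by (rule nn_integral_fertility_swap) measurable
  also have "\<dots> = truncated_delay t"
    unfolding truncated_delay_def
  proof (intro nn_integral_cong)
    fix a s
    show "birth_rate h s a * (\<integral>\<^sup>+u. indicator {0..t} u * indicator {u<..} s \<partial>lborel)
        = birth_rate h s a * ennreal (min s t)"
    proof (cases "0 \<le> s")
      case True
      have "(\<integral>\<^sup>+u. indicator {0..t} u * indicator {u<..} s \<partial>lborel) = (\<integral>\<^sup>+u. indicator (if s \<le> t then {0..<s} else {0..t}) u \<partial>lborel)"
        by (intro nn_integral_cong) (auto split: split_indicator)
      also have "\<dots> = ennreal (min s t)"
        using True t by (auto simp: min_def)
      finally show ?thesis by simp
    qed (simp add: birth_rate_def)
  qed
  finally show ?thesis ..
qed

text \<open>
  Up to a fixed time the tail is at most \<open>1\<close>, afterwards it is at most a small multiple of \<open>1 / sqrt u\<close>, whose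
  integral up to \<open>t\<close> is at most \<open>2 * sqrt t\<close>.
\<close>
lemma truncated_delay_small_o:
  assumes lim: "((\<lambda>t. ennreal (sqrt t) * mean_tail t) \<longlongrightarrow> 0) at_top" and \<epsilon>: "0 < \<epsilon>"
  shows "\<forall>\<^sub>F t in at_top. truncated_delay t \<le> ennreal (\<epsilon> * sqrt t)"
proof -
  have "\<forall>\<^sub>F t in at_top. ennreal (sqrt t) * mean_tail t < ennreal (\<epsilon> / 3)"
    using lim \<epsilon> by (intro order_tendstoD(2)) auto
  then obtain T0 where T0: "\<And>t. T0 \<le> t \<Longrightarrow> ennreal (sqrt t) * mean_tail t < ennreal (\<epsilon> / 3)"
    unfolding eventually_at_top_linorder by auto
  define T where "T = max T0 1"
  have T: "0 < T" by (simp add: T_def)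
  have tail: "mean_tail u \<le> ennreal (\<epsilon> / 3 / sqrt u)" if "T \<le> u" for u
  proof -
    obtain r where r: "mean_tail u = ennreal r" "0 \<le> r"
      using mean_tail_le_1[of u] by (cases "mean_tail u") (auto simp: top_unique)
    have "0 < u" using that T by simp
    have "ennreal (sqrt u * r) < ennreal (\<epsilon> / 3)"
      using T0[of u] that r \<open>0 < u\<close> by (simp add: T_def ennreal_mult)
    then have "sqrt u * r < \<epsilon> / 3"
      using r \<open>0 < u\<close> by (subst (asm) ennreal_less_iff) auto
    then have "r \<le> \<epsilon> / 3 / sqrt u"
      using \<open>0 < u\<close> by (simp add: field_simps)
    then show ?thesis unfolding r by (rule ennreal_leI)
  qed
  have bound: "truncated_delay t \<le> ennreal (T + \<epsilon> / 3 * (2 * sqrt t))" if "T \<le> t" for t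
  proof -
    have t: "0 \<le> t" using that T by simp
    have "truncated_delay t \<le> (\<integral>\<^sup>+u. indicator {0..T} u + ennreal (\<epsilon> / 3) * (ennreal (1 / sqrt u) * indicator {T..t} u) \<partial>lborel)"
      unfolding truncated_delay_eq_integral[OF t]
    proof (rule nn_integral_mono)
      fix u
      have "ennreal (\<epsilon> / 3) * ennreal (1 / sqrt u) = ennreal (\<epsilon> / 3 / sqrt u)" if "T \<le> u"
        using \<epsilon> T that by (simp add: ennreal_mult[symmetric])
      then show "indicator {0..t} u * mean_tail u \<le> indicator {0..T} u + ennreal (\<epsilon> / 3) * (ennreal (1 / sqrt u) * indicator {T..t} u)"
        using mean_tail_le_1[of u] tail[of u] by (auto split: split_indicator intro: add_increasing2)
    qed
    also have "\<dots> = ennreal T + ennreal (\<epsilon> / 3) * (\<integral>\<^sup>+u. ennreal (1 / sqrt u) * indicator {T..t} u \<partial>lborel)"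
      using T by (subst nn_integral_add) (auto simp: nn_integral_cmult)
    also have "(\<integral>\<^sup>+u. ennreal (1 / sqrt u) * indicator {T..t} u \<partial>lborel) = ennreal (2 * sqrt t - 2 * sqrt T)"
    proof (rule nn_integral_FTC_Icc[where F="\<lambda>u. 2 * sqrt u" and f="\<lambda>u. 1 / sqrt u"])
      show "((\<lambda>u. 2 * sqrt u) has_real_derivative 1 / sqrt u) (at u)" if "u \<in> {T..t}" for u
        using that T by (auto intro!: derivative_eq_intros simp: field_simps)
    qed (use that T in auto)
    also have "ennreal T + ennreal (\<epsilon> / 3) * ennreal (2 * sqrt t - 2 * sqrt T) \<le> ennreal T + ennreal (\<epsilon> / 3) * ennreal (2 * sqrt t)"
      using T by (intro add_left_mono mult_left_mono ennreal_leI) auto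
    also have "\<dots> = ennreal (T + \<epsilon> / 3 * (2 * sqrt t))"
      using T \<epsilon> t by (simp add: ennreal_mult[symmetric] ennreal_plus[symmetric] del: ennreal_plus)
    finally show ?thesis .
  qed
  have "\<forall>\<^sub>F t in at_top. 3 * T / \<epsilon> \<le> sqrt t"
    using sqrt_at_top unfolding filterlim_at_top by blast
  then show ?thesis
    using eventually_ge_at_top[of T]
  proof eventually_elim
    case (elim t)
    then have "T + \<epsilon> / 3 * (2 * sqrt t) \<le> \<epsilon> * sqrt t" using \<epsilon> by (simp add: field_simps)
    then show ?case using bound[OF elim(2)] by (meson ennreal_leI order_trans)
  qed
qed

end

section \<open>The central limit theorem\<close>

lemma cmod_iexp_diff_le: "cmod (iexp x - iexp y) \<le> \<bar>x - y\<bar>"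
proof -
  have "iexp x - iexp y = iexp y * (iexp (x - y) - 1)"
    by (simp add: algebra_simps exp_add[symmetric] of_real_diff)
  then have "cmod (iexp x - iexp y) = cmod (iexp (x - y) - 1)" by (simp add: norm_mult)
  also have "\<dots> \<le> \<bar>x - y\<bar>" using iexp_approx1[of "x - y" 0] by simp
  finally show ?thesis .
qed

context hawkes begin

lemma char_settled_minus_cluster:
  assumes t: "0 \<le> t" and fin: "AE w in M. cluster_claims t w < \<infinity>"
    and d: "(\<integral>\<^sup>+w. mismatched_claims t w \<partial>M) \<le> ennreal d" "0 \<le> d"
  shows "cmod ((\<integral>w. iexp (c * enn2real (settled_claims t w)) \<partial>M) - (\<integral>w. iexp (c * enn2real (cluster_claims t w)) \<partial>M)) \<le> \<bar>c\<bar> * d"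
proof -
  let ?S = "\<lambda>w. enn2real (settled_claims t w)" and ?C = "\<lambda>w. enn2real (cluster_claims t w)"
    and ?E = "\<lambda>w. enn2real (mismatched_claims t w)"
  have E_fin: "AE w in M. mismatched_claims t w \<noteq> \<infinity>"
    using d by (intro nn_integral_noteq_infinite) (auto simp: top_unique)
  have E_ae: "AE w in M. ennreal (?E w) = mismatched_claims t w"
    using E_fin by eventually_elim (simp add: less_top)
  have int_E: "integrable M ?E"
    using le_less_trans[OF d(1) ennreal_less_top] nn_integral_cong_AE[OF E_ae]
    by (intro integrableI_nonneg) auto
  have mean_E: "(\<integral>w. ?E w \<partial>M) \<le> d"
  proof -
    have "ennreal (\<integral>w. ?E w \<partial>M) = (\<integral>\<^sup>+w. ennreal (?E w) \<partial>M)"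
      using int_E by (intro nn_integral_eq_integral[symmetric]) auto
    also have "\<dots> \<le> ennreal d" using d nn_integral_cong_AE[OF E_ae] by simp
    finally show ?thesis using d(2) by (simp add: ennreal_le_iff)
  qed
  have close: "AE w in M. \<bar>?S w - ?C w\<bar> \<le> ?E w"
    using E_fin fin
  proof eventually_elim
    case (elim w)
    obtain e where e: "mismatched_claims t w = ennreal e" "0 \<le> e" using elim by (cases "mismatched_claims t w") auto
    obtain c where c: "cluster_claims t w = ennreal c" "0 \<le> c" using elim by (cases "cluster_claims t w") auto
    have "settled_claims t w < \<infinity>"
      using settled_le[of t w] e c by (auto simp: less_top[symmetric] top_unique)
    then obtain s where s: "settled_claims t w = ennreal s" "0 \<le> s" by (cases "settled_claims t w") auto
    have "s \<le> c + e" "c \<le> s + e"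
      using settled_le[of t w] cluster_le[of t w] e c s
      by (auto simp: ennreal_plus[symmetric] ennreal_le_iff simp del: ennreal_plus)
    then show ?case using e c s by simp
  qed
  have iS: "integrable M (\<lambda>w. iexp (c * ?S w))" and iC: "integrable M (\<lambda>w. iexp (c * ?C w))"
    by (intro integrable_const_bound[where B=1]; simp)+
  have "cmod ((\<integral>w. iexp (c * ?S w) \<partial>M) - (\<integral>w. iexp (c * ?C w) \<partial>M)) = cmod (\<integral>w. iexp (c * ?S w) - iexp (c * ?C w) \<partial>M)"
    by (subst Bochner_Integration.integral_diff[OF iS iC]) simp
  also have "\<dots> \<le> (\<integral>w. cmod (iexp (c * ?S w) - iexp (c * ?C w)) \<partial>M)"
    by (rule integral_norm_bound)
  also have "\<dots> \<le> (\<integral>w. \<bar>c\<bar> * ?E w \<partial>M)"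
  proof (rule integral_mono_AE)
    show "integrable M (\<lambda>w. cmod (iexp (c * ?S w) - iexp (c * ?C w)))"
      using iS iC by (intro integrable_norm Bochner_Integration.integrable_diff)
    show "integrable M (\<lambda>w. \<bar>c\<bar> * ?E w)" using int_E by simp
    show "AE w in M. cmod (iexp (c * ?S w) - iexp (c * ?C w)) \<le> \<bar>c\<bar> * ?E w"
      using close
    proof eventually_elim
      case (elim w)
      have "cmod (iexp (c * ?S w) - iexp (c * ?C w)) \<le> \<bar>c * ?S w - c * ?C w\<bar>" by (rule cmod_iexp_diff_le)
      also have "\<dots> = \<bar>c\<bar> * \<bar>?S w - ?C w\<bar>" by (simp add: abs_mult[symmetric] right_diff_distrib)
      also have "\<dots> \<le> \<bar>c\<bar> * ?E w" using elim by (intro mult_left_mono) auto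
      finally show ?case .
    qed
  qed
  also have "\<dots> \<le> \<bar>c\<bar> * d" using mean_E by (simp add: mult_left_mono)
  finally show ?thesis .
qed

end

text \<open>
  With \<open>\<theta>\<close> scaled by \<open>1 / sqrt (x \<nu> E D\<^sup>2)\<close>, the linear term of the expansion of the characteristic
  function cancels against the centring and the quadratic term is \<open>- \<theta>\<^sup>2 / 2\<close> for every \<open>x\<close>. The
  remainder vanishes by dominated convergence, a multiple of \<open>D\<^sup>2\<close> being the dominating function.
\<close>
lemma compound_poisson_exponent_LIMSEQ:
  fixes D :: "'v \<Rightarrow> real" and \<theta> :: real
  assumes N: "prob_space N" and D [measurable]: "D \<in> borel_measurable N"
    and D2: "integrable N (\<lambda>w. (D w)\<^sup>2)" and pos: "0 < (\<integral>w. (D w)\<^sup>2 \<partial>N)" and \<nu>: "0 < \<nu>"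
    and X: "filterlim X at_top sequentially"
  defines "s \<equiv> \<lambda>n::nat. \<theta> / sqrt (X n * \<nu> * (\<integral>w. (D w)\<^sup>2 \<partial>N))"
  shows "(\<lambda>n. of_real (\<nu> * X n) * ((\<integral>w. iexp (s n * D w) \<partial>N) - 1)
      - \<i> * of_real (s n * (X n * \<nu> * (\<integral>w. D w \<partial>N)))) \<longlonglongrightarrow> of_real (- (\<theta>\<^sup>2) / 2)"
proof -
  interpret N: prob_space N by fact
  define \<sigma> where "\<sigma> = (\<integral>w. (D w)\<^sup>2 \<partial>N)"
  have \<sigma>: "0 < \<sigma>" using pos by (simp add: \<sigma>_def)
  define P where "P = distr N borel D"
  interpret P: real_distribution P unfolding P_def by (rule N.real_distribution_distr) simp
  have D1: "integrable N D"
    by (rule N.square_integrable_imp_integrable) (use D2 in auto)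
  have moments: "integrable P (\<lambda>x. x ^ k)" if "k \<le> 2" for k
  proof -
    have "k = 0 \<or> k = 1 \<or> k = 2" using that by auto
    then show ?thesis using D1 D2 unfolding P_def by (auto simp: integrable_distr_eq)
  qed
  have char_P: "char P u = (\<integral>w. iexp (u * D w) \<partial>N)" for u
    unfolding char_def P_def by (subst integral_distr) auto
  have m1: "(\<integral>x. x \<partial>P) = (\<integral>w. D w \<partial>N)" and m2: "(\<integral>x. x\<^sup>2 \<partial>P) = \<sigma>"
    unfolding P_def \<sigma>_def by (subst integral_distr; simp)+
  define R where "R u = (\<integral>x. min (6 * x\<^sup>2) (\<bar>u\<bar> * \<bar>x\<bar> ^ 3) \<partial>P)" for u
  have approx: "cmod (char P u - (1 + \<i> * of_real (u * (\<integral>w. D w \<partial>N)) - of_real (u\<^sup>2 * \<sigma> / 2))) \<le> u\<^sup>2 / 6 * R u" for u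
  proof -
    have "(\<Sum>k\<le>2. ((\<i> * u) ^ k / fact k) * P.expectation (\<lambda>x. x ^ k))
      = 1 + \<i> * of_real (u * (\<integral>w. D w \<partial>N)) - of_real (u\<^sup>2 * \<sigma> / 2)"
      using P.prob_space by (simp add: numeral_2_eq_2 m1 m2[unfolded power2_eq_square] power_mult_distrib algebra_simps)
    moreover have "cmod (char P u - (\<Sum>k\<le>2. ((\<i> * u) ^ k / fact k) * P.expectation (\<lambda>x. x ^ k)))
      \<le> (\<bar>u\<bar> ^ 2 / fact (Suc 2)) * P.expectation (\<lambda>x. min (2 * \<bar>x\<bar> ^ 2 * Suc 2) (\<bar>u\<bar> * \<bar>x\<bar> ^ Suc 2))"
      by (rule P.char_approx2) (rule moments)
    ultimately show ?thesis
      by (simp add: R_def numeral_3_eq_3[symmetric] fact_numeral)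
  qed
  have X_pos: "\<forall>\<^sub>F n in sequentially. 0 < X n"
    using X by (rule filterlim_at_top_dense[THEN iffD1, rule_format])
  have s_lim: "s \<longlonglongrightarrow> 0"
  proof -
    have "filterlim (\<lambda>n. \<nu> * \<sigma> * X n) at_top sequentially"
      using \<nu> \<sigma> by (intro filterlim_tendsto_pos_mult_at_top[OF tendsto_const _ X]) simp
    then have "filterlim (\<lambda>n. sqrt (\<nu> * \<sigma> * X n)) at_top sequentially"
      by (rule filterlim_compose[OF sqrt_at_top])
    then have "(\<lambda>n. \<theta> / sqrt (\<nu> * \<sigma> * X n)) \<longlonglongrightarrow> 0"
      by (intro real_tendsto_divide_at_top[OF tendsto_const])
    then show ?thesis unfolding s_def \<sigma>_def[symmetric] by (simp add: mult_ac)
  qed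
  have R_lim: "(\<lambda>n. R (s n)) \<longlonglongrightarrow> 0"
  proof -
    have "(\<lambda>n. R (s n)) \<longlonglongrightarrow> (\<integral>x. 0 \<partial>P)"
      unfolding R_def
    proof (rule integral_dominated_convergence[where w="\<lambda>x. 6 * x\<^sup>2"])
      show "integrable P (\<lambda>x. 6 * x\<^sup>2)" using moments[of 2] by simp
      show "AE x in P. (\<lambda>n. min (6 * x\<^sup>2) (\<bar>s n\<bar> * \<bar>x\<bar> ^ 3)) \<longlonglongrightarrow> 0"
      proof (rule AE_I2)
        fix x :: real
        have "(\<lambda>n. min (6 * x\<^sup>2) (\<bar>s n\<bar> * \<bar>x\<bar> ^ 3)) \<longlonglongrightarrow> min (6 * x\<^sup>2) (\<bar>0\<bar> * \<bar>x\<bar> ^ 3)"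
          by (intro tendsto_min tendsto_intros s_lim)
        then show "(\<lambda>n. min (6 * x\<^sup>2) (\<bar>s n\<bar> * \<bar>x\<bar> ^ 3)) \<longlonglongrightarrow> 0" by simp
      qed
    qed auto
    then show ?thesis by simp
  qed
  let ?L = "\<lambda>n. of_real (\<nu> * X n) * (char P (s n) - 1) - \<i> * of_real (s n * (X n * \<nu> * (\<integral>w. D w \<partial>N)))"
  have "\<forall>\<^sub>F n in sequentially. cmod (?L n - of_real (- (\<theta>\<^sup>2) / 2)) \<le> \<theta>\<^sup>2 / (6 * \<sigma>) * R (s n)"
    using X_pos
  proof eventually_elim
    case (elim n)
    have sq: "\<nu> * X n * (s n)\<^sup>2 = \<theta>\<^sup>2 / \<sigma>"
      using elim \<nu> \<sigma> unfolding s_def \<sigma>_def[symmetric] by (simp add: power_divide)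
    have "of_real (\<nu> * X n) * of_real ((s n)\<^sup>2 * \<sigma> / 2) = complex_of_real (\<nu> * X n * (s n)\<^sup>2 * \<sigma> / 2)"
      by simp
    also have "\<dots> = of_real (\<theta>\<^sup>2 / 2)" unfolding sq using \<sigma> by simp
    finally have q: "of_real (\<nu> * X n) * of_real ((s n)\<^sup>2 * \<sigma> / 2) = complex_of_real (\<theta>\<^sup>2 / 2)" .
    have "?L n - of_real (- (\<theta>\<^sup>2) / 2) = of_real (\<nu> * X n) * (char P (s n)
        - (1 + \<i> * of_real (s n * (\<integral>w. D w \<partial>N)) - of_real ((s n)\<^sup>2 * \<sigma> / 2)))"
      unfolding diff_diff_eq2 right_diff_distrib distrib_left q by (simp add: algebra_simps)
    then have "cmod (?L n - of_real (- (\<theta>\<^sup>2) / 2)) = \<nu> * X n * cmod (char P (s n)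
        - (1 + \<i> * of_real (s n * (\<integral>w. D w \<partial>N)) - of_real ((s n)\<^sup>2 * \<sigma> / 2)))"
      using elim \<nu> by (simp only: norm_mult norm_of_real) simp
    also have "\<dots> \<le> \<nu> * X n * ((s n)\<^sup>2 / 6 * R (s n))"
      using elim \<nu> by (intro mult_left_mono approx) simp
    also have "\<dots> = (\<nu> * X n * (s n)\<^sup>2) / 6 * R (s n)" by simp
    also have "\<dots> = \<theta>\<^sup>2 / (6 * \<sigma>) * R (s n)" unfolding sq by simp
    finally show ?case .
  qed
  moreover have "(\<lambda>n. \<theta>\<^sup>2 / (6 * \<sigma>) * R (s n)) \<longlonglongrightarrow> 0"
    using tendsto_mult_left[OF R_lim, of "\<theta>\<^sup>2 / (6 * \<sigma>)"] by simp
  ultimately have "(\<lambda>n. ?L n - of_real (- (\<theta>\<^sup>2) / 2)) \<longlonglongrightarrow> 0"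
    by (rule Lim_null_comparison)
  then show ?thesis unfolding char_P by (rule LIM_zero_cancel)
qed

theorem theorem5p1:
  fixes Q :: "'a::polish_space measure"
    and h :: "real \<Rightarrow> 'a \<Rightarrow> real"
    and f :: "'a \<Rightarrow> real"
    and \<nu> :: real
    and M :: "'w measure"
    and N :: "'w \<Rightarrow> (real \<times> 'a) measure"
    and M\<^sub>D :: "'v measure"
    and D :: "'v \<Rightarrow> real"
  assumes "prob_space Q" and "sets Q = sets borel"
    and "\<nu> > 0"
    and "(\<lambda>(s, a). h s a) \<in> borel_measurable (restrict_space borel ({0..} \<times> UNIV))"
    and "\<And>s a. s \<ge> 0 \<Longrightarrow> h s a \<ge> 0"
    and "f \<in> borel_measurable borel" and "\<And>a. f a \<ge> 0"
    and "prob_space M"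
    and "marked_hawkes_process M \<nu> Q h N \<or> stationary_marked_hawkes_process M \<nu> Q h N"
    and "prob_space M\<^sub>D" and "cluster_total M\<^sub>D Q h f D"
    and "(\<integral>\<^sup>+a. kappa h a \<partial>Q) < 1"
    and "(\<integral>\<^sup>+a. ennreal ((f a)\<^sup>2) \<partial>Q) < \<infinity>"
    and "(\<integral>\<^sup>+a. (kappa h a)\<^sup>2 \<partial>Q) < \<infinity>"
    and nondegenerate: "(\<integral>\<^sup>+a. ennreal ((f a)\<^sup>2) \<partial>Q) > 0"
    and "((\<lambda>t. ennreal (sqrt t) * (\<integral>\<^sup>+a. emeasure (fertility h a) {t<..} \<partial>Q)) \<longlongrightarrow> 0) at_top"
  shows "weak_conv_along at_top
    (\<lambda>t. distr M borel (\<lambda>\<omega>.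
       (total_claims f N t \<omega> - t * \<nu> * (\<integral>\<omega>. D \<omega> \<partial>M\<^sub>D)) / sqrt (t * \<nu> * (\<integral>\<omega>. (D \<omega>)\<^sup>2 \<partial>M\<^sub>D))))
    std_normal_distribution"
proof -
  interpret Q: prob_space Q by fact
  interpret M: prob_space M by fact
  interpret claim_kernel Q h f
    by unfold_locales (use assms in auto)
  obtain J where J: "J = {0..} \<or> J = UNIV" and hf: "hawkes_from J M \<nu> Q h N"
    using assms(9) unfolding marked_hawkes_process_def stationary_marked_hawkes_process_def by blast
  obtain \<Gamma> :: "nat \<Rightarrow> 'w \<Rightarrow> real" and W :: "nat \<Rightarrow> 'w \<Rightarrow> 'a cascade_tree"
    where \<Gamma>: "\<forall>i. \<Gamma> i \<in> borel_measurable M"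
    and pois: "poisson_process M (density lborel (\<lambda>s. ennreal \<nu> * indicator J s) \<Otimes>\<^sub>M Q)
          (\<lambda>\<omega>. distr (count_space UNIV) borel (\<lambda>i. (\<Gamma> i \<omega>, mark (W i \<omega>) [])))"
    and W: "independent_cascades M Q h
          (vimage_algebra (space M) (\<lambda>\<omega> i. \<Gamma> i \<omega>) (PiM UNIV (\<lambda>_. borel))) UNIV W"
    and N_eq: "\<forall>\<omega>\<in>space M. N \<omega> =
           distr (count_space (SIGMA i:UNIV. individuals (W i \<omega>))) borel
             (\<lambda>(i, u). (\<Gamma> i \<omega> + birth u (W i \<omega>), mark (W i \<omega>) u))"
    using hf unfolding hawkes_from_def by (elim exE conjE)
  interpret hawkes Q h f M \<nu> J \<Gamma> W
    by unfold_locales (use assms(3) J \<Gamma> pois W in auto)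
  note D_meas [measurable] = single_cluster(1)[OF assms(10,11)]
  define \<mu> where "\<mu> = (\<integral>\<omega>. D \<omega> \<partial>M\<^sub>D)"
  define \<sigma> where "\<sigma> = (\<integral>\<omega>. (D \<omega>)\<^sup>2 \<partial>M\<^sub>D)"
  have D2: "integrable M\<^sub>D (\<lambda>\<omega>. (D \<omega>)\<^sup>2)"
    using single_cluster_second_moment[OF assms(10,11,14)] by (intro integrableI_nonneg) auto
  have \<sigma>: "0 < \<sigma>"
  proof -
    have "0 < (\<integral>\<^sup>+\<omega>. ennreal ((D \<omega>)\<^sup>2) \<partial>M\<^sub>D)"
      using nondegenerate single_cluster(4)[OF assms(10,11)] by (rule less_le_trans)
    also have "\<dots> = ennreal \<sigma>"
      unfolding \<sigma>_def using D2 by (intro nn_integral_eq_integral) auto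
    finally show ?thesis by simp
  qed
  define Y where "Y t \<omega> = (total_claims f N t \<omega> - t * \<nu> * \<mu>) / sqrt (t * \<nu> * \<sigma>)" for t \<omega>
  have total: "total_claims f N t \<omega> = enn2real (settled_claims t \<omega>)" if "\<omega> \<in> space M" for t \<omega>
    using bspec[OF N_eq that] by (rule total_claims_eq)
  have Y_eq: "Y t \<omega> = (enn2real (settled_claims t \<omega>) - t * \<nu> * \<mu>) / sqrt (t * \<nu> * \<sigma>)" if "\<omega> \<in> space M" for t \<omega>
    by (simp add: Y_def total[OF that])
  have Y_meas [measurable]: "Y t \<in> borel_measurable M" for t
    by (subst measurable_cong[OF Y_eq]) measurable
  obtain K where K: "0 \<le> K"
    "\<And>t. 0 \<le> t \<Longrightarrow> (\<integral>\<^sup>+\<omega>. mismatched_claims t \<omega> \<partial>M) \<le> ennreal K * truncated_delay t"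
    using mean_mismatched_claims by blast
  have tail: "((\<lambda>t. ennreal (sqrt t) * mean_tail t) \<longlongrightarrow> 0) at_top"
    using assms(16) unfolding mean_tail_def .
  have conv: "weak_conv_m (\<lambda>n. distr M borel (Y (X n))) std_normal_distribution"
    if X: "filterlim X at_top sequentially" for X :: "nat \<Rightarrow> real"
  proof (rule levy_continuity)
    show "real_distribution (distr M borel (Y (X n)))" for n
      by (rule M.real_distribution_distr) simp
    show "real_distribution std_normal_distribution" by (rule real_dist_normal_dist)
    fix \<theta> :: real
    define s where "s n = \<theta> / sqrt (X n * \<nu> * \<sigma>)" for n
    define a where "a n = exp (- \<i> * of_real (s n * (X n * \<nu> * \<mu>)))" for n
    define S where "S n = (\<integral>\<omega>. iexp (s n * enn2real (settled_claims (X n) \<omega>)) \<partial>M)" for n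
    define C where "C n = (\<integral>\<omega>. iexp (s n * enn2real (cluster_claims (X n) \<omega>)) \<partial>M)" for n
    have a_norm: "cmod (a n) = 1" for n by (simp add: a_def)
    have char_Y: "char (distr M borel (Y (X n))) \<theta> = a n * S n" for n
    proof -
      have "char (distr M borel (Y (X n))) \<theta> = (\<integral>\<omega>. iexp (\<theta> * Y (X n) \<omega>) \<partial>M)"
        unfolding char_def by (subst integral_distr) auto
      also have "\<dots> = (\<integral>\<omega>. a n * iexp (s n * enn2real (settled_claims (X n) \<omega>)) \<partial>M)"
        by (intro Bochner_Integration.integral_cong)
          (simp_all add: Y_eq a_def s_def exp_add[symmetric] diff_divide_distrib algebra_simps)
      finally show ?thesis by (simp add: S_def)
    qed
    have X_pos: "\<forall>\<^sub>F n in sequentially. 0 < X n"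
      using X by (rule filterlim_at_top_dense[THEN iffD1, rule_format])
    have "(\<lambda>n. a n * C n) \<longlonglongrightarrow> exp (of_real (- (\<theta>\<^sup>2) / 2))"
    proof (rule Lim_transform_eventually)
      show "(\<lambda>n. exp (of_real (\<nu> * X n) * ((\<integral>\<omega>. iexp (s n * D \<omega>) \<partial>M\<^sub>D) - 1)
          - \<i> * of_real (s n * (X n * \<nu> * \<mu>)))) \<longlonglongrightarrow> exp (of_real (- (\<theta>\<^sup>2) / 2))"
        unfolding s_def \<mu>_def \<sigma>_def
        by (intro tendsto_exp compound_poisson_exponent_LIMSEQ[OF assms(10) D_meas D2 \<sigma>[unfolded \<sigma>_def] assms(3) X])
      show "\<forall>\<^sub>F n in sequentially. exp (of_real (\<nu> * X n) * ((\<integral>\<omega>. iexp (s n * D \<omega>) \<partial>M\<^sub>D) - 1)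
          - \<i> * of_real (s n * (X n * \<nu> * \<mu>))) = a n * C n"
        using X_pos
      proof eventually_elim
        case (elim n)
        have "C n = exp (of_real (\<nu> * X n) * ((\<integral>\<omega>. iexp (s n * D \<omega>) \<partial>M\<^sub>D) - 1))"
          unfolding C_def using elim
          by (intro char_cluster_claims(2) single_cluster(5)[OF assms(10,11)]) simp
        then show ?case by (simp add: a_def exp_add[symmetric])
      qed
    qed
    moreover have "(\<lambda>n. a n * S n - a n * C n) \<longlonglongrightarrow> 0"
    proof (rule tendstoI)
      fix e :: real assume e: "0 < e"
      \<comment> \<open>\<open>q * \<epsilon>\<close> bounds the effect of a mean difference of \<open>K * \<epsilon> * sqrt (X n)\<close> on the normalised claims.\<close>
      define q where "q = \<bar>\<theta>\<bar> * K / sqrt (\<nu> * \<sigma>)"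
      have q: "0 \<le> q" using K \<sigma> assms(3) by (simp add: q_def)
      define \<epsilon> where "\<epsilon> = e / (q + 1)"
      have \<epsilon>: "0 < \<epsilon>" "q * \<epsilon> < e" using e q by (auto simp: \<epsilon>_def field_simps)
      have "\<forall>\<^sub>F n in sequentially. truncated_delay (X n) \<le> ennreal (\<epsilon> * sqrt (X n))"
        using X truncated_delay_small_o[OF tail \<epsilon>(1)] by (rule filterlim_iff[THEN iffD1, rule_format])
      then show "\<forall>\<^sub>F n in sequentially. dist (a n * S n - a n * C n) 0 < e"
        using X_pos
      proof eventually_elim
        case (elim n)
        have "(\<integral>\<^sup>+\<omega>. mismatched_claims (X n) \<omega> \<partial>M) \<le> ennreal K * truncated_delay (X n)"
          using elim by (intro K(2)) simp
        also have "\<dots> \<le> ennreal K * ennreal (\<epsilon> * sqrt (X n))"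
          using elim by (intro mult_left_mono) auto
        also have "\<dots> = ennreal (K * (\<epsilon> * sqrt (X n)))"
          using K(1) \<epsilon> elim by (simp add: ennreal_mult)
        finally have mean: "(\<integral>\<^sup>+\<omega>. mismatched_claims (X n) \<omega> \<partial>M) \<le> ennreal (K * (\<epsilon> * sqrt (X n)))" .
        have "dist (a n * S n - a n * C n) 0 = cmod (S n - C n)"
          using a_norm[of n] by (simp add: right_diff_distrib[symmetric] norm_mult)
        also have "\<dots> \<le> \<bar>s n\<bar> * (K * (\<epsilon> * sqrt (X n)))"
          unfolding S_def C_def
          using elim K(1) \<epsilon> mean char_cluster_claims(1)[OF _ single_cluster(5)[OF assms(10,11)]]
          by (intro char_settled_minus_cluster) auto
        also have "\<dots> = q * \<epsilon>"
          using elim assms(3) \<sigma> by (simp add: s_def q_def real_sqrt_mult abs_mult)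
        also have "\<dots> < e" by fact
        finally show ?case .
      qed
    qed
    ultimately have "(\<lambda>n. (a n * S n - a n * C n) + a n * C n) \<longlonglongrightarrow> 0 + exp (of_real (- (\<theta>\<^sup>2) / 2))"
      by (intro tendsto_add)
    then show "(\<lambda>n. char (distr M borel (Y (X n))) \<theta>) \<longlonglongrightarrow> char std_normal_distribution \<theta>"
      unfolding char_Y char_std_normal_distribution exp_of_real[symmetric] by simp
  qed
  have "weak_conv_along at_top (\<lambda>t. distr M borel (Y t)) std_normal_distribution"
    unfolding weak_conv_along_def
  proof (intro allI impI tendsto_at_topI_sequentially)
    fix x and X :: "nat \<Rightarrow> real"
    assume "isCont (cdf std_normal_distribution) x" "filterlim X at_top sequentially"
    then show "(\<lambda>n. cdf (distr M borel (Y (X n))) x) \<longlonglongrightarrow> cdf std_normal_distribution x"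
      using conv[of X] unfolding weak_conv_m_def weak_conv_def by blast
  qed
  then show ?thesis unfolding Y_def \<mu>_def \<sigma>_def .
qed

end
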